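(* Consider a prior $\Pi$ consisting of an arbitrary prior on $\eta=(\eta^a,\eta^b)$ and an independent Dirichlet process prior on $F$ with finite base measure $\nu$ ($\nu=0$, the Bayesian bootstrap, being allowed). Assume that there exist measurable sets $\mathcal H_n$ of functions $\eta=(\eta^a,\eta^b)$ such that $$\Pi(\eta\in\mathcal H_n\mid X^{(n)})\to^{P_0}1,\qquad \sup_{b=\Psi(\eta^b):\,\eta\in\mathcal H_n}\|b-b_0\|_{L^2(F_0)}\to 0,\qquad \sup_{b=\Psi(\eta^b):\,\eta\in\mathcal H_n}\bigl|\mathbb G_n[b-b_0]\bigr|\to^{P_0}0 .$$ For $t\in\mathbb R$ let $\eta_t(\eta)=\bigl(\eta^a,\ \eta^b-\tfrac{t}{\sqrt n}\,a_0\bigr)$. If for every $t\in\mathbb R$ $$\frac{\int_{\mathcal H_n}\prod_{i=1}^n p_{\eta_t(\eta)}(R_i,R_iY_i\mid Z_i)\,d\Pi(\eta)}{\int_{\mathcal H_n}\prod_{i=1}^n p_{\eta}(R_i,R_iY_i\mid Z_i)\,d\Pi(\eta)}\to^{P_0}1,$$ then the posterior distribution of $\chi=\int b\,dF$ satisfies the semiparametric Bernstein--von Mises theorem.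
   Context: Model. Let $\mathcal Z$ be a Polish space. One observes $X^{(n)}=(X_1,\dots,X_n)$, i.i.d. copies of $X=(Z,R,RY)$, where $Z\in\mathcal Z$, $R,Y\in\{0,1\}$, and $R,Y$ are conditionally independent given $Z$. Parameters: $F$ = law of $Z$, $1/a(z)=P(R=1\mid Z=z)$, $b(z)=P(Y=1\mid Z=z)$. With $\Psi(x)=1/(1+e^{-x})$ set $\eta^a=\Psi^{-1}(1/a)$, $\eta^b=\Psi^{-1}(b)$. The conditional density of $(R,RY)$ given $Z=z$ is $p_\eta(r,ry\mid z)=(1/a(z))^r(1-1/a(z))^{1-r}b(z)^{ry}(1-b(z))^{r(1-y)}$. The true parameters are $(a_0,b_0,F_0)$; $P_0$ denotes the corresponding law of the data, and $\to^{P_0}$ convergence in $P_0$-probability (outer probability if needed). Standing assumption: $1/a_0$ and $b_0$ are bounded away from $0$ and $1$, and the density $f_0$ of $F_0$ with respect to a dominating measure is bounded away from $0$ and $\infty$. For $h$ a function of $X$ (or of $Z$), $\mathbb G_n[h]=\sqrt n\bigl(n^{-1}\sum_{i=1}^n h(X_i)-P_0h\bigr)$. Posterior. Given $X^{(n)}$, $(a,b)$ and $F$ are independent; $F\mid X^{(n)}\sim DP(\nu+n\mathbb F_n)$ (Dirichlet process), with $\mathbb F_n=n^{-1}\sum_{i=1}^n\delta_{Z_i}$ and $\nu$ a finite measure on $\mathcal Z$; and the posterior of $\eta=(\eta^a,\eta^b)$ has density proportional to $\prod_{i=1}^n p_\eta(R_i,R_iY_i\mid Z_i)$ with respect to its prior.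 Semiparametric Bernstein--von Mises theorem. Let $\chi=\int b\,dF$, $\chi_0=\int b_0\,dF_0$, $\widetilde\chi_0(X)=Ra_0(Z)(Y-b_0(Z))+b_0(Z)-\chi_0$, $V_0=P_0\widetilde\chi_0^2=\int a_0b_0(1-b_0)\,dF_0+\int b_0^2\,dF_0-\chi_0^2$, and let $\widehat\chi_n$ be any random sequence with $\widehat\chi_n=\chi_0+n^{-1}\sum_{i=1}^n\widetilde\chi_0(X_i)+o_{P_0}(n^{-1/2})$. The posterior satisfies the semiparametric Bernstein--von Mises theorem if $d_{BL}\bigl(\mathcal L(\sqrt n(\chi-\widehat\chi_n)\mid X^{(n)}),N(0,V_0)\bigr)\to^{P_0}0$, where $\mathcal L(\cdot\mid X^{(n)})$ is the posterior law and $d_{BL}$ is the bounded Lipschitz distance between probability measures on $\mathbb R$. *)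

theory Defs
  imports "HOL-Probability.Probability"
begin

definition tendsto_in_outer_prob :: "'m measure \<Rightarrow> (nat \<Rightarrow> 'm \<Rightarrow> real) \<Rightarrow> real \<Rightarrow> bool" where
  "tendsto_in_outer_prob M W c \<longleftrightarrow>
     (\<forall>\<epsilon>>0. (\<lambda>n. outer_measure_of M {\<omega> \<in> space M. \<epsilon> < \<bar>W n \<omega> - c\<bar>}) \<longlonglongrightarrow> 0)"

definition BL1 :: "(real \<Rightarrow> real) set" where
  "BL1 = {f. (\<forall>x. \<bar>f x\<bar> \<le> 1) \<and> 1-lipschitz_on UNIV f}"

definition d_BL :: "real measure \<Rightarrow> real measure \<Rightarrow> real" where
  "d_BL \<mu> \<nu> = (SUP f\<in>BL1. \<bar>(\<integral>x. f x \<partial>\<mu>) - (\<integral>x. f x \<partial>\<nu>)\<bar>)"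

definition normal_law :: "real \<Rightarrow> real \<Rightarrow> real measure" where
  "normal_law m v = density lborel (\<lambda>x. ennreal (normal_density m (sqrt v) x))"

definition L2_norm :: "'z measure \<Rightarrow> ('z \<Rightarrow> real) \<Rightarrow> real" where
  "L2_norm F h = sqrt (\<integral>z. (h z)\<^sup>2 \<partial>F)"

text \<open>The values 0 and 1 of R, Y and RY are encoded as booleans; an observation is a
  triple (z, r, ry).\<close>

type_synonym 'z obs = "'z \<times> bool \<times> bool"

definition obs_space :: "'z::topological_space obs measure" where
  "obs_space = borel \<Otimes>\<^sub>M count_space UNIV \<Otimes>\<^sub>M count_space UNIV"

text \<open>Joint law of (Z, R, Y): Z has law F and, given Z = z, the variables R and Y are independent
  Bernoulli variables with success probabilities 1 / a z and b z.\<close>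

definition full_law ::
  "('z \<Rightarrow> real) \<Rightarrow> ('z \<Rightarrow> real) \<Rightarrow> 'z::topological_space measure \<Rightarrow> 'z obs measure" where
  "full_law a b F =
     density (F \<Otimes>\<^sub>M count_space UNIV \<Otimes>\<^sub>M count_space UNIV)
       (\<lambda>(z, r, y). ennreal ((if r then 1 / a z else 1 - 1 / a z) * (if y then b z else 1 - b z)))"

definition obs_law ::
  "('z \<Rightarrow> real) \<Rightarrow> ('z \<Rightarrow> real) \<Rightarrow> 'z::topological_space measure \<Rightarrow> 'z obs measure" where
  "obs_law a b F = distr (full_law a b F) obs_space (\<lambda>(z, r, y). (z, r, r \<and> y))"

text \<open>Conditional density of (R, RY) given Z. The exponents are natural numbers; on the support,
  where ry implies r, the last one is r - ry = r (1 - y).\<close>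

definition cond_density :: "('z \<Rightarrow> real) \<Rightarrow> ('z \<Rightarrow> real) \<Rightarrow> 'z obs \<Rightarrow> real" where
  "cond_density a b = (\<lambda>(z, r, ry).
     (1 / a z) ^ of_bool r * (1 - 1 / a z) ^ (1 - of_bool r) *
     b z ^ of_bool ry * (1 - b z) ^ (of_bool r - of_bool ry))"

definition emp_process ::
  "'z obs measure \<Rightarrow> nat \<Rightarrow> (nat \<Rightarrow> 'z obs) \<Rightarrow> ('z obs \<Rightarrow> real) \<Rightarrow> real" where
  "emp_process P n x h = sqrt n * ((\<Sum>i<n. h (x i)) / n - (\<integral>w. h w \<partial>P))"

definition Psi :: "real \<Rightarrow> real" where
  "Psi x = 1 / (1 + exp (- x))"

type_synonym 'z eta = "('z \<Rightarrow> real) \<times> ('z \<Rightarrow> real)"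

definition a_of :: "'z eta \<Rightarrow> 'z \<Rightarrow> real" where
  "a_of \<eta> z = 1 / Psi (fst \<eta> z)"

definition b_of :: "'z eta \<Rightarrow> 'z \<Rightarrow> real" where
  "b_of \<eta> z = Psi (snd \<eta> z)"

definition likelihood :: "nat \<Rightarrow> (nat \<Rightarrow> 'z obs) \<Rightarrow> 'z eta \<Rightarrow> real" where
  "likelihood n x \<eta> = (\<Prod>i<n. cond_density (a_of \<eta>) (b_of \<eta>) (x i))"

text \<open>A prior is a probability measure on a space of pairs of functions. Its \<open>\<sigma>\<close>-algebra is
  arbitrary, except that the two evaluation maps have to be jointly measurable, so that likelihoods
  and integrals of b are random variables.\<close>

definition eta_prior :: "'z::topological_space eta measure \<Rightarrow> bool" where
  "eta_prior Q \<longleftrightarrow> prob_space Q \<and>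
     (\<lambda>(\<eta>, z). fst \<eta> z) \<in> borel_measurable (Q \<Otimes>\<^sub>M borel) \<and>
     (\<lambda>(\<eta>, z). snd \<eta> z) \<in> borel_measurable (Q \<Otimes>\<^sub>M borel)"

definition eta_posterior ::
  "'z eta measure \<Rightarrow> nat \<Rightarrow> (nat \<Rightarrow> 'z obs) \<Rightarrow> 'z eta measure" where
  "eta_posterior Q n x =
     density Q (\<lambda>\<eta>. ennreal (likelihood n x \<eta> / (\<integral>\<eta>'. likelihood n x \<eta>' \<partial>Q)))"

definition eta_shift :: "('z \<Rightarrow> real) \<Rightarrow> nat \<Rightarrow> real \<Rightarrow> 'z eta \<Rightarrow> 'z eta" where
  "eta_shift a0 n t \<eta> = (fst \<eta>, \<lambda>z. snd \<eta> z - t / sqrt n * a0 z)"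

text \<open>Gamma distribution with shape s and rate 1; degenerate at 0 for s = 0.\<close>

definition gamma_law :: "real \<Rightarrow> real measure" where
  "gamma_law s =
     (if s = 0 then return borel 0
      else density lborel (\<lambda>x. ennreal (if 0 < x then x powr (s - 1) * exp (- x) / Gamma s else 0)))"

text \<open>Dirichlet distribution as the law of normalised independent gamma variables; coordinates
  with parameter 0 vanish almost surely.\<close>

definition dirichlet_law :: "'i set \<Rightarrow> ('i \<Rightarrow> real) \<Rightarrow> ('i \<Rightarrow> real) measure" where
  "dirichlet_law I s =
     distr (\<Pi>\<^sub>M i\<in>I. gamma_law (s i)) (\<Pi>\<^sub>M i\<in>I. borel) (\<lambda>g. \<lambda>i\<in>I. g i / (\<Sum>j\<in>I. g j))"

text \<open>D is the law of a random probability measure F such that (F(A_0), ..., F(A_{k-1})) has a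
  Dirichlet distribution for every finite measurable partition. No such D exists if the base
  measure \<open>\<alpha>\<close> is zero.\<close>

definition dirichlet_process ::
  "'z::topological_space measure \<Rightarrow> 'z measure measure \<Rightarrow> bool" where
  "dirichlet_process \<alpha> D \<longleftrightarrow>
     prob_space D \<and> sets D = sets (prob_algebra borel) \<and>
     (\<forall>(k::nat) A. (\<forall>i<k. A i \<in> sets borel) \<and> disjoint_family_on A {..<k} \<and> (\<Union>i<k. A i) = UNIV \<longrightarrow>
        distr D (\<Pi>\<^sub>M i\<in>{..<k}. borel) (\<lambda>F. \<lambda>i\<in>{..<k}. measure F (A i)) =
        dirichlet_law {..<k} (\<lambda>i. measure \<alpha> (A i)))"

definition add_measure :: "'a measure \<Rightarrow> 'a measure \<Rightarrow> 'a measure" where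
  "add_measure \<mu> \<nu> = measure_of (space \<mu>) (sets \<mu>) (\<lambda>A. emeasure \<mu> A + emeasure \<nu> A)"

definition empirical_measure :: "nat \<Rightarrow> (nat \<Rightarrow> 'z::topological_space) \<Rightarrow> 'z measure" where
  "empirical_measure n z = distr (uniform_count_measure {..<n}) borel z"

definition dp_posterior_base ::
  "'z::topological_space measure \<Rightarrow> nat \<Rightarrow> (nat \<Rightarrow> 'z obs) \<Rightarrow> 'z measure" where
  "dp_posterior_base \<nu> n x =
     add_measure \<nu> (scale_measure (of_nat n) (empirical_measure n (\<lambda>i. fst (x i))))"

definition chi :: "('z \<Rightarrow> real) \<Rightarrow> 'z measure \<Rightarrow> real" where
  "chi b F = (\<integral>z. b z \<partial>F)"

text \<open>Efficient influence function; \<open>R a (Y - b)\<close> is written as \<open>a (RY - R b)\<close>.\<close>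

definition influence ::
  "('z \<Rightarrow> real) \<Rightarrow> ('z \<Rightarrow> real) \<Rightarrow> 'z measure \<Rightarrow> 'z obs \<Rightarrow> real" where
  "influence a0 b0 F0 =
     (\<lambda>(z, r, ry). a0 z * (of_bool ry - of_bool r * b0 z) + b0 z - chi b0 F0)"

definition eff_var ::
  "('z \<Rightarrow> real) \<Rightarrow> ('z \<Rightarrow> real) \<Rightarrow> 'z::topological_space measure \<Rightarrow> real" where
  "eff_var a0 b0 F0 = (\<integral>w. (influence a0 b0 F0 w)\<^sup>2 \<partial>obs_law a0 b0 F0)"

definition efficient_sequence ::
  "'m measure \<Rightarrow> (nat \<Rightarrow> 'm \<Rightarrow> 'z obs) \<Rightarrow> ('z \<Rightarrow> real) \<Rightarrow> ('z \<Rightarrow> real) \<Rightarrow> 'z measure \<Rightarrow>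
   (nat \<Rightarrow> 'm \<Rightarrow> real) \<Rightarrow> bool" where
  "efficient_sequence M X a0 b0 F0 c \<longleftrightarrow>
     (\<forall>n. c n \<in> borel_measurable M) \<and>
     tendsto_in_outer_prob M
       (\<lambda>n \<omega>. sqrt n * (c n \<omega> - (chi b0 F0 + (\<Sum>i<n. influence a0 b0 F0 (X i \<omega>)) / n))) 0"

text \<open>Posterior law of \<open>\<surd>n (\<chi> - c)\<close>, where D is the posterior law of F.\<close>

definition chi_posterior ::
  "'z eta measure \<Rightarrow> 'z measure measure \<Rightarrow> nat \<Rightarrow> (nat \<Rightarrow> 'z obs) \<Rightarrow> real \<Rightarrow> real measure" where
  "chi_posterior Q D n x c =
     distr (eta_posterior Q n x \<Otimes>\<^sub>M D) borel (\<lambda>(\<eta>, F). sqrt n * (chi (b_of \<eta>) F - c))"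

definition semiparametric_BvM ::
  "'m measure \<Rightarrow> (nat \<Rightarrow> 'm \<Rightarrow> 'z obs) \<Rightarrow> ('z \<Rightarrow> real) \<Rightarrow> ('z \<Rightarrow> real) \<Rightarrow>
   'z::topological_space measure \<Rightarrow> 'z eta measure \<Rightarrow>
   (nat \<Rightarrow> (nat \<Rightarrow> 'z obs) \<Rightarrow> 'z measure measure) \<Rightarrow> bool" where
  "semiparametric_BvM M X a0 b0 F0 Q D \<longleftrightarrow>
     (\<forall>c. efficient_sequence M X a0 b0 F0 c \<longrightarrow>
        tendsto_in_outer_prob M
          (\<lambda>n \<omega>. d_BL (chi_posterior Q (D n (\<lambda>i. X i \<omega>)) n (\<lambda>i. X i \<omega>) (c n \<omega>))
                      (normal_law 0 (eff_var a0 b0 F0))) 0)"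

end

theory Submission
  imports Defs "HOL-Complex_Analysis.Conformal_Mappings" "HOL-Real_Asymp.Real_Asymp"
begin

text \<open>
  Write \<open>\<chi> - c = (\<integral>b dF - P\<^sub>n b) + (P\<^sub>n b - c)\<close>. Conditionally on \<open>\<eta>\<close>, a Dirichlet process on a finite
  partition is a normalised vector of independent gamma variables, whose Laplace transform is
  explicit; hence \<open>\<surd>n (\<integral>b dF - P\<^sub>n b)\<close> is close to \<open>N(0, Var b0)\<close>, uniformly in \<open>\<eta>\<close>. For the second
  term, the likelihood ratio of \<open>\<eta>\<close> to its shift along \<open>t a0 / \<surd>n\<close> cancels the factor
  \<open>exp (t \<surd>n (P\<^sub>n b - c))\<close> up to \<open>exp (t\<^sup>2 P0[R a0\<^sup>2 b0 (1 - b0)] / 2)\<close>, so that the assumption on the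
  shifted likelihood gives the limit of the posterior Laplace transform.

  The cancellation leaves the multiplier process \<open>n\<^sup>-\<^sup>1\<^sup>/\<^sup>2 \<Sum> (R\<^sub>i a0(Z\<^sub>i) - 1) (b - b0)(Z\<^sub>i)\<close>, and the
  variances require \<open>P\<^sub>n (b - b0)\<^sup>2 \<rightarrow> 0\<close>, both uniformly over the sieve, although only the empirical
  process at \<open>b - b0\<close> is assumed to vanish. Both are bounded by the Rademacher process (the first by
  convex domination, the second by a Khintchine type inequality), and desymmetrisation bounds its
  mean by that of the empirical process. The latter mean tends to zero because the supremum has
  bounded differences, hence bounded variance.
\<close>

section \<open>Laplace transforms and the bounded Lipschitz distance\<close>

text \<open>Real Laplace transforms are forced by the hypothesis on the shifted likelihood: a shift
  of \<eta> by a real multiple of \<open>a0\<close> stays in the parameter space, an imaginary one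
  does not. The price is that exponential moments are taken, and outside the sieve nothing controls
  an exponent of order sqrt n. So the posterior is first conditioned on the sieve, which hardly
  moves integrals of bounded test functions, and only the conditioned law is transformed.

  Posterior quantities are random and some may fail to be measurable, so no almost surely convergent
  subsequence is extracted. Instead one tolerance is fixed, finitely many events of outer
  probability close to one are intersected, and on the intersection the comparison is deterministic.
  This is why the limit theorems below are uniform in the regression function, the partition and the
  sample.

  The mean of the supremum is controlled through its scale: replacing one observation moves the
  supremum of the empirical process by at most 2 / sqrt n, so its variance is at most 4, whatever
  the size of the class.\<close>

lemma mgf_power_series:
  assumes "real_distribution \<mu>" and int: "\<And>t. integrable \<mu> (\<lambda>x. exp (t * x :: real))"
  shows "(\<lambda>n. complex_of_real (\<integral>x. x ^ n / fact n \<partial>\<mu>) * z ^ n) sums (\<integral>x. exp (z * of_real x) \<partial>\<mu>)"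
proof -
  interpret real_distribution \<mu> by fact
  define r where "r = cmod z"
  \<comment> \<open>For |z| = r this dominates every partial sum of the exponential series of
    \<open>z * x\<close>, which allows sum and integral to be interchanged.\<close>
  let ?e = "\<lambda>x. exp (r * x) + exp (- r * x)"
  have inte: "integrable \<mu> ?e" using int[of r] int[of "-r"] by simp
  have bnd: "(\<Sum>i<N. \<bar>r * x\<bar> ^ i / fact i) \<le> ?e x" for N x
  proof -
    have "(\<Sum>i<N. \<bar>r * x\<bar> ^ i / fact i) \<le> (\<Sum>i. \<bar>r * x\<bar> ^ i /\<^sub>R fact i)"
      using summable_exp_generic[of "\<bar>r * x\<bar>"]
      by (subst (1) divide_inverse) (auto intro!: sum_le_suminf simp: field_simps)
    also have "\<dots> = exp \<bar>r * x\<bar>" by (simp add: exp_def)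
    also have "\<dots> \<le> ?e x" by (cases "r * x \<ge> 0") (auto simp: add_increasing add_increasing2)
    finally show ?thesis .
  qed
  have tm: "\<bar>r * x\<bar> ^ i / fact i \<le> ?e x" for i x
  proof -
    have "\<bar>r * x\<bar> ^ i / fact i \<le> (\<Sum>i<Suc i. \<bar>r * x\<bar> ^ i / fact i)"
      by (intro member_le_sum[where i=i]) auto
    then show ?thesis using bnd[of x "Suc i"] by linarith
  qed
  have fn: "norm (((z * complex_of_real x) ^ n) /\<^sub>R fact n) = \<bar>r * x\<bar> ^ n / fact n" for x n
    by (simp add: r_def norm_mult norm_power abs_mult divide_inverse mult.commute)
  have i1: "integrable \<mu> (\<lambda>x. (z * complex_of_real x) ^ n /\<^sub>R fact n)" for n
    by (rule Bochner_Integration.integrable_bound[OF inte]) (auto simp del: norm_scaleR simp: fn intro!: AE_I2 order.trans[OF tm])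
  have i2: "summable (\<lambda>n. \<integral>x. norm ((z * complex_of_real x) ^ n /\<^sub>R fact n) \<partial>\<mu>)"
  proof (rule summableI_nonneg_bounded)
    fix N
    have "(\<Sum>n<N. \<integral>x. norm ((z * complex_of_real x) ^ n /\<^sub>R fact n) \<partial>\<mu>)
       = (\<integral>x. (\<Sum>n<N. norm ((z * complex_of_real x) ^ n /\<^sub>R fact n)) \<partial>\<mu>)"
      by (subst Bochner_Integration.integral_sum) (auto intro!: integrable_norm i1 simp del: norm_scaleR)
    also have "\<dots> \<le> (\<integral>x. ?e x \<partial>\<mu>)"
    proof (rule integral_mono)
      show "integrable \<mu> (\<lambda>x. \<Sum>n<N. norm ((z * complex_of_real x) ^ n /\<^sub>R fact n))"
        by (intro Bochner_Integration.integrable_sum Bochner_Integration.integrable_norm i1)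
    qed (use inte bnd in \<open>simp_all only: fn\<close>)
    finally show "(\<Sum>n<N. \<integral>x. norm ((z * complex_of_real x) ^ n /\<^sub>R fact n) \<partial>\<mu>) \<le> (\<integral>x. ?e x \<partial>\<mu>)" .
  qed auto
  have "(\<lambda>n. \<integral>x. (z * complex_of_real x) ^ n /\<^sub>R fact n \<partial>\<mu>) sums
        (\<integral>x. (\<Sum>n. (z * complex_of_real x) ^ n /\<^sub>R fact n) \<partial>\<mu>)"
  proof (rule sums_integral[OF i1 _ i2])
    show "AE x in \<mu>. summable (\<lambda>n. norm ((z * complex_of_real x) ^ n /\<^sub>R fact n))"
      using summable_norm_exp by auto
  qed
  also have "(\<lambda>n. \<integral>x. (z * complex_of_real x) ^ n /\<^sub>R fact n \<partial>\<mu>)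
     = (\<lambda>n. complex_of_real (\<integral>x. x ^ n / fact n \<partial>\<mu>) * z ^ n)"
  proof
    fix n
    have "(\<integral>x. (z * complex_of_real x) ^ n /\<^sub>R fact n \<partial>\<mu>) = (\<integral>x. complex_of_real (x ^ n / fact n) * z ^ n \<partial>\<mu>)"
      by (intro Bochner_Integration.integral_cong refl) (simp add: power_mult_distrib scaleR_conv_of_real field_simps)
    then show "(\<integral>x. (z * complex_of_real x) ^ n /\<^sub>R fact n \<partial>\<mu>) = complex_of_real (\<integral>x. x ^ n / fact n \<partial>\<mu>) * z ^ n"
      by (simp only: integral_mult_left_zero integral_complex_of_real)
  qed
  finally show ?thesis by (simp add: exp_def)
qed

text \<open>The difference of the two transforms is a convergent power series, hence holomorphic. It
  vanishes at the rationals, which accumulate at 0, so it vanishes on the imaginary axis too, where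
  characteristic functions determine the law. Rational arguments are enough for the compactness
  argument below, which exhausts a countable set of \<open>t\<close>.\<close>

lemma mgf_unique:
  assumes \<mu>: "real_distribution \<mu>" and \<tau>: "real_distribution \<tau>"
    and i\<mu>: "\<And>t. integrable \<mu> (\<lambda>x. exp (t * x :: real))" and i\<tau>: "\<And>t. integrable \<tau> (\<lambda>x. exp (t * x :: real))"
    and eq: "\<And>t. t \<in> \<rat> \<Longrightarrow> (\<integral>x. exp (t * x) \<partial>\<mu>) = (\<integral>x. exp (t * x) \<partial>\<tau>)"
  shows "\<mu> = \<tau>"
proof (rule Levy_uniqueness[OF \<mu> \<tau>], rule ext)
  fix s :: real
  define f where "f z = (\<integral>x. exp (z * complex_of_real x) \<partial>\<mu>) - (\<integral>x. exp (z * complex_of_real x) \<partial>\<tau>)" for z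
  define a where "a n = complex_of_real (\<integral>x. x ^ n / fact n \<partial>\<mu>) - complex_of_real (\<integral>x. x ^ n / fact n \<partial>\<tau>)" for n
  \<comment> \<open>The ball must contain \<i> s, and the summand 2 leaves room for the sequence 1 /
    (n + 1) of rational zeros.\<close>
  define r where "r = \<bar>s\<bar> + 2"
  have "(\<lambda>n. a n * (w - 0) ^ n) sums f w" for w
    using sums_diff[OF mgf_power_series[OF \<mu> i\<mu>, of w] mgf_power_series[OF \<tau> i\<tau>, of w]]
    by (simp add: f_def a_def algebra_simps)
  then have hol: "f holomorphic_on ball 0 r" by (rule power_series_holomorphic)
  have f0: "f (of_real t) = 0" if "t \<in> \<rat>" for t
  proof -
    have "(\<integral>x. exp (complex_of_real t * complex_of_real x) \<partial>m) = complex_of_real (\<integral>x. exp (t * x) \<partial>m)" for m :: "real measure"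
      by (simp add: exp_of_real integral_complex_of_real[symmetric] del: of_real_mult integral_complex_of_real flip: of_real_mult)
    with eq[OF that] show ?thesis by (simp add: f_def)
  qed
  have "f (\<i> * of_real s) = 0"
  proof (rule analytic_continuation[OF hol, of "of_real ` \<rat> \<inter> ball 0 r" 0])
    show "0 islimpt complex_of_real ` \<rat> \<inter> ball 0 r"
      unfolding islimpt_sequential
    proof (intro exI[of _ "\<lambda>n. complex_of_real (inverse (real (Suc n)))"] conjI allI)
      fix n
      have "inverse (real (Suc n)) \<in> \<rat>" by (intro Rats_inverse) simp
      moreover have "inverse (real (Suc n)) < r" 
        by (simp add: r_def field_simps) (smt (verit) mult_nonneg_nonneg of_nat_0_le_iff abs_ge_zero)
      ultimately show "complex_of_real (inverse (real (Suc n))) \<in> complex_of_real ` \<rat> \<inter> ball 0 r - {0}"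
        by (auto simp: norm_inverse simp del: of_real_inverse of_nat_Suc)
    next
      show "(\<lambda>n. complex_of_real (inverse (real (Suc n)))) \<longlonglongrightarrow> 0"
        using tendsto_of_real[OF LIMSEQ_inverse_real_of_nat, where 'a=complex] by simp
    qed
    show "\<i> * complex_of_real s \<in> ball 0 r" by (simp add: r_def norm_mult)
  qed (auto simp: f0 r_def)
  then show "char \<mu> s = char \<tau> s"
    by (simp add: f_def char_def mult.assoc)
qed

text \<open>Weak convergence does not reach the unbounded function \<open>exp (t * x)\<close>, so it
  is applied to the truncation at \<open>B\<close>. The excess costs at most \<open>m2 / B\<close>
  in the limit, by the transform at \<open>2 * t\<close>, which provides uniform integrability; then
  \<open>B\<close> tends to infinity.\<close>

lemma mgf_weak_limit:
  assumes \<mu>: "\<And>k. real_distribution (\<mu> k)" and \<nu>: "real_distribution \<nu>" and w: "weak_conv_m \<mu> \<nu>"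
    and i1: "\<forall>\<^sub>F k in sequentially. integrable (\<mu> k) (\<lambda>x. exp (t * x :: real))"
    and i2: "\<forall>\<^sub>F k in sequentially. integrable (\<mu> k) (\<lambda>x. exp (2 * t * x))"
    and l1: "(\<lambda>k. \<integral>x. exp (t * x) \<partial>\<mu> k) \<longlonglongrightarrow> m" and l2: "(\<lambda>k. \<integral>x. exp (2 * t * x) \<partial>\<mu> k) \<longlonglongrightarrow> m2"
  shows "integrable \<nu> (\<lambda>x. exp (t * x)) \<and> (\<integral>x. exp (t * x) \<partial>\<nu>) = m"
proof -
  interpret \<nu>: real_distribution \<nu> by fact
  interpret \<mu>: real_distribution "\<mu> k" for k by fact
  have key: "\<bar>m - (\<integral>x. min (exp (t * x)) B \<partial>\<nu>)\<bar> \<le> m2 / B" if "B > 0" for B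
  proof -
    have "(\<lambda>k. \<integral>x. min (exp (t * x)) B \<partial>\<mu> k) \<longlonglongrightarrow> (\<integral>x. min (exp (t * x)) B \<partial>\<nu>)"
      using that by (intro weak_conv_imp_integral_bdd_continuous_conv[OF \<mu> \<nu> w, of _ B] continuous_intros) auto
    then have lim: "(\<lambda>k. \<bar>(\<integral>x. exp (t * x) \<partial>\<mu> k) - (\<integral>x. min (exp (t * x)) B \<partial>\<mu> k)\<bar>) \<longlonglongrightarrow> \<bar>m - (\<integral>x. min (exp (t * x)) B \<partial>\<nu>)\<bar>"
      by (intro tendsto_intros l1)
    have ev: "\<forall>\<^sub>F k in sequentially. \<bar>(\<integral>x. exp (t * x) \<partial>\<mu> k) - (\<integral>x. min (exp (t * x)) B \<partial>\<mu> k)\<bar> \<le> (\<integral>x. exp (2 * t * x) \<partial>\<mu> k) / B"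
      using i1 i2
    proof eventually_elim
      case (elim k)
      have im: "integrable (\<mu> k) (\<lambda>x. min (exp (t * x)) B)"
        by (rule Bochner_Integration.integrable_bound[OF elim(1)]) (use that in \<open>auto simp: abs_if min_def\<close>)
      \<comment> \<open>Where the truncation acts, \<open>exp (t * x)\<close> is at least
        \<open>B\<close>, so the excess is at most \<open>exp (t * x)\<close>, hence at most
        \<open>exp (2 * t * x) / B\<close>.\<close>
      have pt: "\<bar>exp (t * x) - min (exp (t * x)) B\<bar> \<le> exp (2 * t * x) / B" for x
      proof -
        have "exp (2 * t * x) = exp (t * x) * exp (t * x)" by (simp flip: exp_add)
        moreover have "(exp (t * x) - B) * B \<le> exp (t * x) * exp (t * x)" if "B \<le> exp (t * x)"
          using that \<open>B > 0\<close> by (intro mult_mono) auto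
        ultimately show ?thesis using \<open>B > 0\<close>
          by (cases "B \<le> exp (t * x)") (simp_all add: min_def pos_le_divide_eq)
      qed
      have "\<bar>(\<integral>x. exp (t * x) \<partial>\<mu> k) - (\<integral>x. min (exp (t * x)) B \<partial>\<mu> k)\<bar> = \<bar>\<integral>x. exp (t * x) - min (exp (t * x)) B \<partial>\<mu> k\<bar>"
        using elim im by simp
      also have "\<dots> \<le> (\<integral>x. \<bar>exp (t * x) - min (exp (t * x)) B\<bar> \<partial>\<mu> k)" by (rule integral_abs_bound)
      also have "\<dots> \<le> (\<integral>x. exp (2 * t * x) / B \<partial>\<mu> k)"
        using elim im pt by (intro integral_mono) auto
      finally show ?case by simp
    qed
    show ?thesis
      by (rule tendsto_le[OF _ _ lim ev]) (auto intro!: tendsto_intros l2 simp: that less_imp_neq[THEN not_sym])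
  qed
  have "has_bochner_integral \<nu> (\<lambda>x. exp (t * x)) m"
  proof (intro has_bochner_integral_monotone_convergence[where f="\<lambda>k x. min (exp (t * x)) (real (Suc k))"])
    show "integrable \<nu> (\<lambda>x. min (exp (t * x)) (real (Suc k)))" for k
      by (rule \<nu>.integrable_const_bound[where B="real (Suc k)"]) auto
    show "AE x in \<nu>. mono (\<lambda>n. min (exp (t * x)) (real (Suc n)))" by (auto simp: mono_def)
    have "(\<lambda>n. min (exp (t * x)) (real (Suc n))) \<longlonglongrightarrow> exp (t * x)" for x
    proof (rule tendsto_eventually)
      obtain N where "exp (t * x) < real N" using reals_Archimedean2 by auto
      then show "\<forall>\<^sub>F n in sequentially. min (exp (t * x)) (real (Suc n)) = exp (t * x)"
        by (auto simp: eventually_sequentially intro!: exI[of _ N])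
    qed
    then show "AE x in \<nu>. (\<lambda>n. min (exp (t * x)) (real (Suc n))) \<longlonglongrightarrow> exp (t * x)" by simp
    have z: "(\<lambda>k. m2 / real (Suc k)) \<longlonglongrightarrow> 0" by (rule LIMSEQ_Suc[OF lim_const_over_n])
    have "(\<lambda>k. (\<integral>x. min (exp (t * x)) (real (Suc k)) \<partial>\<nu>) - m) \<longlonglongrightarrow> 0"
      by (rule Lim_null_comparison[OF _ z]) (use key in \<open>auto simp: abs_minus_commute\<close>)
    then show "(\<lambda>k. \<integral>x. min (exp (t * x)) (real (Suc k)) \<partial>\<nu>) \<longlonglongrightarrow> m" by (simp add: LIM_zero_iff)
  qed auto
  then show ?thesis by (simp add: has_bochner_integral_iff)
qed

text \<open>Curtiss' theorem with countably many arguments. Bounded transforms at 1 and -1 give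
  tightness through Markov's inequality; every subsequential limit has the transform of
  \<open>\<tau>\<close> at rational arguments and is therefore \<open>\<tau>\<close>.\<close>

lemma mgf_imp_weak_conv:
  assumes \<mu>: "\<And>k. real_distribution (\<mu> k)" and \<tau>: "real_distribution \<tau>"
    and i\<tau>: "\<And>t. integrable \<tau> (\<lambda>x. exp (t * x :: real))"
    and i: "\<And>t. t \<in> \<rat> \<Longrightarrow> \<forall>\<^sub>F k in sequentially. integrable (\<mu> k) (\<lambda>x. exp (t * x))"
    and l: "\<And>t. t \<in> \<rat> \<Longrightarrow> (\<lambda>k. \<integral>x. exp (t * x) \<partial>\<mu> k) \<longlonglongrightarrow> (\<integral>x. exp (t * x) \<partial>\<tau>)"
    and i1: "\<And>k. integrable (\<mu> k) (\<lambda>x. exp (1 * x))" "\<And>k. integrable (\<mu> k) (\<lambda>x. exp (-1 * x))"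
  shows "weak_conv_m \<mu> \<tau>"
proof (rule tight_subseq_weak_converge[OF \<mu> \<tau>])
  interpret \<mu>: real_distribution "\<mu> k" for k by fact
  have "convergent (\<lambda>k. (\<integral>x. exp (1 * x) \<partial>\<mu> k) + (\<integral>x. exp (-1 * x) \<partial>\<mu> k))"
    unfolding convergent_def by (rule exI, rule tendsto_add[OF l l]) auto
  from convergent_imp_Bseq[OF this] obtain C where C: "\<And>k. \<bar>(\<integral>x. exp (1 * x) \<partial>\<mu> k) + (\<integral>x. exp (-1 * x) \<partial>\<mu> k)\<bar> \<le> C" "C > 0"
    by (auto simp: Bseq_def)
  show "tight \<mu>" unfolding tight_def
  proof (intro conjI allI impI \<mu>)
    fix \<epsilon> :: real assume "\<epsilon> > 0"
    \<comment> \<open>Makes \<open>exp a\<close> at least \<open>2 * C / \<epsilon>\<close>, so that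
      Markov's bound \<open>C / exp a\<close> is at most \<open>\<epsilon> / 2\<close>; the maximum
      with 1 keeps \<open>-a < a\<close>.\<close>
    define a where "a = max 1 (ln (2 * C / \<epsilon>))"
    have ea: "C / exp a < \<epsilon>"
    proof -
      have "2 * C / \<epsilon> \<le> exp a"
        using C(2) \<open>\<epsilon> > 0\<close> unfolding a_def by (metis divide_pos_pos exp_le_cancel_iff exp_ln max.cobounded2 mult_pos_pos zero_less_numeral)
      moreover have "exp a > 0" by simp
      ultimately show ?thesis using C(2) \<open>\<epsilon> > 0\<close> by (simp add: field_simps)
    qed
    have "measure (\<mu> n) {-a<..a} > 1 - \<epsilon>" for n
    proof -
      let ?e = "\<lambda>x::real. exp (1 * x) + exp (-1 * x)"
      have ie: "integrable (\<mu> n) ?e" using i1[of n] by simp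
      have "measure (\<mu> n) {x \<in> space (\<mu> n). ?e x \<ge> exp a} \<le> (\<integral>x. ?e x \<partial>\<mu> n) / exp a"
        by (rule integral_Markov_inequality_measure[OF ie, where A="{}"]) (auto simp: add_nonneg_nonneg)
      also have "\<dots> \<le> C / exp a" using C(1)[of n] i1[of n] by (intro divide_right_mono) auto
      finally have 1: "measure (\<mu> n) {x. ?e x \<ge> exp a} < \<epsilon>" using ea by simp
      have "measure (\<mu> n) (UNIV - {-a<..a}) \<le> measure (\<mu> n) {x. ?e x \<ge> exp a}"
      proof (rule \<mu>.finite_measure_mono)
        show "UNIV - {-a<..a} \<subseteq> {x. ?e x \<ge> exp a}"
          by (auto simp: not_less not_le) (auto intro: add_increasing add_increasing2)
      qed auto
      then have "measure (\<mu> n) (UNIV - {-a<..a}) < \<epsilon>" using 1 by simp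
      then show ?thesis using \<mu>.prob_compl[of "{-a<..a}" n] by simp
    qed
    then show "\<exists>a b. a < b \<and> (\<forall>n. measure (\<mu> n) {a<..b} > 1 - \<epsilon>)"
      by (intro exI[of _ "-a"] exI[of _ a]) (auto simp: a_def)
  qed
next
  fix s \<nu> assume s: "strict_mono (s :: nat \<Rightarrow> nat)" and \<nu>: "real_distribution \<nu>" and w: "weak_conv_m (\<mu> \<circ> s) \<nu>"
  have sub: "filterlim s sequentially sequentially" using s by (rule filterlim_subseq)
  have *: "integrable \<nu> (\<lambda>x. exp (t * x)) \<and> (\<integral>x. exp (t * x) \<partial>\<nu>) = (\<integral>x. exp (t * x) \<partial>\<tau>)" if "t \<in> \<rat>" for t
  proof -
    \<comment> \<open>The truncation argument of \<open>mgf_weak_limit\<close> also uses the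
      transform at \<open>2 * t\<close>, which is again a rational argument.\<close>
    have 2: "2 * t \<in> \<rat>" using that by simp
    show ?thesis
      using \<mu> \<nu> w eventually_compose_filterlim[OF i[OF that] sub] eventually_compose_filterlim[OF i[OF 2] sub]
        filterlim_compose[OF l[OF that] sub] filterlim_compose[OF l[OF 2] sub]
      by (intro mgf_weak_limit[of "\<mu> \<circ> s"]) auto
  qed
  interpret \<nu>: real_distribution \<nu> by fact
  have "integrable \<nu> (\<lambda>x. exp (t * x))" for t
  proof -
    \<comment> \<open>A rational \<open>q\<close> beyond |t| carries integrability from rational to
      real arguments, as \<open>mgf_unique\<close> requires.\<close>
    obtain q where q: "q \<in> \<rat>" "q > \<bar>t\<bar>" using Rats_dense_in_real[of "\<bar>t\<bar>" "\<bar>t\<bar> + 1"] by auto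
    have "integrable \<nu> (\<lambda>x. exp (q * x) + exp (-q * x))"
      by (intro Bochner_Integration.integrable_add *[THEN conjunct1] Rats_minus_iff[THEN iffD2] q(1))
    then show ?thesis
    proof (rule Bochner_Integration.integrable_bound, safe intro!: AE_I2)
      fix x :: real
      have "t * x \<le> q * \<bar>x\<bar>" using abs_ge_self[of "t * x"] mult_right_mono[of "\<bar>t\<bar>" q "\<bar>x\<bar>"] q by (simp add: abs_mult)
      then have "exp (t * x) \<le> exp (q * \<bar>x\<bar>)" by simp
      also have "\<dots> \<le> exp (q * x) + exp (-q * x)" by (cases "x \<ge> 0") (auto simp: add_increasing add_increasing2)
      finally show "norm (exp (t * x)) \<le> norm (exp (q * x) + exp (- q * x))" by simp
    qed simp
  qed
  then have "\<nu> = \<tau>" by (intro mgf_unique[OF \<nu> \<tau> _ i\<tau>]) (use * in auto)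
  with w show "weak_conv_m (\<mu> \<circ> s) \<tau>" by simp
qed

section \<open>The bounded Lipschitz distance\<close>

lemma BL1_nonempty: "BL1 \<noteq> {}"
  by (auto simp: BL1_def intro!: exI[of _ "\<lambda>_. 0"] lipschitz_onI)

lemma BL1_measurable: "f \<in> BL1 \<Longrightarrow> f \<in> borel_measurable borel"
  by (auto simp: BL1_def intro!: borel_measurable_continuous_onI lipschitz_on_continuous_on)

lemma BL1_bound: "f \<in> BL1 \<Longrightarrow> \<bar>f x\<bar> \<le> 1"
  by (auto simp: BL1_def)

lemma BL1_lipschitz: "f \<in> BL1 \<Longrightarrow> \<bar>f x - f y\<bar> \<le> \<bar>x - y\<bar>"
  using lipschitz_onD[of 1 UNIV f x y] by (auto simp: BL1_def dist_real_def)

lemma BL1_I: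
  assumes "\<And>x. \<bar>f x\<bar> \<le> 1" "\<And>x y. \<bar>f x - f y\<bar> \<le> \<bar>x - y\<bar>"
  shows "f \<in> BL1"
  using assms by (auto simp: BL1_def dist_real_def intro!: lipschitz_onI)

lemma d_BL_le:
  assumes "\<And>f. f \<in> BL1 \<Longrightarrow> \<bar>(\<integral>x. f x \<partial>\<mu>) - (\<integral>x. f x \<partial>\<nu>)\<bar> \<le> e"
  shows "d_BL \<mu> \<nu> \<le> e"
  unfolding d_BL_def using assms by (intro cSUP_least BL1_nonempty) auto

lemma d_BL_ge:
  assumes "prob_space \<mu>" "prob_space \<nu>" "f \<in> BL1"
  shows "\<bar>(\<integral>x. f x \<partial>\<mu>) - (\<integral>x. f x \<partial>\<nu>)\<bar> \<le> d_BL \<mu> \<nu>"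
proof -
  have *: "\<bar>\<integral>x. f x \<partial>\<mu>\<bar> \<le> 1" if "f \<in> BL1" "prob_space \<mu>" for f and \<mu> :: "real measure"
  proof -
    interpret prob_space \<mu> by fact
    have "\<bar>\<integral>x. f x \<partial>\<mu>\<bar> \<le> (\<integral>x. \<bar>f x\<bar> \<partial>\<mu>)" by (rule integral_abs_bound)
    also have "\<dots> \<le> 1"
    \<comment> \<open>Nothing makes \<open>f\<close> measurable for \<open>\<mu>\<close> here, so it
      may fail to be integrable; its Bochner integral is then 0.\<close>
    proof (cases "integrable \<mu> (\<lambda>x. \<bar>f x\<bar>)")
      case True then show ?thesis using BL1_bound[OF that(1)] by (intro integral_le_const) auto
    qed (simp add: not_integrable_integral_eq)
    finally show ?thesis .
  qed
  show ?thesis unfolding d_BL_def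
  proof (rule cSUP_upper[OF assms(3)], rule bdd_aboveI2)
    fix f assume "f \<in> BL1"
    then show "\<bar>(\<integral>x. f x \<partial>\<mu>) - (\<integral>x. f x \<partial>\<nu>)\<bar> \<le> 2" using *[of f \<mu>] *[of f \<nu>] assms by auto
  qed
qed

text \<open>Skorohod's representation replaces weak convergence by pointwise convergence on one
  space. There every \<open>f\<close> in \<open>BL1\<close> changes by at most
  \<open>min 2 |Ys k x - Y x|\<close>, a bound free of \<open>f\<close>, to which dominated
  convergence applies.\<close>

lemma weak_conv_imp_d_BL:
  assumes \<mu>: "\<And>k. real_distribution (\<mu> k)" and \<tau>: "real_distribution \<tau>" and w: "weak_conv_m \<mu> \<tau>"
  shows "(\<lambda>k. d_BL (\<mu> k) \<tau>) \<longlonglongrightarrow> 0"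
proof -
  obtain \<Omega> :: "real measure" and Ys Y where ps: "prob_space \<Omega>"
    and m1[measurable]: "\<And>n. Ys n \<in> measurable \<Omega> borel" and d1: "\<And>n. distr \<Omega> borel (Ys n) = \<mu> n"
    and m2: "Y \<in> measurable \<Omega> lborel" and d2: "distr \<Omega> borel Y = \<tau>"
    and lim: "\<And>x. x \<in> space \<Omega> \<Longrightarrow> (\<lambda>n. Ys n x) \<longlonglongrightarrow> Y x"
    using Skorohod[OF assms] by blast
  have m2'[measurable]: "Y \<in> borel_measurable \<Omega>" using m2 by simp
  interpret prob_space \<Omega> by fact
  have le: "d_BL (\<mu> k) \<tau> \<le> (\<integral>x. min 2 \<bar>Ys k x - Y x\<bar> \<partial>\<Omega>)" for k
  proof (rule d_BL_le)
    fix f assume f: "f \<in> BL1"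
    note [measurable] = BL1_measurable[OF f]
    have int: "integrable \<Omega> (\<lambda>x. f (Ys k x))" "integrable \<Omega> (\<lambda>x. f (Y x))"
      by (auto intro!: integrable_const_bound[where B=1] simp: BL1_bound[OF f])
    have "(\<integral>x. f x \<partial>\<mu> k) - (\<integral>x. f x \<partial>\<tau>) = (\<integral>x. f (Ys k x) - f (Y x) \<partial>\<Omega>)"
      using int by (simp add: d1[symmetric] d2[symmetric] integral_distr)
    also have "\<bar>\<dots>\<bar> \<le> (\<integral>x. \<bar>f (Ys k x) - f (Y x)\<bar> \<partial>\<Omega>)" by (rule integral_abs_bound)
    also have "\<dots> \<le> (\<integral>x. min 2 \<bar>Ys k x - Y x\<bar> \<partial>\<Omega>)"
    proof (rule integral_mono)
      show "integrable \<Omega> (\<lambda>x. min 2 \<bar>Ys k x - Y x\<bar>)" by (auto intro!: integrable_const_bound[where B=2])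
      show "\<bar>f (Ys k x) - f (Y x)\<bar> \<le> min 2 \<bar>Ys k x - Y x\<bar>" for x
        using BL1_lipschitz[OF f, of "Ys k x" "Y x"] BL1_bound[OF f, of "Ys k x"] BL1_bound[OF f, of "Y x"] by auto
    qed (use int in simp)
    finally show "\<bar>(\<integral>x. f x \<partial>\<mu> k) - (\<integral>x. f x \<partial>\<tau>)\<bar> \<le> (\<integral>x. min 2 \<bar>Ys k x - Y x\<bar> \<partial>\<Omega>)" .
  qed
  have "(\<lambda>k. \<integral>x. min 2 \<bar>Ys k x - Y x\<bar> \<partial>\<Omega>) \<longlonglongrightarrow> (\<integral>x. 0 \<partial>\<Omega>)"
  proof (rule integral_dominated_convergence[where w="\<lambda>_. 2"])
    have "(\<lambda>k. min 2 \<bar>Ys k x - Y x\<bar>) \<longlonglongrightarrow> min 2 \<bar>Y x - Y x\<bar>" if "x \<in> space \<Omega>" for x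
      by (intro tendsto_intros lim that)
    then show "AE x in \<Omega>. (\<lambda>k. min 2 \<bar>Ys k x - Y x\<bar>) \<longlonglongrightarrow> 0" by (auto intro!: AE_I2)
  qed auto
  then have z: "(\<lambda>k. \<integral>x. min 2 \<bar>Ys k x - Y x\<bar> \<partial>\<Omega>) \<longlonglongrightarrow> 0" by simp
  have ge: "0 \<le> d_BL (\<mu> k) \<tau>" for k
  proof -
    obtain f where f: "f \<in> BL1" using BL1_nonempty by auto
    have "prob_space (\<mu> k)" "prob_space \<tau>" using \<mu>[of k] \<tau> by (auto simp: real_distribution_def)
    from d_BL_ge[OF this f] show ?thesis by (meson abs_ge_zero order_trans)
  qed
  show ?thesis by (rule tendsto_sandwich[OF _ _ tendsto_const z]) (auto simp: le ge)
qed

text \<open>Compactness turns convergence of Laplace transforms into a finite criterion, which can be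
  applied on a single event of large outer probability.\<close>

lemma mgf_close_imp_d_BL_less:
  assumes \<tau>: "real_distribution \<tau>" and i\<tau>: "\<And>t. integrable \<tau> (\<lambda>x. exp (t * x :: real))" and e: "e > 0"
  obtains T \<delta> where "finite T" "\<delta> > 0"
    "\<And>\<mu>. real_distribution \<mu> \<Longrightarrow>
       (\<And>t. t \<in> T \<Longrightarrow> integrable \<mu> (\<lambda>x. exp (t * x)) \<and> \<bar>(\<integral>x. exp (t * x) \<partial>\<mu>) - (\<integral>x. exp (t * x) \<partial>\<tau>)\<bar> < \<delta>) \<Longrightarrow>
       d_BL \<mu> \<tau> < e"
proof (rule ccontr)
  assume neg: "\<not> thesis"
  define q where "q = from_nat_into (\<rat> :: real set)"
  have q: "range q = \<rat>" unfolding q_def by (rule range_from_nat_into) (auto simp: countable_rat)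
  \<comment> \<open>The arguments 1 and -1 belong to every \<open>T k\<close> because the tightness
    step uses them for each \<open>k\<close>; the other members exhaust the rationals.\<close>
  define T where "T k = {1, -1} \<union> q ` {..k}" for k :: nat
  \<comment> \<open>A failure of the claim at every stage gives laws that pass the test on
    \<open>T k\<close> with tolerance 1 / (k + 1) and still stay at distance at least
    \<open>e\<close>; they converge weakly, a contradiction.\<close>
  have "\<exists>\<mu>. real_distribution \<mu> \<and>
       (\<forall>t\<in>T k. integrable \<mu> (\<lambda>x. exp (t * x)) \<and> \<bar>(\<integral>x. exp (t * x) \<partial>\<mu>) - (\<integral>x. exp (t * x) \<partial>\<tau>)\<bar> < inverse (real (Suc k)))
       \<and> \<not> d_BL \<mu> \<tau> < e" for k
  proof (rule ccontr)
    assume "\<not> ?thesis"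
    then have *: "\<And>\<mu>. real_distribution \<mu> \<Longrightarrow>
       (\<And>t. t \<in> T k \<Longrightarrow> integrable \<mu> (\<lambda>x. exp (t * x)) \<and> \<bar>(\<integral>x. exp (t * x) \<partial>\<mu>) - (\<integral>x. exp (t * x) \<partial>\<tau>)\<bar> < inverse (real (Suc k))) \<Longrightarrow>
       d_BL \<mu> \<tau> < e" by blast
    have "thesis" by (rule that[of "T k" "inverse (real (Suc k))", OF _ _ *]) (auto simp: T_def)
    with neg show False by simp
  qed
  then obtain \<mu> where \<mu>: "\<And>k. real_distribution (\<mu> k)"
    and i: "\<And>k t. t \<in> T k \<Longrightarrow> integrable (\<mu> k) (\<lambda>x. exp (t * x))"
    and c: "\<And>k t. t \<in> T k \<Longrightarrow> \<bar>(\<integral>x. exp (t * x) \<partial>\<mu> k) - (\<integral>x. exp (t * x) \<partial>\<tau>)\<bar> < inverse (real (Suc k))"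
    and n: "\<And>k. \<not> d_BL (\<mu> k) \<tau> < e"
    by metis
  have ev: "\<forall>\<^sub>F k in sequentially. t \<in> T k" if "t \<in> \<rat>" for t
  proof -
    obtain j where "t = q j" using \<open>t \<in> \<rat>\<close> q by auto
    then show ?thesis by (auto simp: T_def eventually_sequentially intro!: exI[of _ j])
  qed
  have "weak_conv_m \<mu> \<tau>"
  proof (rule mgf_imp_weak_conv[OF \<mu> \<tau> i\<tau>])
    fix t :: real assume t: "t \<in> \<rat>"
    show "\<forall>\<^sub>F k in sequentially. integrable (\<mu> k) (\<lambda>x. exp (t * x))"
      using ev[OF t] by eventually_elim (rule i)
    have "(\<lambda>k. (\<integral>x. exp (t * x) \<partial>\<mu> k) - (\<integral>x. exp (t * x) \<partial>\<tau>)) \<longlonglongrightarrow> 0"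
    proof (rule Lim_null_comparison[OF _ LIMSEQ_inverse_real_of_nat])
      show "\<forall>\<^sub>F k in sequentially. norm ((\<integral>x. exp (t * x) \<partial>\<mu> k) - (\<integral>x. exp (t * x) \<partial>\<tau>)) \<le> inverse (real (Suc k))"
        using ev[OF t] by eventually_elim (use c in \<open>fastforce intro: less_imp_le\<close>)
    qed
    then show "(\<lambda>k. \<integral>x. exp (t * x) \<partial>\<mu> k) \<longlonglongrightarrow> (\<integral>x. exp (t * x) \<partial>\<tau>)" by (simp add: LIM_zero_iff)
  qed (rule i, simp add: T_def)+
  from weak_conv_imp_d_BL[OF \<mu> \<tau> this] have "\<forall>\<^sub>F k in sequentially. d_BL (\<mu> k) \<tau> < e"
    using e by (rule order_tendstoD)
  then show False using n by (auto simp: eventually_sequentially)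
qed

text \<open>Unlike \<open>normal_law 0 0\<close>, which is the zero measure, \<open>gauss 0\<close> is the Dirac measure at 0;
  this case occurs when \<open>b0\<close> is almost surely constant.\<close>

definition gauss :: "real \<Rightarrow> real measure" where
  "gauss s = distr std_normal_distribution borel (\<lambda>x. s * x)"

lemma gauss_real_distribution: "real_distribution (gauss s)"
proof -
  interpret real_distribution std_normal_distribution by (rule real_dist_normal_dist)
  show ?thesis unfolding gauss_def by (intro real_distribution_distr) auto
qed

lemma gauss_mgf: "has_bochner_integral (gauss s) (\<lambda>x. exp (t * x)) (exp (t\<^sup>2 * s\<^sup>2 / 2))"
proof -
  have "std_normal_density x * exp (t * (s * x)) = normal_density (t * s) 1 x * exp (t\<^sup>2 * s\<^sup>2 / 2)" for x
  proof -
    have "- x\<^sup>2 / 2 + t * (s * x) = - (x - t * s)\<^sup>2 / 2 + t\<^sup>2 * s\<^sup>2 / 2" by (simp add: power2_eq_square field_simps)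
    then show ?thesis by (simp add: normal_density_def flip: exp_add)
  qed
  moreover have "has_bochner_integral lborel (\<lambda>x. normal_density (t * s) 1 x * exp (t\<^sup>2 * s\<^sup>2 / 2)) (1 * exp (t\<^sup>2 * s\<^sup>2 / 2))"
    by (intro has_bochner_integral_mult_left) (auto simp: has_bochner_integral_iff)
  ultimately show ?thesis
    unfolding gauss_def by (intro has_bochner_integral_distr has_bochner_integral_density) (auto simp: mult.commute)
qed

lemma normal_law_eq_gauss:
  assumes "v > 0"
  shows "normal_law 0 v = gauss (sqrt v)"
proof -
  interpret real_distribution std_normal_distribution by (rule real_dist_normal_dist)
  have "distributed std_normal_distribution lborel (\<lambda>x. x) (\<lambda>x. ennreal (normal_density 0 1 x))"
    using distr_id2[of lborel std_normal_distribution] by (auto simp: distributed_def)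
  from normal_density_affine[OF this, of "sqrt v" 0] assms
  have "distributed std_normal_distribution lborel (\<lambda>x. sqrt v * x) (\<lambda>x. ennreal (normal_density 0 (sqrt v) x))"
    by simp
  from distributed_distr_eq_density[OF this] show ?thesis
    by (simp add: normal_law_def gauss_def cong: distr_cong)
qed

section \<open>Dirichlet processes\<close>

lemma ln_one_minus_cubic:
  fixes x :: real
  assumes "\<bar>x\<bar> \<le> 1 / 2"
  shows "\<bar>- ln (1 - x) - x - x\<^sup>2 / 2\<bar> \<le> 2 * \<bar>x\<bar> ^ 3"
proof -
  define h where "h y = - ln (1 - y) - y - y\<^sup>2 / 2" for y :: real
  have der: "(h has_field_derivative (y\<^sup>2 / (1 - y))) (at y within {-1/2..1/2})" if "y \<in> {-1/2..1/2}" for y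
    unfolding h_def using that
    by (auto intro!: derivative_eq_intros simp: field_simps power2_eq_square)
  have "norm (h x - h 0) \<le> (2 * x\<^sup>2) * norm (x - 0)"
  proof (rule field_differentiable_bound[where S = "closed_segment 0 x"])
    fix y assume y: "y \<in> closed_segment 0 x"
    then have y2: "\<bar>y\<bar> \<le> \<bar>x\<bar>" by (auto simp: closed_segment_eq_real_ivl split: if_splits)
    have "closed_segment 0 x \<subseteq> {-1/2..1/2}" using assms by (auto simp: closed_segment_eq_real_ivl split: if_splits)
    then show "(h has_field_derivative (y\<^sup>2 / (1 - y))) (at y within closed_segment 0 x)"
      using der y by (blast intro: has_field_derivative_subset)
    have "y\<^sup>2 / (1 - y) \<le> x\<^sup>2 / (1/2)"
    proof (intro frac_le)
      show "y\<^sup>2 \<le> x\<^sup>2" using y2 by (simp add: abs_le_square_iff)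
      show "1 / 2 \<le> 1 - y" using y2 assms by linarith
    qed auto
    then show "norm (y\<^sup>2 / (1 - y)) \<le> 2 * x\<^sup>2" using y2 assms by simp
  qed auto
  then show ?thesis by (simp add: h_def power2_eq_square power3_eq_cube abs_mult)
qed

lemma gamma_law_sets[simp, measurable_cong]: "sets (gamma_law s) = sets borel"
  by (simp add: gamma_law_def)

lemma gamma_law_mgf_nn:
  assumes s: "s \<ge> 0" and u: "u < 1"
  shows "(\<integral>\<^sup>+x. ennreal (exp (u * x)) \<partial>gamma_law s) = ennreal ((1 - u) powr (- s))"
proof (cases "s = 0")
  case True
  then show ?thesis using u by (simp add: gamma_law_def nn_integral_return)
next
  case False
  with s have s: "s > 0" by simp
  \<comment> \<open>Multiplying the gamma density by \<open>exp (u * x)\<close> changes its rate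
    from 1 to \<open>c\<close>; the substitution \<open>c * x\<close> in Euler's integral then gives
    the total mass.\<close>
  define c where "c = 1 - u"
  have c: "c > 0" using u by (simp add: c_def)
  have G: "Gamma s > 0" using s by (rule Gamma_real_pos)
  define K where "K = c powr s / Gamma s"
  have K: "K > 0" using c G by (simp add: K_def)
  have "ennreal (Gamma s) = (\<integral>\<^sup>+t. ennreal (indicator {0..} t * t powr (s - 1) / exp t) \<partial>lborel)"
    by (rule Gamma_conv_nn_integral_real[OF s])
  also have "\<dots> = \<bar>c\<bar> * (\<integral>\<^sup>+x. ennreal (indicator {0..} (0 + c * x) * (0 + c * x) powr (s - 1) / exp (0 + c * x)) \<partial>lborel)"
    using c by (intro nn_integral_real_affine) auto
  also have "\<dots> = (\<integral>\<^sup>+x. ennreal (c * (indicator {0..} (0 + c * x) * (0 + c * x) powr (s - 1) / exp (0 + c * x))) \<partial>lborel)"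
    using c by (subst nn_integral_cmult[symmetric]) (auto simp: ennreal_mult'[symmetric] mult.assoc intro!: nn_integral_cong)
  also have "\<dots> = (\<integral>\<^sup>+x. ennreal (c powr s * Gamma s) * (ennreal (if 0 < x then x powr (s - 1) * exp (- x) / Gamma s else 0) * ennreal (exp (u * x))) \<partial>lborel)"
  proof (intro nn_integral_cong)
    fix x :: real
    show "ennreal (c * (indicator {0..} (0 + c * x) * (0 + c * x) powr (s - 1) / exp (0 + c * x))) =
      ennreal (c powr s * Gamma s) * (ennreal (if 0 < x then x powr (s - 1) * exp (- x) / Gamma s else 0) * ennreal (exp (u * x)))"
    proof (cases "x > 0")
      case True
      have "c * ((c * x) powr (s - 1) / exp (c * x)) = c powr s * Gamma s * (x powr (s - 1) * exp (- x) / Gamma s * exp (u * x))"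
      proof -
        have "c * c powr (s - 1) = c powr s" using c by (simp add: powr_mult_base)
        moreover have "exp (c * x) = exp x / exp (u * x)" by (simp add: c_def algebra_simps exp_diff)
        ultimately show ?thesis using c True G by (simp add: powr_mult exp_minus divide_simps) (metis mult.assoc mult.commute)
      qed
      then show ?thesis using True c G
        by (simp add: ennreal_mult' [symmetric] indicator_def)
    next
      case False
      then show ?thesis using c s by (auto simp: indicator_def not_less zero_le_mult_iff)
    qed
  qed
  also have "\<dots> = ennreal (c powr s * Gamma s) * (\<integral>\<^sup>+x. (ennreal (if 0 < x then x powr (s - 1) * exp (- x) / Gamma s else 0) * ennreal (exp (u * x))) \<partial>lborel)"
    by (rule nn_integral_cmult) measurable
  also have "(\<integral>\<^sup>+x. (ennreal (if 0 < x then x powr (s - 1) * exp (- x) / Gamma s else 0) * ennreal (exp (u * x))) \<partial>lborel)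
     = (\<integral>\<^sup>+x. ennreal (exp (u * x)) \<partial>gamma_law s)"
    using \<open>s \<noteq> 0\<close> False by (simp add: gamma_law_def nn_integral_density)
  finally have eq: "ennreal (Gamma s) = ennreal (c powr s * Gamma s) * (\<integral>\<^sup>+x. ennreal (exp (u * x)) \<partial>gamma_law s)" .
  have cc: "ennreal (c powr (- s) / Gamma s) * ennreal (c powr s * Gamma s) = 1"
    using c G by (simp add: ennreal_mult'[symmetric] powr_minus)
  have "ennreal (c powr (- s) / Gamma s) * ennreal (Gamma s) = (\<integral>\<^sup>+x. ennreal (exp (u * x)) \<partial>gamma_law s)"
    unfolding eq mult.assoc[symmetric] cc by simp
  then show ?thesis using c G by (simp add: c_def ennreal_mult'[symmetric])
qed

text \<open>The Laplace transform at 0 is the total mass.\<close>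

lemma gamma_law_prob_space: "s \<ge> 0 \<Longrightarrow> prob_space (gamma_law s)"
  using gamma_law_mgf_nn[of s 0] by (intro prob_spaceI) simp

text \<open>The logarithm of the transform of one factor is \<open>- s * ln (1 - x)\<close> with
  \<open>x = t * d / sqrt n\<close>. The condition \<open>4 * t\<^sup>2 \<le> n\<close> keeps |x| at
  most 1/2, and the cubic errors add up. Only the sum of the \<open>s i\<close> and the bound on
  \<open>d\<close> enter the error, so the expansion is uniform in the number of cells.\<close>

lemma gamma_prod_mgf:
  fixes s d :: "nat \<Rightarrow> real" and n :: real
  assumes s: "\<And>i. s i \<ge> 0" and d: "\<And>i. i < k \<Longrightarrow> \<bar>d i\<bar> \<le> 1" and n: "n > 0" "4 * t\<^sup>2 \<le> n"
  obtains E where "has_bochner_integral (\<Pi>\<^sub>M i\<in>{..<k}. gamma_law (s i)) (\<lambda>G. exp (t * ((\<Sum>i<k. d i * G i) / sqrt n))) (exp E)"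
    "\<bar>E - (t * (\<Sum>i<k. s i * d i) / sqrt n + t\<^sup>2 * (\<Sum>i<k. s i * (d i)\<^sup>2) / (2 * n))\<bar> \<le> 2 * \<bar>t\<bar> ^ 3 * (\<Sum>i<k. s i) / (n * sqrt n)"
proof
  interpret product_prob_space "\<lambda>i. gamma_law (s i)" "{..<k}"
    by (intro product_prob_spaceI gamma_law_prob_space s)
  define x where "x i = t * d i / sqrt n" for i
  have tn: "\<bar>t\<bar> / sqrt n \<le> 1 / 2"
  proof -
    have "(2 * \<bar>t\<bar>)\<^sup>2 \<le> n" using n by (simp add: power_mult_distrib)
    then have "2 * \<bar>t\<bar> \<le> sqrt n" by (rule real_le_rsqrt)
    then show ?thesis using n by (simp add: field_simps)
  qed
  have x: "\<bar>x i\<bar> \<le> \<bar>t\<bar> / sqrt n" if "i < k" for i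
    using mult_left_mono[OF d[OF that], of "\<bar>t\<bar> / sqrt n"] n by (simp add: x_def abs_mult)
  have x2: "\<bar>x i\<bar> \<le> 1 / 2" if "i < k" for i using x[OF that] tn by linarith
  define E where "E = (\<Sum>i<k. s i * (- ln (1 - x i)))"
  have "(\<integral>\<^sup>+G. ennreal (exp (t * ((\<Sum>i<k. d i * G i) / sqrt n))) \<partial>(\<Pi>\<^sub>M i\<in>{..<k}. gamma_law (s i)))
     = (\<integral>\<^sup>+G. (\<Prod>i<k. ennreal (exp (x i * G i))) \<partial>(\<Pi>\<^sub>M i\<in>{..<k}. gamma_law (s i)))"
    by (intro nn_integral_cong)
      (simp add: prod_ennreal exp_sum[symmetric] x_def sum_distrib_left sum_divide_distrib mult.assoc)
  also have "\<dots> = (\<Prod>i<k. \<integral>\<^sup>+y. ennreal (exp (x i * y)) \<partial>gamma_law (s i))"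
    by (subst product_nn_integral_prod) auto
  also have "\<dots> = (\<Prod>i<k. ennreal (exp (s i * (- ln (1 - x i)))))"
  proof (intro prod.cong refl)
    fix i assume "i \<in> {..<k}"
    then show "(\<integral>\<^sup>+y. ennreal (exp (x i * y)) \<partial>gamma_law (s i)) = ennreal (exp (s i * (- ln (1 - x i))))"
      using x2[of i] by (subst gamma_law_mgf_nn[OF s]) (auto simp: powr_def)
  qed
  also have "\<dots> = ennreal (exp E)"
    by (simp add: prod_ennreal exp_sum E_def)
  finally show "has_bochner_integral (\<Pi>\<^sub>M i\<in>{..<k}. gamma_law (s i)) (\<lambda>G. exp (t * ((\<Sum>i<k. d i * G i) / sqrt n))) (exp E)"
    by (intro has_bochner_integral_nn_integral) auto
  have eq: "t * (\<Sum>i<k. s i * d i) / sqrt n + t\<^sup>2 * (\<Sum>i<k. s i * (d i)\<^sup>2) / (2 * n) = (\<Sum>i<k. s i * (x i + (x i)\<^sup>2 / 2))"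
  proof -
    have "(x i)\<^sup>2 = t\<^sup>2 * (d i)\<^sup>2 / n" for i
      using n by (simp add: x_def power_divide power_mult_distrib)
    then show ?thesis
      by (simp add: x_def sum_distrib_left sum_divide_distrib sum.distrib distrib_left mult_ac)
  qed
  have "\<bar>E - (\<Sum>i<k. s i * (x i + (x i)\<^sup>2 / 2))\<bar> = \<bar>\<Sum>i<k. s i * (- ln (1 - x i) - x i - (x i)\<^sup>2 / 2)\<bar>"
    by (simp add: E_def sum_subtractf[symmetric] algebra_simps)
  also have "\<dots> \<le> (\<Sum>i<k. s i * (2 * (\<bar>t\<bar> / sqrt n) ^ 3))"
  proof (intro order.trans[OF sum_abs] sum_mono)
    fix i assume i: "i \<in> {..<k}"
    have "\<bar>- ln (1 - x i) - x i - (x i)\<^sup>2 / 2\<bar> \<le> 2 * \<bar>x i\<bar> ^ 3" using x2 i by (intro ln_one_minus_cubic) auto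
    also have "\<dots> \<le> 2 * (\<bar>t\<bar> / sqrt n) ^ 3" using x[of i] i by (intro mult_left_mono power_mono) auto
    finally show "\<bar>s i * (- ln (1 - x i) - x i - (x i)\<^sup>2 / 2)\<bar> \<le> s i * (2 * (\<bar>t\<bar> / sqrt n) ^ 3)"
      using s[of i] by (simp add: abs_mult mult_left_mono)
  qed
  also have "\<dots> = 2 * \<bar>t\<bar> ^ 3 * (\<Sum>i<k. s i) / (n * sqrt n)"
    unfolding sum_distrib_right[symmetric] using n by (simp add: power_divide power3_eq_cube)
  finally show "\<bar>E - (t * (\<Sum>i<k. s i * d i) / sqrt n + t\<^sup>2 * (\<Sum>i<k. s i * (d i)\<^sup>2) / (2 * n))\<bar> \<le> 2 * \<bar>t\<bar> ^ 3 * (\<Sum>i<k. s i) / (n * sqrt n)"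
    unfolding eq .
qed

text \<open>Turns transforms at 1 and -1 into a bound on a second moment.\<close>

lemma sq_le_exp_sum: "x\<^sup>2 \<le> exp x + exp (- x)" for x :: real
proof -
  have *: "y\<^sup>2 \<le> exp y" if "y \<ge> 0" for y :: real
  proof -
    have "1 + y + y\<^sup>2 / 2 + y ^ 3 / 6 \<le> exp y"
    proof -
      have "(\<Sum>m<4. y ^ m / fact m) \<le> (\<Sum>m. y ^ m /\<^sub>R fact m)"
        using summable_exp_generic[of y] that
        by (subst (1) divide_inverse) (auto intro!: sum_le_suminf simp: field_simps)
      also have "\<dots> = exp y" by (simp add: exp_def)
      finally show ?thesis by (simp add: eval_nat_numeral)
    qed
    moreover have "y\<^sup>2 / 2 \<le> 1 + y + y ^ 3 / 6"
    proof -
      \<comment> \<open>Completes the square in 1 - y / 2 + y^2 / 6, which leaves the positive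
        constant 5/8.\<close>
      have "0 \<le> y * ((y - 3/2)\<^sup>2 / 6 + 5/8)" using that by simp
      also have "\<dots> = y + y ^ 3 / 6 - y\<^sup>2 / 2"
        by (simp add: power2_eq_square power3_eq_cube field_simps)
      finally show ?thesis by linarith
    qed
    ultimately show ?thesis by linarith
  qed
  show ?thesis
  proof (cases "x \<ge> 0")
    case True then show ?thesis using *[of x] by (simp add: add_increasing2)
  next
    case False then show ?thesis using *[of "-x"] by (simp add: add_increasing)
  qed
qed

text \<open>Evaluating the transform at 1 and -1 gives a bound in terms of \<open>N\<close> alone,
  with no trace of \<open>n\<close>, \<open>k\<close> or the weights. The centring \<open>c\<close>
  will be 0 for the numerator of a Dirichlet vector and \<open>n\<close> for its
  normalisation.\<close>

lemma gamma_prod_second_moment: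
  fixes s d :: "nat \<Rightarrow> real" and n N :: real
  assumes s: "\<And>i. s i \<ge> 0" and d: "\<And>i. i < k \<Longrightarrow> \<bar>d i\<bar> \<le> 1" and n: "n \<ge> 4" and N: "N \<ge> 0" "(\<Sum>i<k. s i) = n + N"
    and c: "\<bar>(\<Sum>i<k. s i * d i) - c\<bar> \<le> N + 1"
  defines "A \<equiv> \<lambda>G. ((\<Sum>i<k. d i * G i) - c) / sqrt n"
  shows "integrable (\<Pi>\<^sub>M i\<in>{..<k}. gamma_law (s i)) (\<lambda>G. (A G)\<^sup>2)"
    "(\<integral>G. (A G)\<^sup>2 \<partial>(\<Pi>\<^sub>M i\<in>{..<k}. gamma_law (s i))) \<le> 2 * exp (4 * (N + 1))"
proof -
  let ?P = "\<Pi>\<^sub>M i\<in>{..<k}. gamma_law (s i)"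
  have *: "\<exists>m. has_bochner_integral ?P (\<lambda>G. exp (t * A G)) m \<and> m \<le> exp (4 * (N + 1))" if t: "\<bar>t\<bar> = 1" for t
  proof -
    have t2: "t\<^sup>2 = 1" using t by (metis abs_1 power2_abs one_power2)
    obtain E where E: "has_bochner_integral ?P (\<lambda>G. exp (t * ((\<Sum>i<k. d i * G i) / sqrt n))) (exp E)"
      and Eb: "\<bar>E - (t * (\<Sum>i<k. s i * d i) / sqrt n + t\<^sup>2 * (\<Sum>i<k. s i * (d i)\<^sup>2) / (2 * n))\<bar> \<le> 2 * \<bar>t\<bar> ^ 3 * (\<Sum>i<k. s i) / (n * sqrt n)"
      using gamma_prod_mgf[of s k d n t] s d n t2 by auto
    have sn: "sqrt n \<ge> 2" using n real_sqrt_le_mono[of 4 n] by simp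
    have 1: "has_bochner_integral ?P (\<lambda>G. exp (t * A G)) (exp E * exp (- t * c / sqrt n))"
    proof -
      have "(\<lambda>G. exp (t * A G)) = (\<lambda>G. exp (t * ((\<Sum>i<k. d i * G i) / sqrt n)) * exp (- t * c / sqrt n))"
        by (auto simp: A_def fun_eq_iff diff_divide_distrib right_diff_distrib exp_add[symmetric])
      then show ?thesis using has_bochner_integral_mult_left[OF E, of "exp (- t * c / sqrt n)"] by simp
    qed
    have a: "\<bar>t * ((\<Sum>i<k. s i * d i) - c) / sqrt n\<bar> \<le> N + 1"
    proof -
      have "\<bar>t * ((\<Sum>i<k. s i * d i) - c) / sqrt n\<bar> = \<bar>(\<Sum>i<k. s i * d i) - c\<bar> / sqrt n"
        using t n by (simp add: abs_mult)
      also have "\<dots> \<le> (N + 1) / 1" using c sn n by (intro frac_le) auto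
      finally show ?thesis by simp
    qed
    have nN: "(n + N) / n \<le> N + 1" using n N mult_left_mono[of 1 n N] by (simp add: field_simps)
    have b: "(\<Sum>i<k. s i * (d i)\<^sup>2) / (2 * n) \<le> N + 1"
    proof -
      have "(\<Sum>i<k. s i * (d i)\<^sup>2) \<le> (\<Sum>i<k. s i * 1)"
        using d s by (intro sum_mono mult_left_mono) (auto simp: abs_square_le_1)
      then have "(\<Sum>i<k. s i * (d i)\<^sup>2) / (2 * n) \<le> (n + N) / (1 * n)" using N n by (intro frac_le) auto
      with nN show ?thesis by simp
    qed
    have cc: "2 * \<bar>t\<bar> ^ 3 * (\<Sum>i<k. s i) / (n * sqrt n) \<le> N + 1"
    proof -
      have "2 * (n + N) / (n * sqrt n) \<le> 2 * (n + N) / (n * 2)" using sn n N by (intro divide_left_mono mult_left_mono) auto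
      also have "\<dots> = (n + N) / n" using n by (simp add: field_simps)
      finally have "2 * (n + N) / (n * sqrt n) \<le> N + 1" using nN by (rule order.trans)
      then show ?thesis by (simp only: t N(2) power_one mult_1_right)
    qed
    \<comment> \<open>The drift, the quadratic term and the remainder are each at most
      \<open>N + 1\<close>; the factor 4 leaves room.\<close>
    have "E - t * c / sqrt n \<le> 4 * (N + 1)"
      using Eb a b cc N(1) unfolding t2 by (simp add: right_diff_distrib diff_divide_distrib)
    then have "exp E * exp (- t * c / sqrt n) \<le> exp (4 * (N + 1))" by (simp add: exp_add[symmetric])
    with 1 show ?thesis by blast
  qed
  obtain m1 m2 where m: "has_bochner_integral ?P (\<lambda>G. exp (1 * A G)) m1" "m1 \<le> exp (4 * (N + 1))"
    "has_bochner_integral ?P (\<lambda>G. exp (-1 * A G)) m2" "m2 \<le> exp (4 * (N + 1))"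
    using *[of 1] *[of "-1"] by auto
  have i: "has_bochner_integral ?P (\<lambda>G. exp (A G) + exp (- A G)) (m1 + m2)"
    using has_bochner_integral_add[OF m(1,3)] by simp
  have meas: "A \<in> borel_measurable ?P" unfolding A_def by measurable
  show int: "integrable ?P (\<lambda>G. (A G)\<^sup>2)"
    by (rule Bochner_Integration.integrable_bound[of _ "\<lambda>G. exp (A G) + exp (- A G)"])
      (use i meas sq_le_exp_sum in \<open>auto simp: has_bochner_integral_iff intro!: AE_I2\<close>)
  have "(\<integral>G. (A G)\<^sup>2 \<partial>?P) \<le> (\<integral>G. exp (A G) + exp (- A G) \<partial>?P)"
    using i int sq_le_exp_sum by (intro integral_mono) (auto simp: has_bochner_integral_iff)
  also have "\<dots> = m1 + m2" using i by (rule has_bochner_integral_integral_eq)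
  finally show "(\<integral>G. (A G)\<^sup>2 \<partial>?P) \<le> 2 * exp (4 * (N + 1))" using m by linarith
qed

text \<open>Since the normalisation concentrates at \<open>n\<close>, it may be replaced by the constant \<open>n\<close>.\<close>

lemma dirichlet_law_linearise:
  fixes s d :: "nat \<Rightarrow> real" and n N :: real
  assumes s: "\<And>i. s i \<ge> 0" and d: "\<And>i. i < k \<Longrightarrow> \<bar>d i\<bar> \<le> 1" and n: "n \<ge> 4" and N: "N \<ge> 0" "(\<Sum>i<k. s i) = n + N"
    and c: "\<bar>\<Sum>i<k. s i * d i\<bar> \<le> N + 1" and f: "f \<in> BL1"
  shows "\<bar>(\<integral>w. f (u + sqrt n * (\<Sum>i<k. d i * w i)) \<partial>dirichlet_law {..<k} s)
    - (\<integral>G. f (u + (\<Sum>i<k. d i * G i) / sqrt n) \<partial>(\<Pi>\<^sub>M i\<in>{..<k}. gamma_law (s i)))\<bar> \<le> 20 * exp (4 * (N + 1)) / sqrt n"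
proof -
  let ?P = "\<Pi>\<^sub>M i\<in>{..<k}. gamma_law (s i)"
  interpret product_prob_space "\<lambda>i. gamma_law (s i)" "{..<k}"
    by (intro product_prob_spaceI gamma_law_prob_space s)
  interpret P: prob_space ?P by (intro prob_space_PiM gamma_law_prob_space s)
  note [measurable] = BL1_measurable[OF f]
  define A where "A G = ((\<Sum>i<k. d i * G i) - 0) / sqrt n" for G
  \<comment> \<open>\<open>A\<close> is the scaled numerator and \<open>B\<close> the scaled
    deviation of the normalisation from \<open>n\<close>; both second moments are bounded in terms
    of \<open>N\<close>.\<close>
  define B where "B G = ((\<Sum>i<k. 1 * G i) - n) / sqrt n" for G :: "nat \<Rightarrow> real"
  have A2: "integrable ?P (\<lambda>G. (A G)\<^sup>2)" "(\<integral>G. (A G)\<^sup>2 \<partial>?P) \<le> 2 * exp (4 * (N + 1))"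
    unfolding A_def using gamma_prod_second_moment[of s k d n N 0] s d n N c by auto
  have B2: "integrable ?P (\<lambda>G. (B G)\<^sup>2)" "(\<integral>G. (B G)\<^sup>2 \<partial>?P) \<le> 2 * exp (4 * (N + 1))"
    unfolding B_def using gamma_prod_second_moment[of s k "\<lambda>_. 1" n N n] s d n N by auto
  have mA[measurable]: "A \<in> borel_measurable ?P" unfolding A_def by measurable
  have sn: "sqrt n \<ge> 2" "sqrt n * sqrt n = n" using n real_sqrt_le_mono[of 4 n] by simp_all
  define R where "R G = sqrt n * (\<Sum>i<k. d i * (G i / (\<Sum>j<k. G j)))" for G :: "nat \<Rightarrow> real"
  have mR[measurable]: "R \<in> borel_measurable ?P" unfolding R_def by measurable
  have eq: "(\<integral>w. f (u + sqrt n * (\<Sum>i<k. d i * w i)) \<partial>dirichlet_law {..<k} s) = (\<integral>G. f (u + R G) \<partial>?P)"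
    unfolding dirichlet_law_def R_def by (subst integral_distr) (auto intro!: Bochner_Integration.integral_cong)
  \<comment> \<open>If |B| is at most \<open>sqrt n / 2\<close>, the normalisation is at least
    \<open>n / 2\<close> and the quotient errs by at most 2 |A| |B| / sqrt n. Otherwise, and in
    particular when the normalisation vanishes, the square of \<open>B\<close> exceeds
    \<open>n / 4\<close> and the right-hand side is at least the trivial bound 2.\<close>
  have pt: "\<bar>f (u + R G) - f (u + A G)\<bar> \<le> ((A G)\<^sup>2 + 9 * (B G)\<^sup>2) / sqrt n" for G
  proof (cases "\<bar>B G\<bar> \<le> sqrt n / 2")
    case True
    define S where "S = (\<Sum>j<k. G j)"
    have BS: "sqrt n * B G = S - n" using n by (simp add: B_def S_def)
    have "\<bar>sqrt n * B G\<bar> \<le> sqrt n * (sqrt n / 2)" using mult_left_mono[OF True, of "sqrt n"] n by (simp add: abs_mult)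
    then have "\<bar>S - n\<bar> \<le> n / 2" unfolding BS using sn(2) by (metis times_divide_eq_right)
    then have S: "S \<ge> n / 2" "S > 0" using n by linarith+
    have RA: "R G = A G * (n / S)"
    proof -
      have "(\<Sum>i<k. d i * (G i / S)) = (\<Sum>i<k. d i * G i) / S" by (simp add: sum_divide_distrib)
      moreover have "A G * (n / S) = (\<Sum>i<k. d i * G i) / S * (n / sqrt n)" by (simp add: A_def)
      moreover have "n / sqrt n = sqrt n" using n by (simp add: real_div_sqrt)
      ultimately show ?thesis unfolding R_def S_def[symmetric] by (metis mult.commute)
    qed
    have "\<bar>R G - A G\<bar> = \<bar>A G\<bar> * (sqrt n * \<bar>B G\<bar> / S)"
    proof -
      have "R G - A G = A G * ((n - S) / S)" using S unfolding RA by (simp add: field_simps)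
      moreover have "n - S = - (sqrt n * B G)" using BS by simp
      ultimately show ?thesis using S n by (simp add: abs_mult)
    qed
    also have "\<dots> \<le> \<bar>A G\<bar> * (sqrt n * \<bar>B G\<bar> / (n / 2))"
      using S n by (intro mult_left_mono divide_left_mono) auto
    also have "\<dots> = 2 * \<bar>A G\<bar> * \<bar>B G\<bar> / sqrt n" using sn n by (simp add: field_simps)
    also have "\<dots> \<le> ((A G)\<^sup>2 + (B G)\<^sup>2) / sqrt n"
      using sum_squares_bound[of "\<bar>A G\<bar>" "\<bar>B G\<bar>"] n by (intro divide_right_mono) auto
    also have "\<dots> \<le> ((A G)\<^sup>2 + 9 * (B G)\<^sup>2) / sqrt n" using n by (intro divide_right_mono) auto
    finally show ?thesis using BL1_lipschitz[OF f, of "u + R G" "u + A G"] by simp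
  next
    case False
    then have "(sqrt n / 2)\<^sup>2 \<le> (B G)\<^sup>2" using n by (intro abs_le_square_iff[THEN iffD1]) auto
    then have "n \<le> 4 * (B G)\<^sup>2" using n by (simp add: power_divide)
    moreover have "2 * sqrt n \<le> n" using mult_right_mono[OF sn(1), of "sqrt n"] sn(2) n by simp
    ultimately have "2 * sqrt n \<le> (A G)\<^sup>2 + 9 * (B G)\<^sup>2" by (smt (verit) zero_le_power2)
    then have "2 \<le> ((A G)\<^sup>2 + 9 * (B G)\<^sup>2) / sqrt n" using n by (simp add: field_simps)
    then show ?thesis using BL1_bound[OF f, of "u + R G"] BL1_bound[OF f, of "u + A G"] by linarith
  qed
  have i: "integrable ?P (\<lambda>G. f (u + R G))" "integrable ?P (\<lambda>G. f (u + A G))"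
    by (auto intro!: P.integrable_const_bound[where B=1] simp: BL1_bound[OF f])
  have "\<bar>(\<integral>G. f (u + R G) \<partial>?P) - (\<integral>G. f (u + A G) \<partial>?P)\<bar> = \<bar>\<integral>G. f (u + R G) - f (u + A G) \<partial>?P\<bar>"
    using i by simp
  also have "\<dots> \<le> (\<integral>G. \<bar>f (u + R G) - f (u + A G)\<bar> \<partial>?P)" by (rule integral_abs_bound)
  also have "\<dots> \<le> (\<integral>G. ((A G)\<^sup>2 + 9 * (B G)\<^sup>2) / sqrt n \<partial>?P)"
    using i A2(1) B2(1) pt by (intro integral_mono) auto
  also have "\<dots> = ((\<integral>G. (A G)\<^sup>2 \<partial>?P) + 9 * (\<integral>G. (B G)\<^sup>2 \<partial>?P)) / sqrt n"
    using A2(1) B2(1) by simp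
  \<comment> \<open>20 = 2 + 9 * 2, from the two second moments.\<close>
  also have "\<dots> \<le> (20 * exp (4 * (N + 1))) / sqrt n"
    using A2(2) B2(2) n by (intro divide_right_mono) auto
  finally show ?thesis unfolding eq by (simp add: A_def)
qed

text \<open>The order of quantifiers is the point: \<kappa> and the threshold for \<open>n\<close>
  serve all weights, test functions and shifts at once. This is possible because closeness of laws
  is decided by finitely many transforms, each expanded with a uniform error.\<close>

lemma gamma_prod_clt:
  assumes N: "N \<ge> 0" and \<epsilon>: "\<epsilon> > 0"
  obtains \<kappa> where "\<kappa> > 0"
    "\<forall>\<^sub>F n in sequentially. \<forall>(k::nat) s d f u. (\<forall>i. s i \<ge> 0) \<longrightarrow> (\<forall>i<k. \<bar>d i\<bar> \<le> 1) \<longrightarrow> (\<Sum>i<k. s i) = real n + N \<longrightarrow>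
      \<bar>\<Sum>i<k. s i * d i\<bar> \<le> N + 1 \<longrightarrow> \<bar>(\<Sum>i<k. s i * (d i)\<^sup>2) / n - \<sigma>\<^sup>2\<bar> \<le> \<kappa> \<longrightarrow> f \<in> BL1 \<longrightarrow>
      \<bar>(\<integral>G. f (u + (\<Sum>i<k. d i * G i) / sqrt n) \<partial>(\<Pi>\<^sub>M i\<in>{..<k}. gamma_law (s i))) - (\<integral>y. f (u + y) \<partial>gauss \<sigma>)\<bar> \<le> \<epsilon>"
proof -
  obtain T \<delta> where T: "finite T" and \<delta>: "\<delta> > 0"
    and cl: "\<And>\<mu>. real_distribution \<mu> \<Longrightarrow>
       (\<And>t. t \<in> T \<Longrightarrow> integrable \<mu> (\<lambda>x. exp (t * x)) \<and> \<bar>(\<integral>x. exp (t * x) \<partial>\<mu>) - (\<integral>x. exp (t * x) \<partial>gauss \<sigma>)\<bar> < \<delta>) \<Longrightarrow>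
       d_BL \<mu> (gauss \<sigma>) < \<epsilon>"
    using mgf_close_imp_d_BL_less[OF gauss_real_distribution _ \<epsilon>, of \<sigma>] gauss_mgf
    by (metis has_bochner_integral_iff)
  have "\<exists>\<rho>>0. \<forall>y. \<bar>y - t\<^sup>2 * \<sigma>\<^sup>2 / 2\<bar> < \<rho> \<longrightarrow> \<bar>exp y - exp (t\<^sup>2 * \<sigma>\<^sup>2 / 2)\<bar> < \<delta>" for t
    using isCont_exp[of "t\<^sup>2 * \<sigma>\<^sup>2 / 2"] \<delta> unfolding continuous_at_eps_delta dist_real_def by blast
  then obtain \<rho> where \<rho>: "\<And>t. \<rho> t > 0" "\<And>t y. \<bar>y - t\<^sup>2 * \<sigma>\<^sup>2 / 2\<bar> < \<rho> t \<Longrightarrow> \<bar>exp y - exp (t\<^sup>2 * \<sigma>\<^sup>2 / 2)\<bar> < \<delta>"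
    by metis
  \<comment> \<open>Chosen so that the variance error \<open>t\<^sup>2 * \<kappa> / 2\<close> uses
    less than half of the margin \<open>\<rho> t\<close>; inserting 1 keeps the minimum defined when
    \<open>T\<close> is empty.\<close>
  define \<kappa> where "\<kappa> = Min (insert 1 ((\<lambda>t. \<rho> t / (2 * (1 + t\<^sup>2))) ` T))"
  have p: "1 + t\<^sup>2 > 0" for t :: real by (simp add: add_pos_nonneg)
  have \<kappa>: "\<kappa> > 0" unfolding \<kappa>_def using T \<rho>(1) p by (subst Min_gr_iff) (auto intro!: divide_pos_pos mult_pos_pos simp del: distrib_left_numeral)
  have \<kappa>T: "t\<^sup>2 * \<kappa> / 2 < \<rho> t / 2" if "t \<in> T" for t
  proof -
    have "\<kappa> \<le> \<rho> t / (2 * (1 + t\<^sup>2))" unfolding \<kappa>_def using T that by (intro Min_le) auto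
    then have "2 * (1 + t\<^sup>2) * \<kappa> \<le> \<rho> t" using p[of t] by (simp add: field_simps)
    moreover have "t\<^sup>2 * \<kappa> < 2 * (1 + t\<^sup>2) * \<kappa>" using \<kappa> zero_le_power2[of t] by (intro mult_strict_right_mono) (simp_all add: add_nonneg_pos)
    ultimately show ?thesis by simp
  qed
  \<comment> \<open>The other half of the margin takes the drift, at most \<open>N + 1\<close>
    before scaling, and the cubic remainder.\<close>
  have ev: "\<forall>\<^sub>F n in sequentially. \<forall>t\<in>T. \<bar>t\<bar> * (N + 1) / sqrt (real n) + 2 * \<bar>t\<bar> ^ 3 * (real n + N) / (real n * sqrt (real n)) < \<rho> t / 2 \<and> 4 * t\<^sup>2 \<le> real n \<and> n \<ge> 1"
  proof (rule eventually_ball_finite[OF T], rule ballI, intro eventually_conj)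
    fix t assume "t \<in> T"
    have "(\<lambda>n. \<bar>t\<bar> * (N + 1) / sqrt (real n) + 2 * \<bar>t\<bar> ^ 3 * (real n + N) / (real n * sqrt (real n))) \<longlonglongrightarrow> 0"
      by real_asymp
    then show "\<forall>\<^sub>F n in sequentially. \<bar>t\<bar> * (N + 1) / sqrt (real n) + 2 * \<bar>t\<bar> ^ 3 * (real n + N) / (real n * sqrt (real n)) < \<rho> t / 2"
      using \<rho>(1)[of t] by (intro order_tendstoD(2)) auto
    show "\<forall>\<^sub>F n in sequentially. 4 * t\<^sup>2 \<le> real n" by real_asymp
  qed (rule eventually_ge_at_top)
  show thesis
  proof (rule that[OF \<kappa>], use ev eventually_ge_at_top[of 1] in eventually_elim, intro allI impI)
    fix n k :: nat and s d :: "nat \<Rightarrow> real" and f u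
    assume n: "\<forall>t\<in>T. \<bar>t\<bar> * (N + 1) / sqrt (real n) + 2 * \<bar>t\<bar> ^ 3 * (real n + N) / (real n * sqrt (real n)) < \<rho> t / 2 \<and> 4 * t\<^sup>2 \<le> real n \<and> n \<ge> 1"
      and n1: "1 \<le> n"
      and s: "\<forall>i. s i \<ge> 0" and d: "\<forall>i<k. \<bar>d i\<bar> \<le> 1" and sn: "(\<Sum>i<k. s i) = real n + N"
      and c: "\<bar>\<Sum>i<k. s i * d i\<bar> \<le> N + 1" and v: "\<bar>(\<Sum>i<k. s i * (d i)\<^sup>2) / n - \<sigma>\<^sup>2\<bar> \<le> \<kappa>" and f: "f \<in> BL1"
    let ?P = "\<Pi>\<^sub>M i\<in>{..<k}. gamma_law (s i)"
    interpret P: prob_space ?P using s by (intro prob_space_PiM gamma_law_prob_space) auto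
    let ?A = "\<lambda>G. (\<Sum>i<k. d i * G i) / sqrt n"
    have mA[measurable]: "?A \<in> borel_measurable ?P" by measurable
    have rd: "real_distribution (distr ?P borel ?A)" by (rule P.real_distribution_distr) measurable
    have "d_BL (distr ?P borel ?A) (gauss \<sigma>) < \<epsilon>"
    proof (rule cl[OF rd])
      fix t assume t: "t \<in> T"
      obtain E where E: "has_bochner_integral ?P (\<lambda>G. exp (t * ((\<Sum>i<k. d i * G i) / sqrt n))) (exp E)"
        and Eb: "\<bar>E - (t * (\<Sum>i<k. s i * d i) / sqrt n + t\<^sup>2 * (\<Sum>i<k. s i * (d i)\<^sup>2) / (2 * n))\<bar> \<le> 2 * \<bar>t\<bar> ^ 3 * (\<Sum>i<k. s i) / (n * sqrt n)"
        using gamma_prod_mgf[of s k d "real n" t] s d n t by auto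
      have gen: "\<bar>e - (p + q)\<bar> \<le> r \<Longrightarrow> \<bar>p\<bar> \<le> a \<Longrightarrow> \<bar>q - v\<bar> \<le> b \<Longrightarrow> a + r < w / 2 \<Longrightarrow> b < w / 2 \<Longrightarrow> \<bar>e - v\<bar> < w"
        for e p q r a v b w :: real by linarith
      have p1: "\<bar>t * (\<Sum>i<k. s i * d i) / sqrt n\<bar> \<le> \<bar>t\<bar> * (N + 1) / sqrt n"
        using c by (simp add: abs_mult divide_right_mono mult_left_mono)
      have p2: "\<bar>t\<^sup>2 * (\<Sum>i<k. s i * (d i)\<^sup>2) / (2 * n) - t\<^sup>2 * \<sigma>\<^sup>2 / 2\<bar> \<le> t\<^sup>2 * \<kappa> / 2"
      proof -
        have "t\<^sup>2 * (\<Sum>i<k. s i * (d i)\<^sup>2) / (2 * n) - t\<^sup>2 * \<sigma>\<^sup>2 / 2 = t\<^sup>2 / 2 * ((\<Sum>i<k. s i * (d i)\<^sup>2) / n - \<sigma>\<^sup>2)"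
          by (simp add: field_simps)
        also have "\<bar>\<dots>\<bar> \<le> t\<^sup>2 / 2 * \<kappa>" unfolding abs_mult using v by (intro mult_mono) auto
        finally show ?thesis by simp
      qed
      have "\<bar>E - t\<^sup>2 * \<sigma>\<^sup>2 / 2\<bar> < \<rho> t"
        by (rule gen[OF Eb[unfolded sn] p1 p2 n[rule_format, OF t, THEN conjunct1] \<kappa>T[OF t]])
      then have "\<bar>exp E - exp (t\<^sup>2 * \<sigma>\<^sup>2 / 2)\<bar> < \<delta>" by (rule \<rho>(2))
      then show "integrable (distr ?P borel ?A) (\<lambda>x. exp (t * x)) \<and> \<bar>(\<integral>x. exp (t * x) \<partial>distr ?P borel ?A) - (\<integral>x. exp (t * x) \<partial>gauss \<sigma>)\<bar> < \<delta>"
        using E gauss_mgf[of \<sigma> t] by (auto simp: integrable_distr_eq integral_distr has_bochner_integral_iff)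
    qed
    \<comment> \<open>\<open>BL1\<close> is closed under translation, so the shift \<open>u\<close>
      costs nothing.\<close>
    moreover have "(\<lambda>y. f (u + y)) \<in> BL1"
      using BL1_bound[OF f] BL1_lipschitz[OF f] by (intro BL1_I) (auto, smt (verit))
    moreover have "prob_space (distr ?P borel ?A)" "prob_space (gauss \<sigma>)"
      using rd gauss_real_distribution[of \<sigma>] by (auto simp: real_distribution_def)
    ultimately have "\<bar>(\<integral>y. f (u + y) \<partial>distr ?P borel ?A) - (\<integral>y. f (u + y) \<partial>gauss \<sigma>)\<bar> \<le> \<epsilon>"
      using d_BL_ge[of "distr ?P borel ?A" "gauss \<sigma>" "\<lambda>y. f (u + y)"] by linarith
    then show "\<bar>(\<integral>G. f (u + ?A G) \<partial>?P) - (\<integral>y. f (u + y) \<partial>gauss \<sigma>)\<bar> \<le> \<epsilon>"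
      using BL1_measurable[OF f] by (simp add: integral_distr)
  qed
qed

section \<open>From Dirichlet vectors to the posterior Dirichlet process\<close>

lemma emeasure_add_measure:
  assumes "sets \<mu> = sets \<nu>" "A \<in> sets \<mu>"
  shows "emeasure (add_measure \<mu> \<nu>) A = emeasure \<mu> A + emeasure \<nu> A"
  unfolding add_measure_def
proof (rule emeasure_measure_of_sigma[OF sets.sigma_algebra_axioms _ _ assms(2)])
  show "positive (sets \<mu>) (\<lambda>A. emeasure \<mu> A + emeasure \<nu> A)" by (simp add: positive_def)
  show "countably_additive (sets \<mu>) (\<lambda>A. emeasure \<mu> A + emeasure \<nu> A)"
    using assms(1) by (auto simp: countably_additive_def suminf_add[symmetric] suminf_emeasure)
qed

lemma measure_dp_posterior_base:
  assumes "finite_measure \<nu>" "sets \<nu> = sets borel" "n \<ge> 1" "A \<in> sets borel"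
  shows "measure (dp_posterior_base \<nu> n x) A = measure \<nu> A + (\<Sum>i<n. indicator A (fst (x i)))"
proof -
  interpret finite_measure \<nu> by fact
  have "emeasure (empirical_measure n (\<lambda>i. fst (x i))) A = ennreal (card ((\<lambda>i. fst (x i)) -` A \<inter> {..<n}) / n)"
    unfolding empirical_measure_def using assms
    by (subst emeasure_distr)
      (auto simp: emeasure_uniform_count_measure space_uniform_count_measure sets_uniform_count_measure measurable_def)
  then have "emeasure (scale_measure (of_nat n) (empirical_measure n (\<lambda>i. fst (x i)))) A = ennreal (card ((\<lambda>i. fst (x i)) -` A \<inter> {..<n}))"
    using assms(3) by (simp add: ennreal_of_nat_eq_real_of_nat ennreal_mult'[symmetric])
  also have "real (card ((\<lambda>i. fst (x i)) -` A \<inter> {..<n})) = (\<Sum>i<n. indicator A (fst (x i)))"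
    by (auto simp: indicator_def sum.If_cases Int_def vimage_def conj_commute intro!: arg_cong[where f=card])
  finally have "emeasure (dp_posterior_base \<nu> n x) A = ennreal (measure \<nu> A + (\<Sum>i<n. indicator A (fst (x i))))"
    unfolding dp_posterior_base_def using assms
    by (subst emeasure_add_measure) (auto simp: empirical_measure_def emeasure_eq_measure ennreal_plus[symmetric] sum_nonneg simp del: ennreal_plus)
  then show ?thesis by (rule measure_eq_emeasure_eq_ennreal[rotated]) (simp add: sum_nonneg)
qed

lemma chi_measurable:
  assumes b: "b \<in> borel_measurable borel"
  shows "chi b \<in> borel_measurable (prob_algebra borel)"
  unfolding chi_def[abs_def]
  by (rule measurable_prob_algebraD[THEN measurable_compose, OF measurable_ident_sets[OF refl] integral_measurable_subprob_algebra[OF b], unfolded id_def]) 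

text \<open>A Dirichlet process is given through finite partitions, so \<open>b\<close> is rounded
  down to the grid of mesh 1 / n, and the cells are the level sets of the result. The rounding error
  becomes 1 / sqrt n after scaling, uniformly in \<open>b\<close>; hence one threshold serves all
  regression functions.\<close>

lemma dirichlet_process_clt:
  fixes \<nu> :: "'z::topological_space measure"
  assumes fin: "finite_measure \<nu>" and sets: "sets \<nu> = sets borel" and \<epsilon>: "\<epsilon> > 0"
  obtains \<kappa> where "\<kappa> > 0"
    "\<forall>\<^sub>F n in sequentially. \<forall>x D b f u. dirichlet_process (dp_posterior_base \<nu> n x) D \<longrightarrow>
      b \<in> borel_measurable borel \<longrightarrow> (\<forall>z. 0 \<le> b z \<and> b z \<le> 1) \<longrightarrow>
      \<bar>(\<Sum>i<n. (b (fst (x i)) - (\<Sum>i<n. b (fst (x i))) / n)\<^sup>2) / n - \<sigma>\<^sup>2\<bar> \<le> \<kappa> \<longrightarrow> f \<in> BL1 \<longrightarrow>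
      \<bar>(\<integral>F. f (u + sqrt n * (chi b F - (\<Sum>i<n. b (fst (x i))) / n)) \<partial>D) - (\<integral>y. f (u + y) \<partial>gauss \<sigma>)\<bar> \<le> \<epsilon>"
proof -
  interpret \<nu>: finite_measure \<nu> by fact
  define N where "N = measure \<nu> UNIV"
  have N: "N \<ge> 0" by (simp add: N_def)
  have sp: "space \<nu> = UNIV" using sets_eq_imp_space_eq[OF sets] by simp
  \<comment> \<open>One third each for the gamma limit theorem, the linearisation of the
    normalisation and the rounding.\<close>
  have e3: "\<epsilon> / 3 > 0" using \<epsilon> by simp
  obtain \<kappa>' where \<kappa>': "\<kappa>' > 0"
    and clt: "\<forall>\<^sub>F n in sequentially. \<forall>(k::nat) s d f u. (\<forall>i. s i \<ge> 0) \<longrightarrow> (\<forall>i<k. \<bar>d i\<bar> \<le> 1) \<longrightarrow> (\<Sum>i<k. s i) = real n + N \<longrightarrow>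
      \<bar>\<Sum>i<k. s i * d i\<bar> \<le> N + 1 \<longrightarrow> \<bar>(\<Sum>i<k. s i * (d i)\<^sup>2) / n - \<sigma>\<^sup>2\<bar> \<le> \<kappa>' \<longrightarrow> f \<in> BL1 \<longrightarrow>
      \<bar>(\<integral>G. f (u + (\<Sum>i<k. d i * G i) / sqrt n) \<partial>(\<Pi>\<^sub>M i\<in>{..<k}. gamma_law (s i))) - (\<integral>y. f (u + y) \<partial>gauss \<sigma>)\<bar> \<le> \<epsilon> / 3"
    using gamma_prod_clt[OF N e3, of \<sigma>] by auto
  have l1: "(\<lambda>n. 20 * exp (4 * (N + 1)) / sqrt (real n)) \<longlonglongrightarrow> 0" by real_asymp
  have l2: "(\<lambda>n. 1 / sqrt (real n)) \<longlonglongrightarrow> 0" by real_asymp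
  have l3: "(\<lambda>n. (N + 2) / real n) \<longlonglongrightarrow> 0" by (rule lim_const_over_n)
  show thesis
  \<comment> \<open>The other half of \<open>\<kappa>'\<close> is kept for the rounding and the base
    measure, which disturb the variance by at most \<open>(N + 2) / n\<close>.\<close>
  proof (rule that[of "\<kappa>' / 2"])
    show "\<kappa>' / 2 > 0" using \<kappa>' by simp
    show "\<forall>\<^sub>F n in sequentially. \<forall>x D b f u. dirichlet_process (dp_posterior_base \<nu> n x) D \<longrightarrow>
      b \<in> borel_measurable borel \<longrightarrow> (\<forall>z. 0 \<le> b z \<and> b z \<le> 1) \<longrightarrow>
      \<bar>(\<Sum>i<n. (b (fst (x i)) - (\<Sum>i<n. b (fst (x i))) / n)\<^sup>2) / n - \<sigma>\<^sup>2\<bar> \<le> \<kappa>' / 2 \<longrightarrow> f \<in> BL1 \<longrightarrow>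
      \<bar>(\<integral>F. f (u + sqrt n * (chi b F - (\<Sum>i<n. b (fst (x i))) / n)) \<partial>D) - (\<integral>y. f (u + y) \<partial>gauss \<sigma>)\<bar> \<le> \<epsilon>"
      using clt order_tendstoD(2)[OF l1 e3] order_tendstoD(2)[OF l2 e3] order_tendstoD(2)[OF l3 half_gt_zero[OF \<kappa>']] eventually_ge_at_top[of 4]
    proof eventually_elim
      case (elim n)
      note 2 = elim
      show ?case
      proof (intro allI impI)
        fix x :: "nat \<Rightarrow> 'z obs" and D b f u
        assume D: "dirichlet_process (dp_posterior_base \<nu> n x) D" and b: "b \<in> borel_measurable borel"
          and b01: "\<forall>z. 0 \<le> b z \<and> b z \<le> 1"
          and v: "\<bar>(\<Sum>i<n. (b (fst (x i)) - (\<Sum>i<n. b (fst (x i))) / n)\<^sup>2) / n - \<sigma>\<^sup>2\<bar> \<le> \<kappa>' / 2" and f: "f \<in> BL1"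
        have n: "n \<ge> 4" "n \<ge> 1" "real n > 0" using 2 by auto
        note [measurable] = b BL1_measurable[OF f]
        define z where "z i = fst (x i)" for i
        define m where "m = (\<Sum>i<n. b (z i)) / n"
        have m01: "0 \<le> m" "m \<le> 1"
        proof -
          show "0 \<le> m" unfolding m_def using b01 by (auto intro!: divide_nonneg_nonneg sum_nonneg)
          have "(\<Sum>i<n. b (z i)) \<le> (\<Sum>i<n. 1)" using b01 by (intro sum_mono) auto
          then show "m \<le> 1" unfolding m_def using n by simp
        qed
        \<comment> \<open>Index of the cell of \<open>y\<close>. It runs from 0 to \<open>n\<close>
          inclusive, because \<open>b\<close> may equal 1; hence \<open>Suc n\<close> cells.\<close>
        define J where "J y = nat \<lfloor>real n * b y\<rfloor>" for y
        have mJ[measurable]: "J \<in> measurable borel (count_space UNIV)" unfolding J_def by measurable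
        have J: "real (J y) \<le> n * b y" "n * b y \<le> real (J y) + 1" for y
          using b01 by (auto simp: J_def le_nat_floor) 
        have Jn: "J y < Suc n" for y
        proof -
          have "real n * b y \<le> real n" using b01 n by (simp add: mult_left_le)
          then have "real (J y) \<le> real n" using J(1)[of y] by linarith
          then show ?thesis by simp
        qed
        define A where "A j = {y. J y = j}" for j
        have A: "A j \<in> sets borel" for j unfolding A_def using measurable_sets[OF mJ, of "{j}"] by (simp add: vimage_def)
        have dis: "disjoint_family_on A {..<Suc n}" by (auto simp: disjoint_family_on_def A_def)
        have UN: "(\<Union>j<Suc n. A j) = UNIV" using Jn by (auto simp: A_def)
        define s where "s j = measure (dp_posterior_base \<nu> n x) (A j)" for j
        have s: "s j = measure \<nu> (A j) + (\<Sum>i<n. indicator (A j) (z i))" for j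
          unfolding s_def z_def by (rule measure_dp_posterior_base[OF fin sets n(2) A])
        \<comment> \<open>Centring at the sample mean cancels the sample part of the drift up to
          \<open>n\<close> rounding errors of size 1 / n; the base measure adds at most
          \<open>N\<close>, whence the bound \<open>N + 1\<close>.\<close>
        define d where "d j = real j / n - m" for j
        have swap: "(\<Sum>j<Suc n. s j * \<phi> j) = (\<Sum>i<n. \<phi> (J (z i))) + (\<Sum>j<Suc n. measure \<nu> (A j) * \<phi> j)" for \<phi>
        proof -
          have "(\<Sum>j<Suc n. indicator (A j) (z i) * \<phi> j) = \<phi> (J (z i))" for i
          proof -
            have "(\<Sum>j<Suc n. indicator (A j) (z i) * \<phi> j) = (\<Sum>j<Suc n. if j = J (z i) then \<phi> j else 0)"
              by (intro sum.cong) (auto simp: A_def indicator_def)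
            also have "\<dots> = \<phi> (J (z i))" using Jn[of "z i"] by simp
            finally show ?thesis .
          qed
          then have "(\<Sum>i<n. \<phi> (J (z i))) = (\<Sum>j<Suc n. \<Sum>i<n. indicator (A j) (z i) * \<phi> j)"
            by (subst sum.swap) (intro sum.cong, auto)
          then show ?thesis unfolding s by (simp only: distrib_right sum.distrib sum_distrib_right)
        qed
        have \<nu>N: "(\<Sum>j<Suc n. measure \<nu> (A j)) = N"
          using \<nu>.finite_measure_finite_Union[OF finite_lessThan _ dis] A UN sets by (simp add: N_def image_subset_iff)
        have \<nu>b: "\<bar>\<Sum>j<Suc n. measure \<nu> (A j) * \<phi> j\<bar> \<le> N" if "\<And>j. j < Suc n \<Longrightarrow> \<bar>\<phi> j\<bar> \<le> 1" for \<phi>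
        proof -
          have "\<bar>\<Sum>j<Suc n. measure \<nu> (A j) * \<phi> j\<bar> \<le> (\<Sum>j<Suc n. \<bar>measure \<nu> (A j) * \<phi> j\<bar>)" by (rule sum_abs)
          also have "\<dots> \<le> (\<Sum>j<Suc n. measure \<nu> (A j))"
            using that by (intro sum_mono) (auto simp: abs_mult mult_left_le)
          finally show ?thesis using \<nu>N by simp
        qed
        have d1: "\<bar>d j\<bar> \<le> 1" if "j < Suc n" for j
        proof -
          have "0 \<le> real j / n" "real j / n \<le> 1" using that n by auto
          then show ?thesis using m01 unfolding d_def by linarith
        qed
        have dJ: "\<bar>d (J y) - (b y - m)\<bar> \<le> 1 / n" for y
        proof -
          have "real (J y) / n \<le> b y" "b y \<le> real (J y) / n + 1 / n" using J[of y] n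
            by (auto simp: field_simps)
          then show ?thesis by (auto simp: d_def)
        qed
        have s0: "(\<Sum>j<Suc n. s j) = real n + N" using swap[of "\<lambda>_. 1"] \<nu>N by simp
        have s1: "\<bar>\<Sum>j<Suc n. s j * d j\<bar> \<le> N + 1"
        proof -
          have "(\<Sum>i<n. b (z i) - m) = 0" using n by (simp add: sum_subtractf m_def)
          then have "\<bar>\<Sum>i<n. d (J (z i))\<bar> = \<bar>\<Sum>i<n. d (J (z i)) - (b (z i) - m)\<bar>" by (simp add: sum_subtractf)
          also have "\<dots> \<le> (\<Sum>i<n. 1 / n)" by (intro order.trans[OF sum_abs] sum_mono dJ)
          also have "\<dots> = 1" using n by simp
          finally show ?thesis using swap[of d] \<nu>b[of d, OF d1] by linarith
        qed
        have s2: "\<bar>(\<Sum>j<Suc n. s j * (d j)\<^sup>2) / n - \<sigma>\<^sup>2\<bar> \<le> \<kappa>'"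
        proof -
          have "\<bar>(\<Sum>i<n. (d (J (z i)))\<^sup>2) - (\<Sum>i<n. (b (z i) - m)\<^sup>2)\<bar> = \<bar>\<Sum>i<n. (d (J (z i)))\<^sup>2 - (b (z i) - m)\<^sup>2\<bar>"
            by (simp add: sum_subtractf)
          also have "\<dots> \<le> (\<Sum>i<n. 2 * (1 / n))"
          proof (intro order.trans[OF sum_abs] sum_mono)
            fix i
            have "\<bar>(d (J (z i)))\<^sup>2 - (b (z i) - m)\<^sup>2\<bar> = \<bar>d (J (z i)) + (b (z i) - m)\<bar> * \<bar>d (J (z i)) - (b (z i) - m)\<bar>"
              by (simp add: abs_mult[symmetric] power2_eq_square algebra_simps)
            also have "\<dots> \<le> 2 * (1 / n)"
            proof (intro mult_mono dJ)
              have "\<bar>b (z i) - m\<bar> \<le> 1" using b01[rule_format, of "z i"] m01 by linarith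
              then show "\<bar>d (J (z i)) + (b (z i) - m)\<bar> \<le> 2" using d1[OF Jn[of "z i"]] by linarith
            qed auto
            finally show "\<bar>(d (J (z i)))\<^sup>2 - (b (z i) - m)\<^sup>2\<bar> \<le> 2 * (1 / n)" .
          qed
          also have "\<dots> = 2" using n by simp
          finally have 1: "\<bar>(\<Sum>i<n. (d (J (z i)))\<^sup>2) - (\<Sum>i<n. (b (z i) - m)\<^sup>2)\<bar> \<le> 2" .
          have "\<bar>\<Sum>j<Suc n. measure \<nu> (A j) * (d j)\<^sup>2\<bar> \<le> N" using d1 by (intro \<nu>b) (simp add: abs_square_le_1)
          with 1 have "\<bar>(\<Sum>j<Suc n. s j * (d j)\<^sup>2) - (\<Sum>i<n. (b (z i) - m)\<^sup>2)\<bar> \<le> N + 2"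
            unfolding swap by linarith
          then have "\<bar>(\<Sum>j<Suc n. s j * (d j)\<^sup>2) / n - (\<Sum>i<n. (b (z i) - m)\<^sup>2) / n\<bar> \<le> (N + 2) / n"
            using n by (simp add: diff_divide_distrib[symmetric] divide_right_mono)
          then show ?thesis using v 2(4)[OF] unfolding z_def[symmetric] m_def[symmetric] by linarith
        qed
        have sge: "\<forall>j. s j \<ge> 0" by (simp add: s_def)
        have c1: "\<bar>(\<integral>G. f (u + (\<Sum>i<Suc n. d i * G i) / sqrt n) \<partial>(\<Pi>\<^sub>M i\<in>{..<Suc n}. gamma_law (s i))) - (\<integral>y. f (u + y) \<partial>gauss \<sigma>)\<bar> \<le> \<epsilon> / 3"
          using 2(1) sge d1 s0 s1 s2 f by blast
        have c2: "\<bar>(\<integral>w. f (u + sqrt n * (\<Sum>i<Suc n. d i * w i)) \<partial>dirichlet_law {..<Suc n} s)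
           - (\<integral>G. f (u + (\<Sum>i<Suc n. d i * G i) / sqrt n) \<partial>(\<Pi>\<^sub>M i\<in>{..<Suc n}. gamma_law (s i)))\<bar> \<le> \<epsilon> / 3"
          using dirichlet_law_linearise[of s "Suc n" d "real n" N f u] sge d1 n s0 s1 f N 2(2) by auto
        from D have pD: "prob_space D" and sD[measurable_cong]: "sets D = sets (prob_algebra borel)"
          and dD: "distr D (\<Pi>\<^sub>M i\<in>{..<Suc n}. borel) (\<lambda>F. \<lambda>i\<in>{..<Suc n}. measure F (A i)) = dirichlet_law {..<Suc n} s"
          unfolding dirichlet_process_def s_def using A dis UN by blast+
        interpret D: prob_space D by fact
        have mm: "(\<lambda>F. measure F (A i)) \<in> borel_measurable D" for i
          unfolding measurable_cong_sets[OF sD refl]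
          by (rule measurable_prob_algebraD[THEN measurable_compose, OF measurable_ident_sets[OF refl] measurable_measure_subprob_algebra[OF A], unfolded id_def])
        have mc: "chi b \<in> borel_measurable D" unfolding measurable_cong_sets[OF sD refl] by (rule chi_measurable[OF b])
        note [measurable] = mm mc
        have eq: "(\<integral>w. f (u + sqrt n * (\<Sum>i<Suc n. d i * w i)) \<partial>dirichlet_law {..<Suc n} s)
           = (\<integral>F. f (u + sqrt n * (\<Sum>i<Suc n. d i * measure F (A i))) \<partial>D)"
          unfolding dD[symmetric] by (subst integral_distr) (auto intro!: Bochner_Integration.integral_cong measurable_restrict)
        have pt: "\<bar>f (u + sqrt n * (chi b F - m)) - f (u + sqrt n * (\<Sum>i<Suc n. d i * measure F (A i)))\<bar> \<le> 1 / sqrt n"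
          if F: "F \<in> space D" for F
        proof -
          have F: "prob_space F" "sets F = sets borel"
            using F sets_eq_imp_space_eq[OF sD] by (auto simp: space_prob_algebra)
          interpret F: prob_space F by fact
          note [measurable_cong] = F(2)
          have spF: "space F = UNIV" using sets_eq_imp_space_eq[OF F(2)] by simp
          have ib: "integrable F b" using b01 by (intro F.integrable_const_bound[where B=1]) auto
          have id: "integrable F (\<lambda>y. d (J y))" using d1 Jn by (intro F.integrable_const_bound[where B=1]) auto
          have "(\<integral>y. d (J y) \<partial>F) = (\<integral>y. (\<Sum>j<Suc n. d j * indicator (A j) y) \<partial>F)"
          proof (intro Bochner_Integration.integral_cong refl)
            fix y
            have "(\<Sum>j<Suc n. d j * indicator (A j) y) = (\<Sum>j<Suc n. if j = J y then d j else 0)"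
              by (intro sum.cong) (auto simp: A_def indicator_def)
            also have "\<dots> = d (J y)" using Jn[of y] by simp
            finally show "d (J y) = (\<Sum>j<Suc n. d j * indicator (A j) y)" by simp
          qed
          also have "\<dots> = (\<Sum>j<Suc n. d j * measure F (A j))"
            using A F(2) spF by (subst Bochner_Integration.integral_sum) (auto intro!: integrable_mult_right simp: F.emeasure_eq_measure)
          finally have 1: "(\<integral>y. d (J y) \<partial>F) = (\<Sum>j<Suc n. d j * measure F (A j))" .
          have "(chi b F - m) - (\<integral>y. d (J y) \<partial>F) = (\<integral>y. (b y - m) - d (J y) \<partial>F)"
            using ib id by (simp add: chi_def F.prob_space)
          also have "\<bar>\<dots>\<bar> \<le> (\<integral>y. \<bar>(b y - m) - d (J y)\<bar> \<partial>F)" by (rule integral_abs_bound)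
          also have "\<dots> \<le> (\<integral>y. 1 / n \<partial>F)"
            using ib id dJ by (intro integral_mono) (auto simp: abs_minus_commute)
          also have "\<dots> = 1 / n" by (simp add: F.prob_space)
          finally have 2: "\<bar>(chi b F - m) - (\<Sum>j<Suc n. d j * measure F (A j))\<bar> \<le> 1 / n" unfolding 1 .
          have "\<bar>f (u + sqrt n * (chi b F - m)) - f (u + sqrt n * (\<Sum>i<Suc n. d i * measure F (A i)))\<bar>
            \<le> \<bar>sqrt n * ((chi b F - m) - (\<Sum>j<Suc n. d j * measure F (A j)))\<bar>"
            using BL1_lipschitz[OF f, of "u + sqrt n * (chi b F - m)" "u + sqrt n * (\<Sum>i<Suc n. d i * measure F (A i))"] by (simp only: right_diff_distrib add_diff_cancel_left)
          also have "\<dots> \<le> sqrt n * (1 / n)" unfolding abs_mult using 2 by (intro mult_mono) auto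
          also have "\<dots> = 1 / sqrt n" using n by (simp add: field_simps)
          finally show ?thesis .
        qed
        have i1: "integrable D (\<lambda>F. f (u + sqrt n * (chi b F - m)))" "integrable D (\<lambda>F. f (u + sqrt n * (\<Sum>i<Suc n. d i * measure F (A i))))"
          by (intro D.integrable_const_bound[where B=1] AE_I2; simp add: BL1_bound[OF f])+
        have "\<bar>(\<integral>F. f (u + sqrt n * (chi b F - m)) \<partial>D) - (\<integral>F. f (u + sqrt n * (\<Sum>i<Suc n. d i * measure F (A i))) \<partial>D)\<bar>
           = \<bar>\<integral>F. f (u + sqrt n * (chi b F - m)) - f (u + sqrt n * (\<Sum>i<Suc n. d i * measure F (A i))) \<partial>D\<bar>"
          by (subst Bochner_Integration.integral_diff[OF i1]) simp
        also have "\<dots> \<le> (\<integral>F. \<bar>f (u + sqrt n * (chi b F - m)) - f (u + sqrt n * (\<Sum>i<Suc n. d i * measure F (A i)))\<bar> \<partial>D)"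
          by (rule integral_abs_bound)
        also have "\<dots> \<le> (\<integral>F. 1 / sqrt n \<partial>D)"
          using i1 pt by (intro integral_mono Bochner_Integration.integrable_abs Bochner_Integration.integrable_diff) auto
        also have "\<dots> = 1 / sqrt n" by (simp add: D.prob_space)
        finally show "\<bar>(\<integral>F. f (u + sqrt n * (chi b F - (\<Sum>i<n. b (fst (x i))) / n)) \<partial>D) - (\<integral>y. f (u + y) \<partial>gauss \<sigma>)\<bar> \<le> \<epsilon>"
          unfolding z_def[symmetric] m_def[symmetric] using c1 c2 2(3) unfolding eq by linarith
      qed
    qed
  qed
qed

section \<open>Essential suprema of multiplier processes\<close>

text \<open>A true supremum over the sieve need not be measurable, and on the given probability space
  the inequalities of symmetrisation can fail for its outer expectation. The posterior only sees
  the essential supremum with respect to the prior, which is measurable.\<close>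

definition ess_norm :: "'e measure \<Rightarrow> ('e \<Rightarrow> real) \<Rightarrow> ennreal" where
  "ess_norm R f = esssup R (\<lambda>\<eta>. ennreal \<bar>f \<eta>\<bar>)"

lemma ess_norm_AE: "AE \<eta> in R. ennreal \<bar>f \<eta>\<bar> \<le> ess_norm R f"
  unfolding ess_norm_def by (rule esssup_AE)

lemma ess_norm_le:
  assumes "f \<in> borel_measurable R" "AE \<eta> in R. ennreal \<bar>f \<eta>\<bar> \<le> c"
  shows "ess_norm R f \<le> c"
  unfolding ess_norm_def using assms by (intro esssup_I) auto

lemma ess_norm_sum_scaled:
  assumes f: "\<And>i. i \<in> I \<Longrightarrow> f i \<in> borel_measurable R" and fin: "finite I"
    and h: "h \<in> borel_measurable R" "\<And>\<eta>. \<eta> \<in> space R \<Longrightarrow> \<bar>h \<eta>\<bar> \<le> (\<Sum>i\<in>I. c i * \<bar>f i \<eta>\<bar>)"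
    and c: "\<And>i. i \<in> I \<Longrightarrow> c i \<ge> 0"
  shows "ess_norm R h \<le> (\<Sum>i\<in>I. ennreal (c i) * ess_norm R (f i))"
proof (rule ess_norm_le[OF h(1)])
  have "AE \<eta> in R. \<forall>i\<in>I. ennreal \<bar>f i \<eta>\<bar> \<le> ess_norm R (f i)"
    using fin ess_norm_AE by (intro AE_finite_allI) auto
  then show "AE \<eta> in R. ennreal \<bar>h \<eta>\<bar> \<le> (\<Sum>i\<in>I. ennreal (c i) * ess_norm R (f i))"
  proof (rule AE_mp, intro AE_I2 impI)
    fix \<eta> assume "\<eta> \<in> space R" and *: "\<forall>i\<in>I. ennreal \<bar>f i \<eta>\<bar> \<le> ess_norm R (f i)"
    have "ennreal \<bar>h \<eta>\<bar> \<le> ennreal (\<Sum>i\<in>I. c i * \<bar>f i \<eta>\<bar>)" using h(2)[OF \<open>\<eta> \<in> space R\<close>] by (rule ennreal_leI)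
    also have "\<dots> = (\<Sum>i\<in>I. ennreal (c i) * ennreal \<bar>f i \<eta>\<bar>)"
      using c by (simp add: sum_ennreal[symmetric] ennreal_mult)
    also have "\<dots> \<le> (\<Sum>i\<in>I. ennreal (c i) * ess_norm R (f i))"
      using * by (intro sum_mono mult_left_mono) auto
    finally show "ennreal \<bar>h \<eta>\<bar> \<le> (\<Sum>i\<in>I. ennreal (c i) * ess_norm R (f i))" .
  qed
qed

text \<open>The essential supremum exceeds \<open>y\<close> exactly when the section where |f x|
  exceeds \<open>y\<close> has positive measure, and the measure of a section depends measurably on
  \<open>x\<close>. A pointwise supremum over \<eta> has no such description.\<close>

lemma ess_norm_measurable:
  assumes R: "sigma_finite_measure R" and f: "(\<lambda>(x, \<eta>). f x \<eta>) \<in> borel_measurable (A \<Otimes>\<^sub>M R)"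
  shows "(\<lambda>x. ess_norm R (f x)) \<in> borel_measurable A"
proof (rule borel_measurableI_greater)
  fix y :: ennreal
  interpret sigma_finite_measure R by fact
  note [measurable] = f
  have fx: "f x \<in> borel_measurable R" if "x \<in> space A" for x
    using measurable_compose[OF measurable_Pair1'[OF that] f] by simp
  define Q where "Q = {p \<in> space (A \<Otimes>\<^sub>M R). y < ennreal \<bar>case_prod f p\<bar>}"
  have Q: "Q \<in> sets (A \<Otimes>\<^sub>M R)" unfolding Q_def by measurable
  have sec: "Pair x -` Q = {\<eta> \<in> space R. y < ennreal \<bar>f x \<eta>\<bar>}" if "x \<in> space A" for x
    using that by (auto simp: Q_def space_pair_measure)
  have "y < ess_norm R (f x) \<longleftrightarrow> emeasure R (Pair x -` Q) > 0" if x: "x \<in> space A" for x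
  proof
    assume "y < ess_norm R (f x)"
    then show "emeasure R (Pair x -` Q) > 0"
      unfolding sec[OF x] ess_norm_def using fx[OF x] by (intro esssup_pos_measure) auto
  next
    assume pos: "emeasure R (Pair x -` Q) > 0"
    show "y < ess_norm R (f x)"
    proof (rule ccontr)
      assume "\<not> y < ess_norm R (f x)"
      then have "AE \<eta> in R. \<not> y < ennreal \<bar>f x \<eta>\<bar>"
        using ess_norm_AE[of "f x" R] by (auto simp: not_less elim: eventually_mono)
      then have "emeasure R {\<eta> \<in> space R. y < ennreal \<bar>f x \<eta>\<bar>} = 0"
        using fx[OF x] by (subst (asm) AE_iff_measurable[OF _ refl]) auto
      with pos show False by (simp add: sec[OF x])
    qed
  qed
  then have "{x \<in> space A. y < ess_norm R (f x)} = {x \<in> space A. emeasure R (Pair x -` Q) > 0}" by auto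
  also have "\<dots> \<in> sets A" using measurable_emeasure_Pair[OF Q] by measurable
  finally show "{x \<in> space A. y < ess_norm R (f x)} \<in> sets A" .
qed

text \<open>For each \<open>z\<close> the norm bounds |f| outside a null set of \<eta> that depends
  on \<open>z\<close>. Fubini turns this into a bound for almost every \<open>z\<close>, valid
  outside one null set of \<eta>, and then \<open>z\<close> can be integrated out.\<close>

lemma ess_norm_Jensen:
  assumes R: "sigma_finite_measure R" and S: "prob_space S"
    and f: "(\<lambda>(\<eta>, z). f \<eta> z) \<in> borel_measurable (R \<Otimes>\<^sub>M S)"
    and B: "\<And>\<eta> z. \<bar>f \<eta> z\<bar> \<le> B"
  shows "ess_norm R (\<lambda>\<eta>. \<integral>z. f \<eta> z \<partial>S) \<le> (\<integral>\<^sup>+z. ess_norm R (\<lambda>\<eta>. f \<eta> z) \<partial>S)"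
proof -
  interpret R: sigma_finite_measure R by fact
  interpret S: prob_space S by fact
  interpret pair_sigma_finite R S ..
  note [measurable] = f
  have em[measurable]: "(\<lambda>z. ess_norm R (\<lambda>\<eta>. f \<eta> z)) \<in> borel_measurable S"
    by (rule ess_norm_measurable[OF R]) measurable
  show ?thesis
  proof (rule ess_norm_le)
    have "AE z in S. AE \<eta> in R. ennreal \<bar>f \<eta> z\<bar> \<le> ess_norm R (\<lambda>\<eta>. f \<eta> z)"
      by (intro AE_I2 ess_norm_AE)
    then have "AE \<eta> in R. AE z in S. ennreal \<bar>f \<eta> z\<bar> \<le> ess_norm R (\<lambda>\<eta>. f \<eta> z)"
      by (subst AE_commute) measurable
    then show "AE \<eta> in R. ennreal \<bar>\<integral>z. f \<eta> z \<partial>S\<bar> \<le> (\<integral>\<^sup>+z. ess_norm R (\<lambda>\<eta>. f \<eta> z) \<partial>S)"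
    proof (rule AE_mp, intro AE_I2 impI)
      fix \<eta> assume \<eta>[measurable]: "\<eta> \<in> space R" and *: "AE z in S. ennreal \<bar>f \<eta> z\<bar> \<le> ess_norm R (\<lambda>\<eta>. f \<eta> z)"
      have [measurable]: "f \<eta> \<in> borel_measurable S" using measurable_compose[OF measurable_Pair1'[OF \<eta>] f] by simp
      have "integrable S (f \<eta>)" by (rule S.integrable_const_bound[where B=B]) (auto simp: B)
      then have "ennreal \<bar>\<integral>z. f \<eta> z \<partial>S\<bar> \<le> (\<integral>\<^sup>+z. ennreal \<bar>f \<eta> z\<bar> \<partial>S)"
        using integral_norm_bound_ennreal[of S "f \<eta>"] by simp
      also have "\<dots> \<le> (\<integral>\<^sup>+z. ess_norm R (\<lambda>\<eta>. f \<eta> z) \<partial>S)" using * by (rule nn_integral_mono_AE)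
      finally show "ennreal \<bar>\<integral>z. f \<eta> z \<partial>S\<bar> \<le> (\<integral>\<^sup>+z. ess_norm R (\<lambda>\<eta>. f \<eta> z) \<partial>S)" .
    qed
  qed measurable
qed

section \<open>Variance and mean of functions with bounded differences\<close>

text \<open>An Efron-Stein type bound by induction on the coordinates: averaging over the last one
  preserves the bounded differences, and the second moment lost by averaging is at most c^2.\<close>

lemma bounded_differences_variance:
  fixes f :: "(nat \<Rightarrow> 'z) \<Rightarrow> real"
  assumes S: "prob_space S" and "f \<in> borel_measurable (\<Pi>\<^sub>M i\<in>{..<n}. S)"
    and "\<And>x. x \<in> space (\<Pi>\<^sub>M i\<in>{..<n}. S) \<Longrightarrow> \<bar>f x\<bar> \<le> B"
    and "\<And>x i y. x \<in> space (\<Pi>\<^sub>M i\<in>{..<n}. S) \<Longrightarrow> i < n \<Longrightarrow> y \<in> space S \<Longrightarrow> \<bar>f (x(i := y)) - f x\<bar> \<le> c"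
  shows "(\<integral>x. (f x)\<^sup>2 \<partial>(\<Pi>\<^sub>M i\<in>{..<n}. S)) - (\<integral>x. f x \<partial>(\<Pi>\<^sub>M i\<in>{..<n}. S))\<^sup>2 \<le> n * c\<^sup>2"
  using assms(2-)
proof (induction n arbitrary: f)
  case 0
  then show ?case by (simp add: PiM_empty lebesgue_integral_count_space_finite)
next
  case (Suc n)
  interpret S: prob_space S by fact
  interpret product_prob_space "\<lambda>_. S" "{..<n}" by (intro product_prob_spaceI S)
  let ?P = "\<Pi>\<^sub>M i\<in>{..<n}. S" and ?P' = "\<Pi>\<^sub>M i\<in>{..<Suc n}. S"
  interpret P: prob_space ?P by (intro prob_space_PiM S)
  interpret P': prob_space ?P' by (intro prob_space_PiM S)
  note fm[measurable] = Suc.prems(1) and fB = Suc.prems(2) and fc = Suc.prems(3)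
  have up[measurable]: "(\<lambda>p. (fst p)(n := snd p)) \<in> measurable (?P \<Otimes>\<^sub>M S) ?P'"
    using measurable_add_dim[of n "{..<n}" "\<lambda>_. S"] by (simp add: split_beta' lessThan_Suc)
  have sp: "x(n := y) \<in> space ?P'" if "x \<in> space ?P" "y \<in> space S" for x y
    using that by (auto simp: space_PiM PiE_iff extensional_def)
  have fm2: "(\<lambda>p. f ((fst p)(n := snd p))) \<in> borel_measurable (?P \<Otimes>\<^sub>M S)" by measurable
  note [measurable] = fm2
  have fx[measurable]: "(\<lambda>y. f (x(n := y))) \<in> borel_measurable S" if "x \<in> space ?P" for x
    using measurable_compose[OF measurable_Pair1'[OF that] fm2] by simp
  define h where "h x = (\<integral>y. f (x(n := y)) \<partial>S)" for x
  have hm[measurable]: "h \<in> borel_measurable ?P" unfolding h_def by measurable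
  have fi: "integrable S (\<lambda>y. f (x(n := y)))" if "x \<in> space ?P" for x
    using fB sp[OF that] by (intro S.integrable_const_bound[where B=B] fx[OF that]) auto
  have hB: "\<bar>h x\<bar> \<le> B" if "x \<in> space ?P" for x
  proof -
    have "\<bar>h x\<bar> \<le> (\<integral>y. \<bar>f (x(n := y))\<bar> \<partial>S)" unfolding h_def by (rule integral_abs_bound)
    also have "\<dots> \<le> B" using fi[OF that] fB sp[OF that] by (intro S.integral_le_const) auto
    finally show ?thesis .
  qed
  have hc: "\<bar>h (x(i := y)) - h x\<bar> \<le> c" if x: "x \<in> space ?P" and i: "i < n" and y: "y \<in> space S" for x i y
  proof -
    have x': "x(i := y) \<in> space ?P" using x i y by (auto simp: space_PiM PiE_iff extensional_def)
    have "\<bar>h (x(i := y)) - h x\<bar> = \<bar>\<integral>w. f (x(i := y, n := w)) - f (x(n := w)) \<partial>S\<bar>"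
      unfolding h_def using fi[OF x] fi[OF x'] by simp
    also have "\<dots> \<le> (\<integral>w. \<bar>f (x(i := y, n := w)) - f (x(n := w))\<bar> \<partial>S)" by (rule integral_abs_bound)
    also have "\<dots> \<le> c"
    proof (rule S.integral_le_const)
      show "AE w in S. \<bar>f (x(i := y, n := w)) - f (x(n := w))\<bar> \<le> c"
      proof (rule AE_I2)
        fix w assume w: "w \<in> space S"
        have "x(i := y, n := w) = x(n := w, i := y)" using i by (auto simp: fun_eq_iff)
        then show "\<bar>f (x(i := y, n := w)) - f (x(n := w))\<bar> \<le> c"
          using fc[OF sp[OF x w], of i y] i y by (simp del: fun_upd_apply)
      qed
    qed (use fi[OF x] fi[OF x'] in auto)
    finally show ?thesis .
  qed
  have IH: "(\<integral>x. (h x)\<^sup>2 \<partial>?P) - (\<integral>x. h x \<partial>?P)\<^sup>2 \<le> n * c\<^sup>2"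
    by (rule Suc.IH[OF hm hB hc])
  have fI: "integrable ?P' f" using fB by (intro P'.integrable_const_bound[where B=B]) auto
  have sq: "a\<^sup>2 \<le> B\<^sup>2" if "\<bar>a\<bar> \<le> B" for a :: real using that abs_le_square_iff[of a B] by linarith
  have f2I: "integrable ?P' (\<lambda>x. (f x)\<^sup>2)" using fB sq by (intro P'.integrable_const_bound[where B="B\<^sup>2"]) auto
  have h2I: "integrable ?P (\<lambda>x. (h x)\<^sup>2)" using hB sq by (intro P.integrable_const_bound[where B="B\<^sup>2"]) auto
  have ins: "insert n {..<n} = {..<Suc n}" by (simp add: lessThan_Suc)
  have e1: "(\<integral>x. f x \<partial>?P') = (\<integral>x. h x \<partial>?P)"
    using product_integral_insert[of "{..<n}" n f] fI unfolding ins h_def by simp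
  have e2: "(\<integral>x. (f x)\<^sup>2 \<partial>?P') = (\<integral>x. (\<integral>y. (f (x(n := y)))\<^sup>2 \<partial>S) \<partial>?P)"
    using product_integral_insert[of "{..<n}" n "\<lambda>x. (f x)\<^sup>2"] f2I unfolding ins by simp
  have inner: "(\<integral>y. (f (x(n := y)))\<^sup>2 \<partial>S) \<le> (h x)\<^sup>2 + c\<^sup>2" if x: "x \<in> space ?P" for x
  proof -
    let ?f = "\<lambda>y. f (x(n := y))"
    have f2i: "integrable S (\<lambda>y. (?f y)\<^sup>2)"
      using fB sp[OF x] sq by (intro S.integrable_const_bound[where B="B\<^sup>2"]) (auto intro!: borel_measurable_power fx[OF x])
    \<comment> \<open>The distance to the mean over the last coordinate is an average of
      differences, each at most \<open>c\<close>.\<close>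
    have dev: "(?f y - h x)\<^sup>2 \<le> c\<^sup>2" if y: "y \<in> space S" for y
    proof -
      have "\<bar>?f y - h x\<bar> = \<bar>\<integral>w. ?f y - ?f w \<partial>S\<bar>" using fi[OF x] by (simp add: h_def S.prob_space)
      also have "\<dots> \<le> (\<integral>w. \<bar>?f y - ?f w\<bar> \<partial>S)" by (rule integral_abs_bound)
      also have "\<dots> \<le> c"
      proof (rule S.integral_le_const)
        show "AE w in S. \<bar>?f y - ?f w\<bar> \<le> c"
        proof (rule AE_I2)
          fix w assume w: "w \<in> space S"
          show "\<bar>?f y - ?f w\<bar> \<le> c" using fc[OF sp[OF x w], of n y] y by (simp del: fun_upd_apply)
        qed
      qed (use fi[OF x] in auto)
      finally have "\<bar>?f y - h x\<bar> \<le> c" .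
      then have "\<bar>?f y - h x\<bar> \<le> \<bar>c\<bar>" by linarith
      then show ?thesis by (simp add: abs_le_square_iff)
    qed
    have "(\<integral>y. (?f y)\<^sup>2 \<partial>S) - (h x)\<^sup>2 = (\<integral>y. (?f y)\<^sup>2 - 2 * h x * ?f y + (h x)\<^sup>2 \<partial>S)"
      using fi[OF x] f2i by (simp add: S.prob_space h_def[symmetric] power2_eq_square)
    also have "\<dots> = (\<integral>y. (?f y - h x)\<^sup>2 \<partial>S)"
      by (intro Bochner_Integration.integral_cong) (auto simp: power2_eq_square algebra_simps)
    also have "\<dots> \<le> c\<^sup>2"
    proof (rule S.integral_le_const)
      have "integrable S (\<lambda>y. (?f y)\<^sup>2 - 2 * h x * ?f y + (h x)\<^sup>2)" using fi[OF x] f2i by auto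
      then show "integrable S (\<lambda>y. (?f y - h x)\<^sup>2)"
        by (rule Bochner_Integration.integrable_cong[THEN iffD1, rotated -1]) (auto simp: power2_eq_square algebra_simps)
    qed (use dev in auto)
    finally show ?thesis by simp
  qed
  have "(\<integral>x. (f x)\<^sup>2 \<partial>?P') \<le> (\<integral>x. (h x)\<^sup>2 + c\<^sup>2 \<partial>?P)"
    unfolding e2
  proof (rule integral_mono)
    show "integrable ?P (\<lambda>x. \<integral>y. (f (x(n := y)))\<^sup>2 \<partial>S)"
    proof (rule P.integrable_const_bound[where B="B\<^sup>2 + c\<^sup>2"])
      show "AE x in ?P. norm (\<integral>y. (f (x(n := y)))\<^sup>2 \<partial>S) \<le> B\<^sup>2 + c\<^sup>2"
        using inner sq[OF hB] by (intro AE_I2) (fastforce intro: order.trans)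
    qed measurable
  qed (use h2I inner in auto)
  also have "\<dots> = (\<integral>x. (h x)\<^sup>2 \<partial>?P) + c\<^sup>2" using h2I by (simp add: P.prob_space)
  finally show ?case using IH unfolding e1 by (simp add: algebra_simps)
qed

text \<open>Smallness in probability controls a mean only under uniform integrability, which the
  variance bound supplies. In the application \<open>B\<close> grows with the sample size, so it
  must not enter the conclusion.\<close>

lemma expectation_small:
  assumes "prob_space P" and f: "f \<in> borel_measurable P" "\<And>x. x \<in> space P \<Longrightarrow> 0 \<le> f x \<and> f x \<le> (B::real)"
    and var: "(\<integral>x. (f x)\<^sup>2 \<partial>P) - (\<integral>x. f x \<partial>P)\<^sup>2 \<le> 4"
    and e: "0 < e" "e \<le> 1 / 2" and p: "measure P {x \<in> space P. e < f x} \<le> e\<^sup>2"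
  shows "(\<integral>x. f x \<partial>P) \<le> 7 * e"
proof -
  interpret prob_space P by fact
  note [measurable] = f(1)
  define m where "m = (\<integral>x. f x \<partial>P)"
  define U where "U = {x \<in> space P. e < f x}"
  have U[measurable]: "U \<in> sets P" unfolding U_def by measurable
  have fi: "integrable P f" using f(2) by (intro integrable_const_bound[where B=B]) fastforce+
  have "(f x)\<^sup>2 \<le> B\<^sup>2" if "x \<in> space P" for x using f(2)[OF that] by (intro power_mono) auto
  then have f2i: "integrable P (\<lambda>x. (f x)\<^sup>2)" by (intro integrable_const_bound[where B="B\<^sup>2"]) auto
  have ex: "(\<lambda>x. (f x - m)\<^sup>2) = (\<lambda>x. (f x)\<^sup>2 - 2 * m * f x + m\<^sup>2)"
    by (auto simp: power2_eq_square algebra_simps)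
  have vi: "integrable P (\<lambda>x. (f x - m)\<^sup>2)" unfolding ex using fi f2i by auto
  have v: "(\<integral>x. (f x - m)\<^sup>2 \<partial>P) \<le> 4"
    using var fi f2i unfolding ex by (simp add: m_def[symmetric] prob_space power2_eq_square)
  have m0: "m \<ge> 0" unfolding m_def using f(2) by (intro integral_nonneg_AE) auto
  \<comment> \<open>On \<open>U\<close>, Young's inequality with weight \<open>e\<close> bounds
    \<open>f x - m\<close>: the square has integral at most 4, and the large constant
    \<open>1 / (2 * e)\<close> is paid only with probability at most e^2.\<close>
  have pt: "f x \<le> e + (m * indicator U x + (e / 2 * (f x - m)\<^sup>2 + 1 / (2 * e) * indicator U x))" if x: "x \<in> space P" for x
  proof (cases "x \<in> U")
    case True
    have "0 \<le> (e * (f x - m) - 1)\<^sup>2 / (2 * e)" using e by simp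
    also have "\<dots> = e / 2 * (f x - m)\<^sup>2 + 1 / (2 * e) - (f x - m)"
      using e by (simp add: power2_eq_square field_simps)
    finally show ?thesis using True e by simp
  next
    case False
    then have "f x \<le> e" using x by (auto simp: U_def)
    moreover have "0 \<le> e / 2 * (f x - m)\<^sup>2" using e by simp
    ultimately show ?thesis using False by simp
  qed
  have Ui: "integrable P (\<lambda>x. indicator U x :: real)" by (intro integrable_const_bound[where B=1]) auto
  have "m \<le> (\<integral>x. e + (m * indicator U x + (e / 2 * (f x - m)\<^sup>2 + 1 / (2 * e) * indicator U x)) \<partial>P)"
    unfolding m_def[symmetric] unfolding m_def
    by (rule integral_mono) (use fi vi Ui pt in \<open>auto simp: m_def[symmetric]\<close>)
  also have "\<dots> = e + (m * measure P U + (e / 2 * (\<integral>x. (f x - m)\<^sup>2 \<partial>P) + 1 / (2 * e) * measure P U))"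
    using vi Ui by (simp add: prob_space)
  also have "\<dots> \<le> e + (m * (1 / 2) + (e / 2 * 4 + 1 / (2 * e) * e\<^sup>2))"
  proof -
    \<comment> \<open>The assumption \<open>e \<le> 1 / 2\<close> brings the probability of
      \<open>U\<close> below 1/2, so that half of \<open>m\<close> can be absorbed on the
      left.\<close>
    have "e * e \<le> (1/2) * 1" using e by (intro mult_mono) auto
    then have "measure P U \<le> 1 / 2" using p by (simp add: U_def power2_eq_square)
    then show ?thesis using m0 e v p by (intro add_mono mult_left_mono order.refl) (auto simp: U_def)
  qed
  \<comment> \<open>7 / 2 = 1 + 2 + 1 / 2, and solving for \<open>m\<close> doubles it.\<close>
  also have "\<dots> = m / 2 + 7 / 2 * e" using e by (simp add: power2_eq_square field_simps)
  finally show ?thesis by (simp add: m_def)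
qed

section \<open>Averages over Rademacher signs\<close>

text \<open>A sign vector is encoded by the set of its positive positions: Rademacher averages
  become finite sums over \<open>Pow {..<n}\<close> divided by \<open>2 ^ n\<close>, without an
  auxiliary probability space.\<close>

definition sg :: "nat set \<Rightarrow> nat \<Rightarrow> real" where
  "sg A i = (if i \<in> A then 1 else -1)"

lemma sum_Pow_Suc:
  "(\<Sum>A\<in>Pow {..<Suc n}. F A) = (\<Sum>A\<in>Pow {..<n}. F A + F (insert n A))"
proof -
  have "(\<Sum>A\<in>Pow {..<Suc n}. F A) = (\<Sum>A\<in>Pow {..<n} \<union> insert n ` Pow {..<n}. F A)"
    by (simp add: lessThan_Suc Pow_insert)
  also have "\<dots> = (\<Sum>A\<in>Pow {..<n}. F A) + (\<Sum>A\<in>insert n ` Pow {..<n}. F A)"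
    by (intro sum.union_disjoint) auto
  also have "(\<Sum>A\<in>insert n ` Pow {..<n}. F A) = (\<Sum>A\<in>Pow {..<n}. F (insert n A))"
  proof (subst sum.reindex)
    show "inj_on (insert n) (Pow {..<n})"
      by (rule inj_onI) (metis Diff_insert_absorb PowD lessThan_iff less_irrefl subsetD)
  qed simp
  finally show ?thesis by (simp add: sum.distrib)
qed

lemma sg_Suc:
  assumes "A \<in> Pow {..<n}"
  shows "(\<Sum>i<Suc n. sg A i * a i) = (\<Sum>i<n. sg A i * a i) - a n"
    "(\<Sum>i<Suc n. sg (insert n A) i * a i) = (\<Sum>i<n. sg A i * a i) + a n"
    "(\<Prod>i<Suc n. 1 + sg A i * a i) = (\<Prod>i<n. 1 + sg A i * a i) * (1 - a n)"
    "(\<Prod>i<Suc n. 1 + sg (insert n A) i * a i) = (\<Prod>i<n. 1 + sg A i * a i) * (1 + a n)"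
  using assms by (auto simp: sg_def intro!: sum.cong prod.cong)

text \<open>The offset \<open>c\<close> serves the induction, in which the last sign shifts it by 1.
  At \<open>c = 0\<close> this is the variance of a sum of \<open>n\<close> independent
  signs.\<close>

lemma sum_sg_square: "(\<Sum>A\<in>Pow {..<n}. (c + (\<Sum>i<n. sg A i))\<^sup>2) = 2 ^ n * (c\<^sup>2 + n)"
proof (induction n arbitrary: c)
  case (Suc n)
  have "(\<Sum>A\<in>Pow {..<Suc n}. (c + (\<Sum>i<Suc n. sg A i))\<^sup>2)
     = (\<Sum>A\<in>Pow {..<n}. (c - 1 + (\<Sum>i<n. sg A i))\<^sup>2 + (c + 1 + (\<Sum>i<n. sg A i))\<^sup>2)"
    unfolding sum_Pow_Suc
    by (intro sum.cong refl, simp only: sg_Suc(1,2)[where a="\<lambda>_. 1", unfolded mult_1_right]) (simp add: algebra_simps)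
  then show ?case by (simp only: sum.distrib Suc.IH) (simp add: power2_eq_square algebra_simps)
qed simp

text \<open>Cauchy-Schwarz, in the form 2 |S| sqrt n \<le> S^2 + n, reduces the first absolute
  moment to the second moment.\<close>

lemma sum_sg_abs: "(\<Sum>A\<in>Pow {..<n}. \<bar>\<Sum>i<n. sg A i\<bar>) \<le> 2 ^ n * sqrt n"
proof (cases "n = 0")
  case False
  have "(\<Sum>A\<in>Pow {..<n}. \<bar>\<Sum>i<n. sg A i\<bar>) \<le> (\<Sum>A\<in>Pow {..<n}. ((0 + (\<Sum>i<n. sg A i))\<^sup>2 / sqrt n + sqrt n) / 2)"
  proof (rule sum_mono)
    fix A
    have "2 * \<bar>\<Sum>i<n. sg A i\<bar> * sqrt n \<le> \<bar>\<Sum>i<n. sg A i\<bar>\<^sup>2 + (sqrt n)\<^sup>2"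
      by (rule sum_squares_bound)
    then show "\<bar>\<Sum>i<n. sg A i\<bar> \<le> ((0 + (\<Sum>i<n. sg A i))\<^sup>2 / sqrt n + sqrt n) / 2"
      using False by (simp add: field_simps)
  qed
  also have "\<dots> = (2 ^ n * n / sqrt n + 2 ^ n * sqrt n) / 2"
    using sum_sg_square[of 0 n] by (simp add: sum_divide_distrib[symmetric] sum.distrib card_Pow)
  also have "\<dots> = 2 ^ n * sqrt n" using False by (simp add: field_simps)
  finally show ?thesis .
qed simp

lemma sum_sg_cos: "(\<Sum>A\<in>Pow {..<n}. cos (c + (\<Sum>i<n. sg A i * a i))) = 2 ^ n * cos c * (\<Prod>i<n. cos (a i))"
proof (induction n arbitrary: c)
  case (Suc n)
  have "(\<Sum>A\<in>Pow {..<Suc n}. cos (c + (\<Sum>i<Suc n. sg A i * a i)))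
     = (\<Sum>A\<in>Pow {..<n}. cos (c - a n + (\<Sum>i<n. sg A i * a i)) + cos (c + a n + (\<Sum>i<n. sg A i * a i)))"
    unfolding sum_Pow_Suc by (intro sum.cong refl, simp only: sg_Suc(1,2)) (simp add: algebra_simps)
  then show ?case by (simp only: sum.distrib Suc.IH) (simp add: cos_add cos_diff algebra_simps)
qed simp

text \<open>Under the weights (1 + s y) / 2 the signs are independent with means \<open>y i\<close>,
  so their linear combination has the mean on the right; the factor \<open>2 ^ n\<close> collects
  the halves.\<close>

lemma sum_sg_weighted:
  "(\<Sum>A\<in>Pow {..<n}. (\<Prod>i<n. 1 + sg A i * y i) * (c + (\<Sum>i<n. sg A i * a i))) = 2 ^ n * (c + (\<Sum>i<n. y i * a i))"
proof (induction n arbitrary: c)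
  case (Suc n)
  have "(\<Sum>A\<in>Pow {..<Suc n}. (\<Prod>i<Suc n. 1 + sg A i * y i) * (c + (\<Sum>i<Suc n. sg A i * a i)))
     = (\<Sum>A\<in>Pow {..<n}. (1 - y n) * ((\<Prod>i<n. 1 + sg A i * y i) * (c - a n + (\<Sum>i<n. sg A i * a i)))
        + (1 + y n) * ((\<Prod>i<n. 1 + sg A i * y i) * (c + a n + (\<Sum>i<n. sg A i * a i))))"
    unfolding sum_Pow_Suc by (intro sum.cong refl, simp only: sg_Suc) (simp add: algebra_simps)
  then show ?case by (simp only: sum.distrib sum_distrib_left[symmetric] Suc.IH) (simp add: algebra_simps)
qed simp

lemma one_minus_cos_le: "1 - cos x \<le> \<bar>x\<bar>" for x :: real
proof -
  have "1 - cos x = 2 * (sin (x / 2))\<^sup>2" using cos_double_sin[of "x / 2"] by simp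
  also have "\<dots> \<le> 2 * \<bar>sin (x / 2)\<bar>"
    using mult_right_mono[of "\<bar>sin (x / 2)\<bar>" 1 "\<bar>sin (x / 2)\<bar>"] by (simp add: power2_eq_square abs_mult[symmetric])
  also have "\<dots> \<le> \<bar>x\<bar>" using abs_sin_x_le_abs_x[of "x / 2"] by simp
  finally show ?thesis .
qed

lemma cos_le_exp:
  fixes x :: real
  assumes "\<bar>x\<bar> \<le> 1"
  shows "cos x \<le> exp (- (x\<^sup>2 / 4))" "0 \<le> cos x"
proof -
  obtain t where t: "cos x = (\<Sum>m<4. cos_coeff m * x ^ m) + cos (t + 1/2 * real 4 * pi) / fact 4 * x ^ 4"
    using Maclaurin_cos_expansion[of x 4] by blast
  have "(\<Sum>m<4. cos_coeff m * x ^ m) = 1 - x\<^sup>2 / 2"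
    by (simp add: eval_nat_numeral cos_coeff_def) (simp flip: numeral_2_eq_2 numeral_3_eq_3)
  moreover have "cos (t + 1/2 * real 4 * pi) / fact 4 * x ^ 4 \<le> 1 / fact 4 * x ^ 4"
    by (intro mult_right_mono divide_right_mono) auto
  moreover have "x ^ 4 \<le> x\<^sup>2"
    using assms power_decreasing[of 2 4 "\<bar>x\<bar>"] by (simp add: power_even_abs)
  moreover have f4: "(fact 4 :: real) = 24" by (simp add: fact_numeral)
  ultimately have "cos x \<le> 1 - x\<^sup>2 / 4" using t zero_le_power2[of x] unfolding f4 by linarith
  also have "\<dots> \<le> exp (- (x\<^sup>2 / 4))" using exp_ge_add_one_self[of "- (x\<^sup>2 / 4)"] by simp
  finally show "cos x \<le> exp (- (x\<^sup>2 / 4))" .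
  show "0 \<le> cos x" using assms pi_gt3 by (intro cos_ge_zero) auto
qed

text \<open>A lower Khintchine type bound: \<open>\<bar>x\<bar> \<ge> 1 - cos x\<close> and the mean of \<open>cos\<close> factorises over the signs.\<close>

lemma sum_squares_le_sg:
  assumes g: "\<And>i. i < n \<Longrightarrow> \<bar>g i\<bar> \<le> 1" and n: "n \<ge> 1"
  shows "(\<Sum>i<n. (g i)\<^sup>2) / n \<le> (\<Sum>A\<in>Pow {..<n}. 8 / (sqrt n * 2 ^ n) * \<bar>\<Sum>i<n. sg A i * g i\<bar>)"
proof -
  define a where "a i = g i / sqrt n" for i
  define u where "u = (\<Sum>i<n. (a i)\<^sup>2 / 4)"
  have a: "\<bar>a i\<bar> \<le> 1" if "i < n" for i
  proof -
    have "\<bar>g i\<bar> / sqrt n \<le> 1 / 1" using g[OF that] n by (intro frac_le) auto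
    then show ?thesis by (simp add: a_def)
  qed
  have ua: "u = (\<Sum>i<n. (g i)\<^sup>2) / n / 4"
    by (simp add: u_def a_def power_divide sum_divide_distrib[symmetric])
  have u0: "0 \<le> u" unfolding u_def by (intro sum_nonneg) auto
  have "(\<Sum>i<n. (g i)\<^sup>2) \<le> (\<Sum>i<n. 1)" using g by (intro sum_mono) (auto simp: abs_square_le_1)
  then have u1: "u \<le> 1" using n by (simp add: ua field_simps)
  have "(\<Prod>i<n. cos (a i)) \<le> (\<Prod>i<n. exp (- ((a i)\<^sup>2 / 4)))"
    using a cos_le_exp by (intro prod_mono) auto
  also have "\<dots> = exp (- u)" by (simp add: u_def exp_sum[symmetric] sum_negf)
  \<comment> \<open>Valid on [0, 1], which is why \<open>u \<le> 1\<close> was secured from |g i|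
    \<le> 1.\<close>
  also have "\<dots> \<le> 1 - u / 2"
  proof -
    have "exp (- u) = inverse (exp u)" by (rule exp_minus)
    also have "\<dots> \<le> inverse (1 + u)" using exp_ge_add_one_self[of u] u0 by (intro le_imp_inverse_le) auto
    also have "\<dots> \<le> 1 - u / 2"
    proof -
      have "u * u \<le> u * 1" using u0 u1 by (intro mult_left_mono) auto
      then have "1 \<le> (1 - u / 2) * (1 + u)" by (simp add: algebra_simps)
      then show ?thesis using u0 by (simp add: field_simps)
    qed
    finally show ?thesis .
  qed
  finally have c: "(\<Prod>i<n. cos (a i)) \<le> 1 - u / 2" .
  have "u / 2 \<le> 1 - (\<Prod>i<n. cos (a i))" using c by linarith
  also have "\<dots> = (\<Sum>A\<in>Pow {..<n}. (1 - cos (0 + (\<Sum>i<n. sg A i * a i))) / 2 ^ n)"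
    unfolding sum_divide_distrib[symmetric] sum_subtractf sum_sg_cos by (simp add: card_Pow field_simps)
  also have "\<dots> \<le> (\<Sum>A\<in>Pow {..<n}. \<bar>\<Sum>i<n. sg A i * a i\<bar> / 2 ^ n)"
    using one_minus_cos_le by (intro sum_mono divide_right_mono) auto
  also have "\<dots> = (\<Sum>A\<in>Pow {..<n}. 1 / (sqrt n * 2 ^ n) * \<bar>\<Sum>i<n. sg A i * g i\<bar>)"
    by (intro sum.cong refl) (simp add: a_def sum_divide_distrib[symmetric])
  finally have *: "u / 2 \<le> (\<Sum>A\<in>Pow {..<n}. 1 / (sqrt n * 2 ^ n) * \<bar>\<Sum>i<n. sg A i * g i\<bar>)" .
  \<comment> \<open>8 = 4 * 2: the 4 undoes the quarter in \<open>u\<close>, the 2 the half lost in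
    the exponential bound.\<close>
  have "(\<Sum>i<n. (g i)\<^sup>2) / n = 8 * (u / 2)" by (simp add: ua)
  also have "\<dots> \<le> 8 * (\<Sum>A\<in>Pow {..<n}. 1 / (sqrt n * 2 ^ n) * \<bar>\<Sum>i<n. sg A i * g i\<bar>)" using * by simp
  also have "\<dots> = (\<Sum>A\<in>Pow {..<n}. 8 / (sqrt n * 2 ^ n) * \<bar>\<Sum>i<n. sg A i * g i\<bar>)"
    unfolding sum_distrib_left by (intro sum.cong refl) simp
  finally show ?thesis .
qed

section \<open>Symmetrisation for a bounded class\<close>

text \<open>By \<open>eq\<close>, each weight has conditional mean 1 given \<open>zz\<close>.
  Tilting the coordinates by such weights leaves the law of their images under \<open>zz\<close>
  unchanged, and over independent coordinates the tilts multiply.\<close>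

lemma weighted_product_integral:
  assumes P: "prob_space P" and S: "prob_space S" and zz[measurable]: "zz \<in> measurable P S"
    and W[measurable]: "\<And>i. W i \<in> borel_measurable P"
    and eq: "\<And>i A. i \<in> I \<Longrightarrow> A \<in> sets S \<Longrightarrow> (\<integral>\<^sup>+x. W i x * indicator A (zz x) \<partial>P) = emeasure S A"
    and fin: "finite I" and \<phi>[measurable]: "\<phi> \<in> borel_measurable (\<Pi>\<^sub>M i\<in>I. S)"
  shows "(\<integral>\<^sup>+x. (\<Prod>i\<in>I. W i (x i)) * \<phi> (\<lambda>i\<in>I. zz (x i)) \<partial>(\<Pi>\<^sub>M i\<in>I. P)) = (\<integral>\<^sup>+z. \<phi> z \<partial>(\<Pi>\<^sub>M i\<in>I. S))"
proof -
  interpret P: product_prob_space "\<lambda>_. P" I by (intro product_prob_spaceI P)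
  interpret S: product_prob_space "\<lambda>_. S" I by (intro product_prob_spaceI S)
  let ?P = "\<Pi>\<^sub>M i\<in>I. P" and ?S = "\<Pi>\<^sub>M i\<in>I. S"
  have [measurable]: "(\<lambda>x. \<lambda>i\<in>I. zz (x i)) \<in> measurable ?P ?S" by measurable
  have [measurable]: "(\<lambda>x. \<Prod>i\<in>I. W i (x i)) \<in> borel_measurable ?P" by measurable
  have eq2: "distr (density ?P (\<lambda>x. \<Prod>i\<in>I. W i (x i))) ?S (\<lambda>x. \<lambda>i\<in>I. zz (x i)) = ?S"
  proof (rule S.PiM_eqI)
    fix A assume A: "\<And>i. i \<in> I \<Longrightarrow> A i \<in> sets S"
    have pre: "(\<lambda>x. \<lambda>i\<in>I. zz (x i)) -` Pi\<^sub>E I A \<inter> space ?P \<in> sets ?P"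
      using A fin by (intro measurable_sets[of _ _ ?S] sets_PiM_I_finite) auto
    have "emeasure (distr (density ?P (\<lambda>x. \<Prod>i\<in>I. W i (x i))) ?S (\<lambda>x. \<lambda>i\<in>I. zz (x i))) (Pi\<^sub>E I A)
      = (\<integral>\<^sup>+x. (\<Prod>i\<in>I. W i (x i)) * indicator ((\<lambda>x. \<lambda>i\<in>I. zz (x i)) -` Pi\<^sub>E I A \<inter> space ?P) x \<partial>?P)"
      using A fin pre by (subst emeasure_distr) (auto simp: emeasure_density intro!: sets_PiM_I_finite)
    also have "\<dots> = (\<integral>\<^sup>+x. (\<Prod>i\<in>I. W i (x i) * indicator (A i) (zz (x i))) \<partial>?P)"
    proof (intro nn_integral_cong)
      fix x assume x: "x \<in> space ?P"
      have "indicator ((\<lambda>x. \<lambda>i\<in>I. zz (x i)) -` Pi\<^sub>E I A \<inter> space ?P) x = (\<Prod>i\<in>I. indicator (A i) (zz (x i)) :: ennreal)"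
        using x fin by (auto simp: indicator_def PiE_iff)
      then show "(\<Prod>i\<in>I. W i (x i)) * indicator ((\<lambda>x. \<lambda>i\<in>I. zz (x i)) -` Pi\<^sub>E I A \<inter> space ?P) x = (\<Prod>i\<in>I. W i (x i) * indicator (A i) (zz (x i)))"
        by (simp add: prod.distrib)
    qed
    also have "\<dots> = (\<Prod>i\<in>I. \<integral>\<^sup>+x. W i x * indicator (A i) (zz x) \<partial>P)"
      using fin A by (intro P.product_nn_integral_prod) auto
    also have "\<dots> = (\<Prod>i\<in>I. emeasure S (A i))" using eq A by (intro prod.cong) auto
    finally show "emeasure (distr (density ?P (\<lambda>x. \<Prod>i\<in>I. W i (x i))) ?S (\<lambda>x. \<lambda>i\<in>I. zz (x i))) (Pi\<^sub>E I A) = (\<Prod>i\<in>I. emeasure S (A i))" .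
  qed (use fin in auto)
  have "(\<integral>\<^sup>+z. \<phi> z \<partial>?S) = (\<integral>\<^sup>+z. \<phi> z \<partial>distr (density ?P (\<lambda>x. \<Prod>i\<in>I. W i (x i))) ?S (\<lambda>x. \<lambda>i\<in>I. zz (x i)))"
    by (simp add: eq2)
  also have "\<dots> = (\<integral>\<^sup>+x. (\<Prod>i\<in>I. W i (x i)) * \<phi> (\<lambda>i\<in>I. zz (x i)) \<partial>?P)"
    by (subst nn_integral_distr) (auto simp: nn_integral_density)
  finally show ?thesis by simp
qed

text \<open>In the application \<open>R\<close> is the prior restricted to a sieve, so it is finite
  without being a probability measure, and \<open>S\<close> is the law of one covariate.\<close>

locale bounded_class =
  fixes R :: "'e measure" and S :: "'z measure" and g :: "'e \<Rightarrow> 'z \<Rightarrow> real"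
  assumes R: "finite_measure R" and S: "prob_space S"
    and g_meas: "(\<lambda>(\<eta>, z). g \<eta> z) \<in> borel_measurable (R \<Otimes>\<^sub>M S)"
    and g_bound: "\<And>\<eta> z. \<bar>g \<eta> z\<bar> \<le> 1"
begin

sublocale R: finite_measure R by (rule R)
sublocale S: prob_space S by (rule S)

lemma sfR: "sigma_finite_measure R" by (rule R.sigma_finite_measure_axioms)

lemma g_comp[measurable (raw)]:
  assumes "h \<in> measurable N R" "f \<in> measurable N S"
  shows "(\<lambda>p. g (h p) (f p)) \<in> borel_measurable N"
  using measurable_compose[OF measurable_Pair[OF assms] g_meas] by simp

definition gh :: "'e \<Rightarrow> 'z \<Rightarrow> real" where
  "gh \<eta> z = g \<eta> z - (\<integral>z. g \<eta> z \<partial>S)"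

lemma Pg_measurable[measurable]: "(\<lambda>\<eta>. \<integral>z. g \<eta> z \<partial>S) \<in> borel_measurable R"
  using g_meas by (rule S.borel_measurable_lebesgue_integral)

lemma gh_comp[measurable (raw)]:
  assumes [measurable]: "h \<in> measurable N R" "f \<in> measurable N S"
  shows "(\<lambda>p. gh (h p) (f p)) \<in> borel_measurable N"
proof -
  have [measurable]: "(\<lambda>p. \<integral>z. g (h p) z \<partial>S) \<in> borel_measurable N"
    by (rule measurable_compose[OF assms(1) Pg_measurable])
  show ?thesis unfolding gh_def by measurable
qed

lemma g_integrable: "\<eta> \<in> space R \<Longrightarrow> integrable S (g \<eta>)"
  by (rule S.integrable_const_bound[where B=1]) (auto simp: g_bound intro!: g_comp)

lemma Pg_bound: "\<bar>\<integral>z. g \<eta> z \<partial>S\<bar> \<le> 1"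
proof (cases "integrable S (g \<eta>)")
  case True
  have "\<bar>\<integral>z. g \<eta> z \<partial>S\<bar> \<le> (\<integral>z. \<bar>g \<eta> z\<bar> \<partial>S)" by (rule integral_abs_bound)
  also have "\<dots> \<le> 1" using True g_bound by (intro S.integral_le_const) auto
  finally show ?thesis .
qed (simp add: not_integrable_integral_eq)

lemma gh_bound: "\<bar>gh \<eta> z\<bar> \<le> 2"
  unfolding gh_def using g_bound[of \<eta> z] Pg_bound[of \<eta>] by linarith

lemma gh_integral: "\<eta> \<in> space R \<Longrightarrow> integrable S (gh \<eta>)" "\<eta> \<in> space R \<Longrightarrow> (\<integral>z. gh \<eta> z \<partial>S) = 0"
  unfolding gh_def[abs_def] using g_integrable by (auto simp: S.prob_space)

text \<open>Indexed by a set, since a sign pattern splits the sample into its positive and its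
  negative positions.\<close>

definition centred :: "nat set \<Rightarrow> (nat \<Rightarrow> 'z) \<Rightarrow> 'e \<Rightarrow> real" where
  "centred C x \<eta> = (\<Sum>i\<in>C. gh \<eta> (x i))"

lemma centred_measurable2[measurable (raw)]:
  assumes "C \<subseteq> I" shows "(\<lambda>(x, \<eta>). centred C x \<eta>) \<in> borel_measurable ((\<Pi>\<^sub>M i\<in>I. S) \<Otimes>\<^sub>M R)"
proof -
  have "(\<lambda>p. gh (snd p) (fst p i)) \<in> borel_measurable ((\<Pi>\<^sub>M i\<in>I. S) \<Otimes>\<^sub>M R)" if "i \<in> C" for i
  proof -
    have "i \<in> I" using that assms by auto
    then show ?thesis by (intro gh_comp) measurable
  qed
  then show ?thesis unfolding centred_def split_beta' by (intro borel_measurable_sum)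
qed

lemma ess_centred_measurable:
  "C \<subseteq> I \<Longrightarrow> (\<lambda>x. ess_norm R (centred C x)) \<in> borel_measurable (\<Pi>\<^sub>M i\<in>I. S)"
  by (intro ess_norm_measurable[OF sfR] centred_measurable2)

lemma centred_measurable:
  assumes "C \<subseteq> I" "x \<in> space (\<Pi>\<^sub>M i\<in>I. S)" shows "centred C x \<in> borel_measurable R"
  using measurable_compose[OF measurable_Pair1'[OF assms(2)] centred_measurable2[OF assms(1)]] by simp

lemma ess_centred_insert:
  assumes fin: "finite I" and C: "C \<subseteq> I" "j \<in> I" "j \<notin> C"
  shows "(\<integral>\<^sup>+x. ess_norm R (centred C x) \<partial>(\<Pi>\<^sub>M i\<in>I. S)) \<le> (\<integral>\<^sup>+x. ess_norm R (centred (insert j C) x) \<partial>(\<Pi>\<^sub>M i\<in>I. S))"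
proof -
  interpret product_prob_space "\<lambda>_. S" I by (intro product_prob_spaceI S)
  define I' where "I' = I - {j}"
  have I': "finite I'" "j \<notin> I'" "insert j I' = I" "C \<subseteq> I'" using fin C by (auto simp: I'_def)
  have finC: "finite C" using C fin finite_subset by auto
  have m: "(\<lambda>x. ess_norm R (centred D x)) \<in> borel_measurable (Pi\<^sub>M (insert j I') (\<lambda>_. S))" if "D \<subseteq> I" for D
    using ess_centred_measurable[OF that] I' by simp
  have "(\<integral>\<^sup>+x. ess_norm R (centred C x) \<partial>(\<Pi>\<^sub>M i\<in>I. S))
     = (\<integral>\<^sup>+x. (\<integral>\<^sup>+y. ess_norm R (centred C (x(j := y))) \<partial>S) \<partial>(\<Pi>\<^sub>M i\<in>I'. S))"
    using product_nn_integral_insert[OF I'(1,2) m[OF C(1)]] I' by simp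
  also have "\<dots> = (\<integral>\<^sup>+x. ess_norm R (centred C x) \<partial>(\<Pi>\<^sub>M i\<in>I'. S))"
  proof (intro nn_integral_cong)
    fix x
    have "centred C (x(j := y)) = centred C x" for y
      unfolding centred_def using C by (intro ext sum.cong) auto
    then show "(\<integral>\<^sup>+y. ess_norm R (centred C (x(j := y))) \<partial>S) = ess_norm R (centred C x)"
      by (simp add: S.emeasure_space_1)
  qed
  also have "\<dots> \<le> (\<integral>\<^sup>+x. (\<integral>\<^sup>+y. ess_norm R (centred (insert j C) (x(j := y))) \<partial>S) \<partial>(\<Pi>\<^sub>M i\<in>I'. S))"
  proof (intro nn_integral_mono)
    fix x assume x: "x \<in> space (\<Pi>\<^sub>M i\<in>I'. S)"
    let ?f = "\<lambda>\<eta> y. centred C x \<eta> + gh \<eta> y"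
    have cm[measurable]: "centred C x \<in> borel_measurable R" by (rule centred_measurable[OF I'(4) x])
    have e1: "centred (insert j C) (x(j := y)) = (\<lambda>\<eta>. ?f \<eta> y)" for y
    proof -
      have "(\<Sum>i\<in>C. gh \<eta> ((x(j := y)) i)) = (\<Sum>i\<in>C. gh \<eta> (x i))" for \<eta>
        using C by (intro sum.cong) auto
      then show ?thesis unfolding centred_def using C finC by (intro ext) (simp del: fun_upd_apply add: fun_upd_same)
    qed
    \<comment> \<open>The new summand has mean zero under \<open>S\<close>, so adding its integral
      changes nothing and brings the expression into the form of Jensen's inequality.\<close>
    have e2: "ess_norm R (centred C x) = ess_norm R (\<lambda>\<eta>. \<integral>y. ?f \<eta> y \<partial>S)"
      unfolding ess_norm_def
    proof (rule esssup_AE_cong)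
      show "AE \<eta> in R. ennreal \<bar>centred C x \<eta>\<bar> = ennreal \<bar>\<integral>y. ?f \<eta> y \<partial>S\<bar>"
        using gh_integral by (auto simp: S.prob_space)
      show "(\<lambda>\<eta>. ennreal \<bar>\<integral>y. ?f \<eta> y \<partial>S\<bar>) \<in> borel_measurable R" by measurable
    qed measurable
    have "ess_norm R (\<lambda>\<eta>. \<integral>y. ?f \<eta> y \<partial>S) \<le> (\<integral>\<^sup>+y. ess_norm R (\<lambda>\<eta>. ?f \<eta> y) \<partial>S)"
    proof (rule ess_norm_Jensen[OF sfR S])
      show "(\<lambda>(\<eta>, y). ?f \<eta> y) \<in> borel_measurable (R \<Otimes>\<^sub>M S)" by measurable
      show "\<bar>?f \<eta> y\<bar> \<le> real (card C) * 2 + 2" for \<eta> y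
      proof -
        have "\<bar>centred C x \<eta>\<bar> \<le> (\<Sum>i\<in>C. 2)" unfolding centred_def
          by (intro order.trans[OF sum_abs] sum_mono gh_bound)
        then show ?thesis using gh_bound[of \<eta> y] by simp
      qed
    qed
    then show "ess_norm R (centred C x) \<le> (\<integral>\<^sup>+y. ess_norm R (centred (insert j C) (x(j := y))) \<partial>S)"
      unfolding e1 e2 .
  qed
  also have "\<dots> = (\<integral>\<^sup>+x. ess_norm R (centred (insert j C) x) \<partial>(\<Pi>\<^sub>M i\<in>I. S))"
    using product_nn_integral_insert[OF I'(1,2) m[of "insert j C"]] I' C by simp
  finally show ?thesis .
qed

text \<open>Integrating out a centred summand can only decrease the norm, by Jensen's inequality.\<close>

lemma ess_centred_mono:
  assumes fin: "finite I" and B: "B \<subseteq> I"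
  shows "(\<integral>\<^sup>+x. ess_norm R (centred B x) \<partial>(\<Pi>\<^sub>M i\<in>I. S)) \<le> (\<integral>\<^sup>+x. ess_norm R (centred I x) \<partial>(\<Pi>\<^sub>M i\<in>I. S))"
proof -
  have "finite D \<Longrightarrow> D \<subseteq> I - B \<Longrightarrow>
    (\<integral>\<^sup>+x. ess_norm R (centred B x) \<partial>(\<Pi>\<^sub>M i\<in>I. S)) \<le> (\<integral>\<^sup>+x. ess_norm R (centred (B \<union> D) x) \<partial>(\<Pi>\<^sub>M i\<in>I. S))" for D
  proof (induction D rule: finite_induct)
    case (insert j D)
    have "(\<integral>\<^sup>+x. ess_norm R (centred B x) \<partial>(\<Pi>\<^sub>M i\<in>I. S)) \<le> (\<integral>\<^sup>+x. ess_norm R (centred (B \<union> D) x) \<partial>(\<Pi>\<^sub>M i\<in>I. S))"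
      using insert by auto
    also have "\<dots> \<le> (\<integral>\<^sup>+x. ess_norm R (centred (insert j (B \<union> D)) x) \<partial>(\<Pi>\<^sub>M i\<in>I. S))"
      using insert B by (intro ess_centred_insert[OF fin]) auto
    finally show ?case by simp
  qed simp
  from this[of "I - B"] show ?thesis using fin B by (simp add: Un_absorb1)
qed

text \<open>Equals sqrt n times the mean of the essential supremum of the empirical process, so
  smallness will mean o(sqrt n).\<close>

definition rn :: "nat \<Rightarrow> ennreal" where
  "rn n = (\<integral>\<^sup>+x. ess_norm R (centred {..<n} x) \<partial>(\<Pi>\<^sub>M i\<in>{..<n}. S))"

definition signed :: "nat \<Rightarrow> nat set \<Rightarrow> (nat \<Rightarrow> 'z) \<Rightarrow> 'e \<Rightarrow> real" where
  "signed n A x \<eta> = (\<Sum>i<n. sg A i * g \<eta> (x i))"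

lemma signed_measurable2:
  "(\<lambda>(x, \<eta>). signed n A x \<eta>) \<in> borel_measurable ((\<Pi>\<^sub>M i\<in>{..<n}. S) \<Otimes>\<^sub>M R)"
proof -
  have "(\<lambda>p. g (snd p) (fst p i)) \<in> borel_measurable ((\<Pi>\<^sub>M i\<in>{..<n}. S) \<Otimes>\<^sub>M R)" if "i \<in> {..<n}" for i
    using that by (intro g_comp) measurable
  then show ?thesis unfolding signed_def split_beta' by (intro borel_measurable_sum borel_measurable_times borel_measurable_const)
qed

lemma signed_measurable:
  assumes "x \<in> space (\<Pi>\<^sub>M i\<in>{..<n}. S)" shows "signed n A x \<in> borel_measurable R"
  using measurable_compose[OF measurable_Pair1'[OF assms] signed_measurable2] by simp

lemma ess_signed_measurable[measurable]:
  "(\<lambda>x. ess_norm R (signed n A x)) \<in> borel_measurable (\<Pi>\<^sub>M i\<in>{..<n}. S)"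
  by (intro ess_norm_measurable[OF sfR] signed_measurable2)

text \<open>Desymmetrisation for one fixed sign pattern. The positive and the negative positions
  give two centred partial sums, and completing either to the full sample can only increase its mean
  norm. As the signs act on uncentred functions, the means remain, with the net sign as
  factor.\<close>

lemma ess_signed_le:
  assumes \<delta>: "AE \<eta> in R. \<bar>\<integral>z. g \<eta> z \<partial>S\<bar> \<le> \<delta>" and d0: "\<delta> \<ge> 0"
  shows "(\<integral>\<^sup>+x. ess_norm R (signed n A x) \<partial>(\<Pi>\<^sub>M i\<in>{..<n}. S)) \<le> 2 * rn n + ennreal (\<bar>\<Sum>i<n. sg A i\<bar> * \<delta>)"
proof -
  let ?S = "\<Pi>\<^sub>M i\<in>{..<n}. S"
  interpret PS: prob_space ?S by (intro prob_space_PiM S)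
  define C D where "C = {..<n} \<inter> A" and "D = {..<n} - A"
  have CD: "C \<subseteq> {..<n}" "D \<subseteq> {..<n}" "C \<union> D = {..<n}" "C \<inter> D = {}" by (auto simp: C_def D_def)
  note [measurable] = ess_centred_measurable[OF CD(1)] ess_centred_measurable[OF CD(2)]
  have "(\<integral>\<^sup>+x. ess_norm R (signed n A x) \<partial>?S)
    \<le> (\<integral>\<^sup>+x. ess_norm R (centred C x) + ess_norm R (centred D x) + ennreal (\<bar>\<Sum>i<n. sg A i\<bar> * \<delta>) \<partial>?S)"
  proof (intro nn_integral_mono ess_norm_le signed_measurable)
    fix x assume x: "x \<in> space ?S"
    show "AE \<eta> in R. ennreal \<bar>signed n A x \<eta>\<bar> \<le> ess_norm R (centred C x) + ess_norm R (centred D x) + ennreal (\<bar>\<Sum>i<n. sg A i\<bar> * \<delta>)"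
      using \<delta> ess_norm_AE[of "centred C x" R] ess_norm_AE[of "centred D x" R]
    proof eventually_elim
      case (elim \<eta>)
      let ?p = "\<integral>z. g \<eta> z \<partial>S"
      have "signed n A x \<eta> = (\<Sum>i<n. sg A i * gh \<eta> (x i)) + (\<Sum>i<n. sg A i) * ?p"
        by (simp add: signed_def gh_def right_diff_distrib sum_subtractf sum_distrib_right)
      also have "(\<Sum>i<n. sg A i * gh \<eta> (x i)) = (\<Sum>i\<in>C. sg A i * gh \<eta> (x i)) + (\<Sum>i\<in>D. sg A i * gh \<eta> (x i))"
        unfolding CD(3)[symmetric] using CD finite_subset[OF CD(1)] finite_subset[OF CD(2)] by (intro sum.union_disjoint) auto
      also have "(\<Sum>i\<in>C. sg A i * gh \<eta> (x i)) = centred C x \<eta>"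
        unfolding centred_def by (intro sum.cong) (auto simp: C_def sg_def)
      also have "(\<Sum>i\<in>D. sg A i * gh \<eta> (x i)) = - centred D x \<eta>"
        unfolding centred_def sum_negf[symmetric] by (intro sum.cong) (auto simp: D_def sg_def)
      finally have "\<bar>signed n A x \<eta>\<bar> \<le> \<bar>centred C x \<eta>\<bar> + \<bar>centred D x \<eta>\<bar> + \<bar>(\<Sum>i<n. sg A i)\<bar> * \<bar>?p\<bar>"
        unfolding abs_mult[symmetric] by linarith
      also have "\<dots> \<le> \<bar>centred C x \<eta>\<bar> + \<bar>centred D x \<eta>\<bar> + \<bar>(\<Sum>i<n. sg A i)\<bar> * \<delta>"
        using elim(1) by (intro add_left_mono mult_left_mono) auto
      finally have "ennreal \<bar>signed n A x \<eta>\<bar> \<le> ennreal (\<bar>centred C x \<eta>\<bar> + \<bar>centred D x \<eta>\<bar> + \<bar>(\<Sum>i<n. sg A i)\<bar> * \<delta>)"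
        by (rule ennreal_leI)
      also have "\<dots> = ennreal \<bar>centred C x \<eta>\<bar> + ennreal \<bar>centred D x \<eta>\<bar> + ennreal (\<bar>(\<Sum>i<n. sg A i)\<bar> * \<delta>)"
        using d0 by (simp add: ennreal_plus)
      also have "\<dots> \<le> ess_norm R (centred C x) + ess_norm R (centred D x) + ennreal (\<bar>\<Sum>i<n. sg A i\<bar> * \<delta>)"
        using elim by (intro add_mono) auto
      finally show ?case .
    qed
  qed
  also have "\<dots> = (\<integral>\<^sup>+x. ess_norm R (centred C x) \<partial>?S) + (\<integral>\<^sup>+x. ess_norm R (centred D x) \<partial>?S) + ennreal (\<bar>\<Sum>i<n. sg A i\<bar> * \<delta>)"
    by (simp add: nn_integral_add PS.emeasure_space_1)
  also have "\<dots> \<le> rn n + rn n + ennreal (\<bar>\<Sum>i<n. sg A i\<bar> * \<delta>)"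
    unfolding rn_def using CD by (intro add_mono ess_centred_mono order.refl) auto
  finally show ?thesis by (simp add: mult_2)
qed

text \<open>Averaging over the patterns replaces the net sign by its mean absolute value, at most
  sqrt n; hence means of size \<delta> contribute \<open>sqrt n * \<delta>\<close>.\<close>

lemma sum_ess_signed_le:
  assumes \<delta>: "AE \<eta> in R. \<bar>\<integral>z. g \<eta> z \<partial>S\<bar> \<le> \<delta>" and d0: "\<delta> \<ge> 0" and c: "c \<ge> 0"
  shows "(\<Sum>A\<in>Pow {..<n}. ennreal (c / 2 ^ n) * (\<integral>\<^sup>+x. ess_norm R (signed n A x) \<partial>(\<Pi>\<^sub>M i\<in>{..<n}. S)))
    \<le> ennreal c * (2 * rn n + ennreal (sqrt n * \<delta>))"
proof -
  have "(\<Sum>A\<in>Pow {..<n}. ennreal (c / 2 ^ n) * (\<integral>\<^sup>+x. ess_norm R (signed n A x) \<partial>(\<Pi>\<^sub>M i\<in>{..<n}. S)))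
    \<le> (\<Sum>A\<in>Pow {..<n}. ennreal (c / 2 ^ n) * (2 * rn n + ennreal (\<bar>\<Sum>i<n. sg A i\<bar> * \<delta>)))"
    by (intro sum_mono mult_left_mono ess_signed_le[OF \<delta> d0]) auto
  also have "\<dots> = ennreal (c / 2 ^ n) * (of_nat (2 ^ n) * (2 * rn n)) + ennreal (c / 2 ^ n) * ennreal ((\<Sum>A\<in>Pow {..<n}. \<bar>\<Sum>i<n. sg A i\<bar>) * \<delta>)"
  proof -
    have "(\<Sum>A\<in>Pow {..<n}. 2 * rn n) = of_nat (2 ^ n) * (2 * rn n)" by (simp add: card_Pow)
    moreover have "(\<Sum>A\<in>Pow {..<n}. ennreal (\<bar>\<Sum>i<n. sg A i\<bar> * \<delta>)) = ennreal ((\<Sum>A\<in>Pow {..<n}. \<bar>\<Sum>i<n. sg A i\<bar>) * \<delta>)"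
      using d0 by (subst sum_ennreal) (auto simp: sum_distrib_right)
    ultimately show ?thesis by (simp only: sum_distrib_left[symmetric] sum.distrib distrib_left)
  qed
  also have "ennreal (c / 2 ^ n) * (of_nat (2 ^ n) * (2 * rn n)) = ennreal c * (2 * rn n)"
  proof -
    have "ennreal (c / 2 ^ n) * of_nat (2 ^ n) = ennreal c"
      unfolding ennreal_of_nat_eq_real_of_nat using c by (subst ennreal_mult'[symmetric]) auto
    then show ?thesis by (simp only: mult.assoc[symmetric])
  qed
  also have "ennreal (c / 2 ^ n) * ennreal ((\<Sum>A\<in>Pow {..<n}. \<bar>\<Sum>i<n. sg A i\<bar>) * \<delta>) \<le> ennreal c * ennreal (sqrt n * \<delta>)"
  proof -
    have "c / 2 ^ n * ((\<Sum>A\<in>Pow {..<n}. \<bar>\<Sum>i<n. sg A i\<bar>) * \<delta>) \<le> c / 2 ^ n * (2 ^ n * sqrt n * \<delta>)"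
      using c d0 sum_sg_abs[of n] by (intro mult_left_mono mult_right_mono) auto
    then show ?thesis using c d0 by (simp add: ennreal_mult[symmetric] sum_nonneg ennreal_leI)
  qed
  finally show ?thesis by (simp add: distrib_left)
qed

text \<open>A centred variable with values in \<open>[-K, K]\<close> is dominated in convex order by a random sign times
  \<open>K\<close>: the weights \<open>(1 + s \<xi> / K) / 2\<close> write \<open>\<xi>\<close> as a mean of \<open>s K\<close>, and conditionally on \<open>zz\<close> they
  average to \<open>1 / 2\<close>.\<close>

lemma ess_multiplier_le:
  assumes P: "prob_space P" and zz[measurable]: "zz \<in> measurable P S" and \<xi>[measurable]: "\<xi> \<in> borel_measurable P"
    and \<xi>K: "\<And>x. \<bar>\<xi> x\<bar> \<le> K" and K: "K > 0"
    and eq: "\<And>s A. s = 1 \<or> s = -1 \<Longrightarrow> A \<in> sets S \<Longrightarrow>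
       (\<integral>\<^sup>+x. ennreal (1 + s * (\<xi> x / K)) * indicator A (zz x) \<partial>P) = emeasure S A"
    and \<delta>: "AE \<eta> in R. \<bar>\<integral>z. g \<eta> z \<partial>S\<bar> \<le> \<delta>" and d0: "\<delta> \<ge> 0"
  shows "(\<integral>\<^sup>+x. ess_norm R (\<lambda>\<eta>. \<Sum>i<n. \<xi> (x i) * g \<eta> (zz (x i))) \<partial>(\<Pi>\<^sub>M i\<in>{..<n}. P))
    \<le> ennreal K * (2 * rn n + ennreal (sqrt n * \<delta>))"
proof -
  let ?P = "\<Pi>\<^sub>M i\<in>{..<n}. P"
  define y where "y x i = \<xi> (x i) / K" for x :: "nat \<Rightarrow> _" and i
  define W where "W A x = (\<Prod>i<n. 1 + sg A i * y x i)" for A and x :: "nat \<Rightarrow> _"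
  have y1: "\<bar>y x i\<bar> \<le> 1" for x i using \<xi>K[of "x i"] K by (simp add: y_def)
  have W1: "0 \<le> 1 + sg A i * y x i" for A i x using y1[of x i] by (auto simp: sg_def)
  have W0: "W A x \<ge> 0" for A x unfolding W_def using W1 by (intro prod_nonneg) auto
  define zr where "zr x = (\<lambda>i\<in>{..<n}. zz (x i))" for x :: "nat \<Rightarrow> _"
  have zrm[measurable]: "zr \<in> measurable ?P (\<Pi>\<^sub>M i\<in>{..<n}. S)" unfolding zr_def by measurable
  have sm: "(\<lambda>\<eta>. \<Sum>i<n. \<xi> (x i) * g \<eta> (zz (x i))) \<in> borel_measurable R" if x: "x \<in> space ?P" for x
  proof -
    have "zz (x i) \<in> space S" if "i \<in> {..<n}" for i
      using x that measurable_space[OF zz] by (auto simp: space_PiM PiE_iff)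
    then show ?thesis by (intro borel_measurable_sum borel_measurable_times borel_measurable_const g_comp) auto
  qed
  have "(\<integral>\<^sup>+x. ess_norm R (\<lambda>\<eta>. \<Sum>i<n. \<xi> (x i) * g \<eta> (zz (x i))) \<partial>?P)
     \<le> (\<integral>\<^sup>+x. (\<Sum>A\<in>Pow {..<n}. ennreal (K / 2 ^ n * W A x) * ess_norm R (signed n A (zr x))) \<partial>?P)"
  proof (intro nn_integral_mono ess_norm_sum_scaled sm)
    fix x \<eta> assume "x \<in> space ?P" "\<eta> \<in> space R"
    have sr: "signed n A (zr x) \<eta> = (\<Sum>i<n. sg A i * g \<eta> (zz (x i)))" for A
      unfolding signed_def zr_def by (intro sum.cong) auto
    \<comment> \<open>The weights tilt the signs to means \<open>\<xi> / K\<close>, so for each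
      sample the multiplier sum is a weighted average of signed sums, with weights that do not
      depend on \<eta>.\<close>
    have "(\<Sum>i<n. \<xi> (x i) * g \<eta> (zz (x i))) = K / 2 ^ n * (2 ^ n * (0 + (\<Sum>i<n. y x i * g \<eta> (zz (x i)))))"
      using K by (simp add: y_def sum_distrib_left)
    also have "\<dots> = (\<Sum>A\<in>Pow {..<n}. K / 2 ^ n * W A x * signed n A (zr x) \<eta>)"
      unfolding sum_sg_weighted[symmetric] W_def[symmetric] sr by (simp add: sum_distrib_left mult.assoc)
    also have "\<bar>\<dots>\<bar> \<le> (\<Sum>A\<in>Pow {..<n}. K / 2 ^ n * W A x * \<bar>signed n A (zr x) \<eta>\<bar>)"
      using W0 K by (intro order.trans[OF sum_abs] sum_mono) (simp add: abs_mult)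
    finally show "\<bar>\<Sum>i<n. \<xi> (x i) * g \<eta> (zz (x i))\<bar> \<le> (\<Sum>A\<in>Pow {..<n}. K / 2 ^ n * W A x * \<bar>signed n A (zr x) \<eta>\<bar>)" .
  next
    fix x A assume "x \<in> space ?P"
    then show "signed n A (zr x) \<in> borel_measurable R" by (intro signed_measurable measurable_space[OF zrm])
  qed (use W0 K in auto)
  also have "\<dots> = (\<Sum>A\<in>Pow {..<n}. ennreal (K / 2 ^ n) * (\<integral>\<^sup>+x. (\<Prod>i\<in>{..<n}. ennreal (1 + sg A i * (\<xi> (x i) / K))) * ess_norm R (signed n A (zr x)) \<partial>?P))"
  proof -
    have Wp: "ennreal (K / 2 ^ n * W A x) = ennreal (K / 2 ^ n) * (\<Prod>i\<in>{..<n}. ennreal (1 + sg A i * (\<xi> (x i) / K)))" for A x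
      unfolding W_def y_def using K W1[unfolded y_def] by (subst ennreal_mult') (auto simp: prod_ennreal)
    have mm: "(\<lambda>x. ess_norm R (signed n A (zr x))) \<in> borel_measurable ?P" for A
      by (rule measurable_compose[OF zrm ess_signed_measurable])
    note [measurable] = mm
    show ?thesis unfolding Wp mult.assoc
      by (subst nn_integral_sum, measurable) (intro sum.cong refl nn_integral_cmult, measurable)
  qed
  \<comment> \<open>The signed sums see the sample only through \<open>zz\<close>, so the weights
    integrate out.\<close>
  also have "\<dots> = (\<Sum>A\<in>Pow {..<n}. ennreal (K / 2 ^ n) * (\<integral>\<^sup>+x. ess_norm R (signed n A x) \<partial>(\<Pi>\<^sub>M i\<in>{..<n}. S)))"
    unfolding zr_def
  proof (intro sum.cong arg_cong2[where f="(*)"] refl weighted_product_integral[OF P S zz])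
    fix A i B assume "B \<in> sets S"
    then show "(\<integral>\<^sup>+x. ennreal (1 + sg A i * (\<xi> x / K)) * indicator B (zz x) \<partial>P) = emeasure S B"
      by (intro eq) (auto simp: sg_def)
  qed measurable
  also have "\<dots> \<le> ennreal K * (2 * rn n + ennreal (sqrt n * \<delta>))"
    using K by (intro sum_ess_signed_le[OF \<delta> d0]) auto
  finally show ?thesis .
qed

text \<open>The Khintchine type bound holds for each \<eta> with coefficients free of \<eta>, so it
  passes to the essential supremum.\<close>

lemma ess_squares_le:
  assumes \<delta>: "AE \<eta> in R. \<bar>\<integral>z. g \<eta> z \<partial>S\<bar> \<le> \<delta>" and d0: "\<delta> \<ge> 0" and n: "n \<ge> 1"
  shows "(\<integral>\<^sup>+x. ess_norm R (\<lambda>\<eta>. (\<Sum>i<n. (g \<eta> (x i))\<^sup>2) / n) \<partial>(\<Pi>\<^sub>M i\<in>{..<n}. S))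
    \<le> ennreal (8 / sqrt n) * (2 * rn n + ennreal (sqrt n * \<delta>))"
proof -
  let ?S = "\<Pi>\<^sub>M i\<in>{..<n}. S"
  have "(\<integral>\<^sup>+x. ess_norm R (\<lambda>\<eta>. (\<Sum>i<n. (g \<eta> (x i))\<^sup>2) / n) \<partial>?S)
     \<le> (\<integral>\<^sup>+x. (\<Sum>A\<in>Pow {..<n}. ennreal (8 / sqrt n / 2 ^ n) * ess_norm R (signed n A x)) \<partial>?S)"
  proof (intro nn_integral_mono ess_norm_sum_scaled signed_measurable)
    fix x \<eta> assume x: "x \<in> space ?S" and "\<eta> \<in> space R"
    have "(\<Sum>i<n. (g \<eta> (x i))\<^sup>2) / n \<le> (\<Sum>A\<in>Pow {..<n}. 8 / (sqrt n * 2 ^ n) * \<bar>\<Sum>i<n. sg A i * g \<eta> (x i)\<bar>)"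
      using n by (intro sum_squares_le_sg g_bound)
    then show "\<bar>(\<Sum>i<n. (g \<eta> (x i))\<^sup>2) / n\<bar> \<le> (\<Sum>A\<in>Pow {..<n}. 8 / sqrt n / 2 ^ n * \<bar>signed n A x \<eta>\<bar>)"
      by (simp add: signed_def sum_nonneg)
  next
    fix x assume x: "x \<in> space ?S"
    have "x i \<in> space S" if "i \<in> {..<n}" for i using x that by (auto simp: space_PiM PiE_iff)
    then show "(\<lambda>\<eta>. (\<Sum>i<n. (g \<eta> (x i))\<^sup>2) / n) \<in> borel_measurable R"
      by (intro borel_measurable_sum borel_measurable_divide borel_measurable_power borel_measurable_const g_comp) auto
  qed auto
  also have "\<dots> = (\<Sum>A\<in>Pow {..<n}. ennreal (8 / sqrt n / 2 ^ n) * (\<integral>\<^sup>+x. ess_norm R (signed n A x) \<partial>?S))"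
    by (simp add: nn_integral_sum nn_integral_cmult)
  also have "\<dots> \<le> ennreal (8 / sqrt n) * (2 * rn n + ennreal (sqrt n * \<delta>))"
    by (intro sum_ess_signed_le[OF \<delta> d0]) auto
  finally show ?thesis .
qed

text \<open>Bounded differences of size 2 / sqrt n give the variance bound 4 that is built into
  \<open>expectation_small\<close>; the crude bound \<open>2 * sqrt n\<close> on
  \<open>\<tau>\<close> serves integrability.\<close>

lemma rn_le:
  assumes n: "n \<ge> 1" and e: "0 < e" "e \<le> 1 / 2"
    and p: "measure (\<Pi>\<^sub>M i\<in>{..<n}. S) {x \<in> space (\<Pi>\<^sub>M i\<in>{..<n}. S). ennreal (e * sqrt n) < ess_norm R (centred {..<n} x)} \<le> e\<^sup>2"
  shows "rn n \<le> ennreal (7 * e * sqrt n)"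
proof -
  let ?S = "\<Pi>\<^sub>M i\<in>{..<n}. S"
  interpret PS: prob_space ?S by (intro prob_space_PiM S)
  note [measurable] = ess_centred_measurable[of "{..<n}" "{..<n}", OF order.refl]
  define \<tau> where "\<tau> x = enn2real (ess_norm R (centred {..<n} x)) / sqrt n" for x
  have up: "ess_norm R (centred {..<n} x) \<le> ennreal (2 * n)" if "x \<in> space ?S" for x
  proof (intro ess_norm_le centred_measurable[OF order.refl that] AE_I2)
    fix \<eta>
    have "\<bar>centred {..<n} x \<eta>\<bar> \<le> (\<Sum>i<n. 2)" unfolding centred_def
      by (intro order.trans[OF sum_abs] sum_mono gh_bound)
    then show "ennreal \<bar>centred {..<n} x \<eta>\<bar> \<le> ennreal (2 * n)" by (intro ennreal_leI) simp
  qed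
  have fin: "ess_norm R (centred {..<n} x) = ennreal (sqrt n * \<tau> x)" if "x \<in> space ?S" for x
    using order.strict_trans1[OF up[OF that] ennreal_less_top] n by (simp add: \<tau>_def)
  have t0: "0 \<le> \<tau> x" for x by (simp add: \<tau>_def)
  have \<tau>m[measurable]: "\<tau> \<in> borel_measurable ?S" unfolding \<tau>_def by measurable
  have \<tau>B: "\<tau> x \<le> 2 * sqrt n" if "x \<in> space ?S" for x
  proof -
    have "sqrt n * \<tau> x \<le> 2 * n" using up[OF that] unfolding fin[OF that] by (simp add: ennreal_le_iff)
    then have "sqrt n * \<tau> x \<le> sqrt n * (2 * sqrt n)"
      by (simp only: mult.left_commute[of "sqrt n" 2] real_sqrt_mult_self abs_of_nat)
    then show ?thesis using n by (subst (asm) mult_le_cancel_left_pos) auto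
  qed
  have diff: "\<bar>\<tau> (x(i := y)) - \<tau> x\<bar> \<le> 2 / sqrt n" if x: "x \<in> space ?S" and i: "i < n" and y: "y \<in> space S" for x i y
  proof -
    have half: "\<tau> x1 \<le> \<tau> x2 + 2 / sqrt n" if x1: "x1 \<in> space ?S" and x2: "x2 \<in> space ?S" and eq: "\<And>k. k \<noteq> i \<Longrightarrow> x1 k = x2 k" for x1 x2
    proof -
      have "ess_norm R (centred {..<n} x1) \<le> ess_norm R (centred {..<n} x2) + ennreal 2"
      proof (rule ess_norm_le[OF centred_measurable[OF order.refl x1]])
        show "AE \<eta> in R. ennreal \<bar>centred {..<n} x1 \<eta>\<bar> \<le> ess_norm R (centred {..<n} x2) + ennreal 2"
          using ess_norm_AE[of "centred {..<n} x2" R]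
        proof eventually_elim
          case (elim \<eta>)
          \<comment> \<open>The centring terms cancel in the difference, which leaves two values of
            \<open>g\<close>, hence at most 2.\<close>
          have "centred {..<n} x1 \<eta> - centred {..<n} x2 \<eta> = (\<Sum>k<n. if k = i then gh \<eta> (x1 i) - gh \<eta> (x2 i) else 0)"
            unfolding centred_def sum_subtractf[symmetric] using eq by (intro sum.cong) auto
          also have "\<dots> = g \<eta> (x1 i) - g \<eta> (x2 i)" using i by (simp add: gh_def)
          finally have "\<bar>centred {..<n} x1 \<eta>\<bar> \<le> \<bar>centred {..<n} x2 \<eta>\<bar> + 2"
            using g_bound[of \<eta> "x1 i"] g_bound[of \<eta> "x2 i"] by linarith
          then have "ennreal \<bar>centred {..<n} x1 \<eta>\<bar> \<le> ennreal (\<bar>centred {..<n} x2 \<eta>\<bar> + 2)"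
            by (rule ennreal_leI)
          also have "\<dots> = ennreal \<bar>centred {..<n} x2 \<eta>\<bar> + ennreal 2" by (rule ennreal_plus) auto
          also have "\<dots> \<le> ess_norm R (centred {..<n} x2) + ennreal 2" using elim by (rule add_right_mono)
          finally show ?case .
        qed
      qed
      then have "ennreal (sqrt n * \<tau> x1) \<le> ennreal (sqrt n * \<tau> x2) + ennreal 2"
        unfolding fin[OF x1] fin[OF x2] .
      also have "\<dots> = ennreal (sqrt n * \<tau> x2 + 2)" using t0[of x2] by (intro ennreal_plus[symmetric]) auto
      finally have "sqrt n * \<tau> x1 \<le> sqrt n * \<tau> x2 + 2" using t0[of x2] by (subst (asm) ennreal_le_iff) auto
      then show ?thesis using n by (simp add: field_simps)
    qed
    have x': "x(i := y) \<in> space ?S" using x i y by (auto simp: space_PiM PiE_iff extensional_def)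
    show ?thesis using half[OF x x'] half[OF x' x] by auto
  qed
  have var: "(\<integral>x. (\<tau> x)\<^sup>2 \<partial>?S) - (\<integral>x. \<tau> x \<partial>?S)\<^sup>2 \<le> 4"
  proof -
    have "(\<integral>x. (\<tau> x)\<^sup>2 \<partial>?S) - (\<integral>x. \<tau> x \<partial>?S)\<^sup>2 \<le> n * (2 / sqrt n)\<^sup>2"
      by (rule bounded_differences_variance[OF S \<tau>m _ diff, of "2 * sqrt n"]) (use t0 \<tau>B in auto)
    also have "\<dots> = 4" using n by (simp add: power_divide)
    finally show ?thesis .
  qed
  have "(\<integral>x. \<tau> x \<partial>?S) \<le> 7 * e"
  proof (rule expectation_small[OF _ \<tau>m _ var e])
    have "{x \<in> space ?S. e < \<tau> x} = {x \<in> space ?S. ennreal (e * sqrt n) < ess_norm R (centred {..<n} x)}"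
      using fin n e by (auto simp: ennreal_less_iff mult.commute)
    then show "measure ?S {x \<in> space ?S. e < \<tau> x} \<le> e\<^sup>2" using p by simp
  qed (use t0 \<tau>B in \<open>auto intro: PS.prob_space_axioms\<close>)
  moreover have "rn n = ennreal (sqrt n * (\<integral>x. \<tau> x \<partial>?S))"
  proof -
    have "integrable ?S \<tau>" using t0 \<tau>B by (intro PS.integrable_const_bound[where B="2 * sqrt n"]) auto
    then have "(\<integral>\<^sup>+x. ennreal (sqrt n * \<tau> x) \<partial>?S) = ennreal (\<integral>x. sqrt n * \<tau> x \<partial>?S)"
      using t0 by (intro nn_integral_eq_integral) auto
    moreover have "rn n = (\<integral>\<^sup>+x. ennreal (sqrt n * \<tau> x) \<partial>?S)"
      unfolding rn_def using fin by (intro nn_integral_cong) auto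
    ultimately show ?thesis by simp
  qed
  ultimately show ?thesis using n by (simp add: ennreal_leI mult.commute mult_left_mono)
qed

end

section \<open>Statements holding with outer probability tending to one\<close>

text \<open>A family of predicates rather than of real variables, so that bounds on suprema,
  statements for almost every \<eta> and other events of unclear measurability can be intersected
  before any of them is used.\<close>

definition whp :: "'m measure \<Rightarrow> (nat \<Rightarrow> 'm \<Rightarrow> bool) \<Rightarrow> bool" where
  "whp M P \<longleftrightarrow> (\<lambda>n. outer_measure_of M {\<omega> \<in> space M. \<not> P n \<omega>}) \<longlonglongrightarrow> 0"

lemma tendsto_in_outer_prob_whp:
  "tendsto_in_outer_prob M W c \<longleftrightarrow> (\<forall>\<epsilon>>0. whp M (\<lambda>n \<omega>. \<bar>W n \<omega> - c\<bar> \<le> \<epsilon>))"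
  by (simp add: tendsto_in_outer_prob_def whp_def not_le)

lemma outer_measure_of_Un:
  assumes "A \<subseteq> space M" "B \<subseteq> space M"
  shows "outer_measure_of M (A \<union> B) \<le> outer_measure_of M A + outer_measure_of M B"
proof -
  obtain E F where E: "E \<in> sets M" "A \<subseteq> E" "outer_measure_of M A = emeasure M E"
    and F: "F \<in> sets M" "B \<subseteq> F" "outer_measure_of M B = emeasure M F"
    using outer_measure_of_attain[OF assms(1)] outer_measure_of_attain[OF assms(2)] by blast
  have "outer_measure_of M (A \<union> B) \<le> outer_measure_of M (E \<union> F)"
    using E F by (intro outer_measure_of_mono) auto
  also have "\<dots> \<le> emeasure M E + emeasure M F" using E F by (simp add: emeasure_subadditive)
  finally show ?thesis using E F by simp
qed

lemma whp_mono:
  assumes P: "whp M P" and imp: "\<forall>\<^sub>F n in sequentially. \<forall>\<omega>\<in>space M. P n \<omega> \<longrightarrow> Q n \<omega>"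
  shows "whp M Q"
  unfolding whp_def
proof (rule tendsto_sandwich[OF _ _ tendsto_const P[unfolded whp_def]])
  show "\<forall>\<^sub>F n in sequentially. outer_measure_of M {\<omega> \<in> space M. \<not> Q n \<omega>} \<le> outer_measure_of M {\<omega> \<in> space M. \<not> P n \<omega>}"
    using imp by eventually_elim (auto intro!: outer_measure_of_mono)
qed auto

lemma whp_conj:
  assumes P: "whp M P" and Q: "whp M Q"
  shows "whp M (\<lambda>n \<omega>. P n \<omega> \<and> Q n \<omega>)"
  unfolding whp_def
proof (rule tendsto_sandwich[OF _ _ tendsto_const])
  show "(\<lambda>n. outer_measure_of M {\<omega> \<in> space M. \<not> P n \<omega>} + outer_measure_of M {\<omega> \<in> space M. \<not> Q n \<omega>}) \<longlonglongrightarrow> 0"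
    using tendsto_add[OF P[unfolded whp_def] Q[unfolded whp_def]] by simp
  have "{\<omega> \<in> space M. \<not> (P n \<omega> \<and> Q n \<omega>)} = {\<omega> \<in> space M. \<not> P n \<omega>} \<union> {\<omega> \<in> space M. \<not> Q n \<omega>}" for n by auto
  then show "\<forall>\<^sub>F n in sequentially. outer_measure_of M {\<omega> \<in> space M. \<not> (P n \<omega> \<and> Q n \<omega>)}
     \<le> outer_measure_of M {\<omega> \<in> space M. \<not> P n \<omega>} + outer_measure_of M {\<omega> \<in> space M. \<not> Q n \<omega>}"
    by (auto intro!: always_eventually outer_measure_of_Un)
qed auto

lemma whp_True: "whp M (\<lambda>n \<omega>. True)"
  by (simp add: whp_def)

lemma whp_ball_finite:
  assumes "finite T" "\<And>t. t \<in> T \<Longrightarrow> whp M (P t)"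
  shows "whp M (\<lambda>n \<omega>. \<forall>t\<in>T. P t n \<omega>)"
  using assms by (induction T rule: finite_induct) (auto intro: whp_conj simp: whp_True)

lemma whp_AE:
  assumes "AE \<omega> in M. P \<omega>"
  shows "whp M (\<lambda>n \<omega>. P \<omega>)"
proof -
  obtain N where N: "{\<omega> \<in> space M. \<not> P \<omega>} \<subseteq> N" "N \<in> null_sets M" using AE_E[OF assms] by (metis null_setsI)
  have "outer_measure_of M {\<omega> \<in> space M. \<not> P \<omega>} \<le> outer_measure_of M N" by (rule outer_measure_of_mono[OF N(1)])
  also have "\<dots> = 0" using N(2) by (simp add: null_sets_def)
  finally have "outer_measure_of M {\<omega> \<in> space M. \<not> P \<omega>} = 0" by simp
  then show ?thesis by (simp add: whp_def)
qed

lemma whpI: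
  assumes "\<And>e. e > 0 \<Longrightarrow> \<forall>\<^sub>F n in sequentially. outer_measure_of M {\<omega> \<in> space M. \<not> P n \<omega>} \<le> ennreal e"
  shows "whp M P"
  unfolding whp_def
proof (rule order_tendstoI)
  fix a :: ennreal assume "0 < a"
  then obtain b where b: "0 < b" "b < a" using dense by blast
  then have "b < \<top>" by (meson less_le_trans top_greatest)
  then have be: "b = ennreal (enn2real b)" by simp
  then have "enn2real b > 0" using b(1) by (metis ennreal_less_zero_iff)
  from assms[OF this] show "\<forall>\<^sub>F n in sequentially. outer_measure_of M {\<omega> \<in> space M. \<not> P n \<omega>} < a"
    using b(2) be by (auto elim!: eventually_mono)
qed auto

lemma whpD:
  assumes "whp M P" "e > 0"
  shows "\<forall>\<^sub>F n in sequentially. outer_measure_of M {\<omega> \<in> space M. \<not> P n \<omega>} \<le> ennreal e"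
  using order_tendstoD(2)[OF assms(1)[unfolded whp_def], of "ennreal e"] assms(2) by (auto elim: eventually_mono)

text \<open>The scale \<open>r n\<close> will be sqrt n or 1; its positivity is asked only
  eventually because sqrt n vanishes at n = 0.\<close>

lemma whp_Markov:
  assumes Y[measurable]: "\<And>n. Y n \<in> borel_measurable M" and \<kappa>: "\<kappa> > 0"
    and small: "\<And>e. e > 0 \<Longrightarrow> \<forall>\<^sub>F n in sequentially. (\<integral>\<^sup>+\<omega>. Y n \<omega> \<partial>M) \<le> ennreal (e * r n) \<and> r n > 0"
  shows "whp M (\<lambda>n \<omega>. Y n \<omega> \<le> ennreal (\<kappa> * r n))"
proof (rule whpI)
  fix e :: real assume e: "e > 0"
  show "\<forall>\<^sub>F n in sequentially. outer_measure_of M {\<omega> \<in> space M. \<not> Y n \<omega> \<le> ennreal (\<kappa> * r n)} \<le> ennreal e"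
    using small[OF mult_pos_pos[OF e \<kappa>]]
  proof eventually_elim
    case (elim n)
    define c where "c = ennreal (1 / (\<kappa> * r n))"
    have cc: "c * ennreal (\<kappa> * r n) = 1" unfolding c_def using elim \<kappa> by (subst ennreal_mult'[symmetric]) auto
    have "outer_measure_of M {\<omega> \<in> space M. \<not> Y n \<omega> \<le> ennreal (\<kappa> * r n)} = emeasure M {\<omega> \<in> space M. \<not> Y n \<omega> \<le> ennreal (\<kappa> * r n)}"
      by (rule outer_measure_of_eq) measurable
    also have "\<dots> \<le> emeasure M {\<omega> \<in> space M. 1 \<le> c * Y n \<omega>}"
    proof (rule emeasure_mono)
      show "{\<omega> \<in> space M. \<not> Y n \<omega> \<le> ennreal (\<kappa> * r n)} \<subseteq> {\<omega> \<in> space M. 1 \<le> c * Y n \<omega>}"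
      proof safe
        fix \<omega> assume "\<not> Y n \<omega> \<le> ennreal (\<kappa> * r n)"
        then have "c * ennreal (\<kappa> * r n) \<le> c * Y n \<omega>" by (intro mult_left_mono) auto
        then show "1 \<le> c * Y n \<omega>" unfolding cc .
      qed
    qed measurable
    also have "\<dots> \<le> c * (\<integral>\<^sup>+\<omega>. Y n \<omega> * indicator (space M) \<omega> \<partial>M)"
      by (rule nn_integral_Markov_inequality) auto
    also have "(\<integral>\<^sup>+\<omega>. Y n \<omega> * indicator (space M) \<omega> \<partial>M) = (\<integral>\<^sup>+\<omega>. Y n \<omega> \<partial>M)"
      by (intro nn_integral_cong) (simp add: indicator_def)
    also have "c * \<dots> \<le> c * ennreal (e * \<kappa> * r n)" using elim by (intro mult_left_mono) auto
    also have "\<dots> = ennreal e"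
      unfolding c_def using elim \<kappa> e by (subst ennreal_mult'[symmetric]) auto
    finally show ?case .
  qed
qed

section \<open>The law of an observation\<close>

lemma sets_obs_space_pair:
  assumes "sets F0 = sets borel"
  shows "sets (F0 \<Otimes>\<^sub>M count_space (UNIV :: bool set) \<Otimes>\<^sub>M count_space (UNIV :: bool set)) = sets (obs_space :: 'z::topological_space obs measure)"
  unfolding obs_space_def by (intro sets_pair_measure_cong assms refl)

text \<open>Enumerates the four values of (R, Y). For R = 0 both values of Y are recorded as
  \<open>(z, False, False)\<close>, which therefore occurs twice.\<close>

lemma nn_integral_obs_law:
  fixes F0 :: "'z::topological_space measure"
  assumes a0[measurable]: "a0 \<in> borel_measurable borel" and b0[measurable]: "b0 \<in> borel_measurable borel"
    and F0: "prob_space F0" "sets F0 = sets borel" and h[measurable]: "h \<in> borel_measurable obs_space"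
  shows "(\<integral>\<^sup>+w. h w \<partial>obs_law a0 b0 F0) = (\<integral>\<^sup>+z.
     (ennreal (1 / a0 z * b0 z) * h (z, True, True) + ennreal (1 / a0 z * (1 - b0 z)) * h (z, True, False) +
     (ennreal ((1 - 1 / a0 z) * b0 z) * h (z, False, False) + ennreal ((1 - 1 / a0 z) * (1 - b0 z)) * h (z, False, False))) \<partial>F0)"
proof -
  interpret F0: prob_space F0 by fact
  let ?C = "count_space (UNIV :: bool set)"
  let ?N = "F0 \<Otimes>\<^sub>M ?C \<Otimes>\<^sub>M ?C"
  have s: "sets ?N = sets (obs_space :: 'z obs measure)" by (rule sets_obs_space_pair[OF F0(2)])
  note [measurable_cong] = F0(2)
  have C2: "?C \<Otimes>\<^sub>M ?C = count_space UNIV" by (subst pair_measure_count_space) auto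
  let ?d = "\<lambda>(z, r, y). ennreal ((if r then 1 / a0 z else 1 - 1 / a0 z) * (if y then b0 z else 1 - b0 z))"
  let ?m = "\<lambda>(z, r, y). (z, r, r \<and> y)"
  have mb[measurable]: "?m \<in> measurable ?N (obs_space :: 'z obs measure)"
    unfolding obs_space_def by measurable
  have db[measurable]: "?d \<in> borel_measurable ?N" by measurable
  have "(\<integral>\<^sup>+w. h w \<partial>obs_law a0 b0 F0) = (\<integral>\<^sup>+w. h (?m w) \<partial>density ?N ?d)"
    unfolding obs_law_def full_law_def by (subst nn_integral_distr) auto
  also have "\<dots> = (\<integral>\<^sup>+w. ?d w * h (?m w) \<partial>?N)" by (subst nn_integral_density) auto
  also have "\<dots> = (\<integral>\<^sup>+z. (\<integral>\<^sup>+p. ?d (z, p) * h (?m (z, p)) \<partial>(?C \<Otimes>\<^sub>M ?C)) \<partial>F0)"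
  proof (rule sigma_finite_measure.nn_integral_fst[symmetric])
    show "sigma_finite_measure (?C \<Otimes>\<^sub>M ?C)" unfolding C2 by (rule sigma_finite_measure_count_space)
  qed measurable
  also have "\<dots> = (\<integral>\<^sup>+z. (\<Sum>p\<in>UNIV. ?d (z, p) * h (?m (z, p))) \<partial>F0)"
    unfolding C2 by (subst nn_integral_count_space_finite) auto
  also have "\<dots> = (\<integral>\<^sup>+z.
     (ennreal (1 / a0 z * b0 z) * h (z, True, True) + ennreal (1 / a0 z * (1 - b0 z)) * h (z, True, False) +
     (ennreal ((1 - 1 / a0 z) * b0 z) * h (z, False, False) + ennreal ((1 - 1 / a0 z) * (1 - b0 z)) * h (z, False, False))) \<partial>F0)"
    by (intro nn_integral_cong) (simp add: UNIV_Times_UNIV[symmetric] sum.cartesian_product[symmetric] UNIV_bool add_ac del: UNIV_Times_UNIV)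
  finally show ?thesis .
qed

locale causal_model =
  fixes a0 b0 :: "'z::topological_space \<Rightarrow> real" and F0 :: "'z measure" and \<epsilon>0 :: real
  assumes a0[measurable]: "a0 \<in> borel_measurable borel" and b0[measurable]: "b0 \<in> borel_measurable borel"
    and F0: "prob_space F0" and sF0[measurable_cong]: "sets F0 = sets borel"
    and \<epsilon>0: "\<epsilon>0 > 0" and ab: "\<And>z. \<epsilon>0 \<le> 1 / a0 z \<and> 1 / a0 z \<le> 1 - \<epsilon>0 \<and> \<epsilon>0 \<le> b0 z \<and> b0 z \<le> 1 - \<epsilon>0"
begin

sublocale F0: prob_space F0 by (rule F0)

abbreviation "P0 \<equiv> obs_law a0 b0 F0"

definition Ka where "Ka = 1 / \<epsilon>0"

lemma a0_pos: "a0 z > 0"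
  using ab[of z] \<epsilon>0 by (metis less_le_trans zero_less_divide_1_iff)

lemma a0_bounds: "1 \<le> a0 z" "a0 z \<le> Ka"
proof -
  have "1 / a0 z \<le> 1" using ab[of z] \<epsilon>0 by linarith
  then show "1 \<le> a0 z" using a0_pos[of z] by (simp add: field_simps)
  show "a0 z \<le> Ka" using ab[of z] \<epsilon>0 a0_pos[of z] by (simp add: field_simps Ka_def)
qed

lemma Ka_ge: "Ka \<ge> 1" using a0_bounds[of undefined] by linarith

lemma b0_bounds: "0 < b0 z" "b0 z < 1" "0 \<le> b0 z" "b0 z \<le> 1"
  using ab[of z] \<epsilon>0 by auto

lemma sets_P0[simp, measurable_cong]: "sets P0 = sets obs_space"
  by (simp add: obs_law_def)

lemma space_obs[simp]: "space (obs_space :: 'z obs measure) = UNIV"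
  by (simp add: obs_space_def space_pair_measure)

lemma fst_obs[measurable]: "fst \<in> borel_measurable (obs_space :: 'z obs measure)"
  unfolding obs_space_def by measurable

lemma ennreal_weights:
  fixes \<phi> :: ennreal
  assumes "p1 \<ge> 0" "p2 \<ge> 0" "p3 \<ge> 0" "p4 \<ge> 0" "A \<ge> 0" "B \<ge> 0" "p1 * A + p2 * A + (p3 * B + p4 * B) = 1"
  shows "ennreal p1 * (ennreal A * \<phi>) + ennreal p2 * (ennreal A * \<phi>) + (ennreal p3 * (ennreal B * \<phi>) + ennreal p4 * (ennreal B * \<phi>)) = \<phi>"
proof -
  have "ennreal p1 * ennreal A + ennreal p2 * ennreal A + (ennreal p3 * ennreal B + ennreal p4 * ennreal B)
      = ennreal (p1 * A + p2 * A + (p3 * B + p4 * B))"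
    using assms(1-6) by (simp only: ennreal_mult[symmetric] ennreal_plus[symmetric] mult_nonneg_nonneg add_nonneg_nonneg)
  then have "(ennreal p1 * ennreal A + ennreal p2 * ennreal A + (ennreal p3 * ennreal B + ennreal p4 * ennreal B)) * \<phi> = \<phi>"
    using assms(7) by simp
  then show ?thesis by (simp only: distrib_right mult.assoc)
qed

text \<open>Given Z, the variable R a0(Z) has mean 1, so the weight has conditional mean 1, and |s|
  \<le> 1 / Ka keeps it nonnegative. At \<open>s = 0\<close> this identifies the law of Z; at
  \<open>s = 1 / Ka\<close> and its negative it is the hypothesis of the multiplier
  inequality.\<close>

lemma nn_integral_weight_fst:
  assumes \<phi>[measurable]: "\<phi> \<in> borel_measurable borel" and s: "\<bar>s\<bar> \<le> 1 / Ka"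
  shows "(\<integral>\<^sup>+w. ennreal (1 + s * (of_bool (fst (snd w)) * a0 (fst w) - 1)) * \<phi> (fst w) \<partial>P0) = (\<integral>\<^sup>+z. \<phi> z \<partial>F0)"
proof -
  have [measurable]: "(\<lambda>w. ennreal (1 + s * (of_bool (fst (snd w)) * a0 (fst w) - 1)) * \<phi> (fst w)) \<in> borel_measurable (obs_space :: 'z obs measure)"
    unfolding obs_space_def by measurable
  show ?thesis
  proof (subst nn_integral_obs_law[OF a0 b0 F0 sF0], measurable, intro nn_integral_cong)
    fix z
    have K: "Ka > 0" using Ka_ge by linarith
    have p: "0 \<le> 1 + s * (a0 z - 1)" "0 \<le> 1 - s"
    proof -
      have "\<bar>s * (a0 z - 1)\<bar> \<le> 1 / Ka * Ka"
        unfolding abs_mult using s a0_bounds[of z] K by (intro mult_mono) auto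
      then show "0 \<le> 1 + s * (a0 z - 1)" using K by simp
      have "1 / Ka \<le> 1" using Ka_ge by simp
      then show "0 \<le> 1 - s" using s by linarith
    qed
    have i: "0 \<le> 1 / a0 z" "0 \<le> 1 - 1 / a0 z" "0 \<le> b0 z" "0 \<le> 1 - b0 z" using ab[of z] \<epsilon>0 by linarith+
    have "1 / a0 z * b0 z * (1 + s * (a0 z - 1)) + 1 / a0 z * (1 - b0 z) * (1 + s * (a0 z - 1)) +
       ((1 - 1 / a0 z) * b0 z * (1 - s) + (1 - 1 / a0 z) * (1 - b0 z) * (1 - s)) = 1"
      using a0_pos[of z] by (simp add: field_simps)
    then show "ennreal (1 / a0 z * b0 z) * (ennreal (1 + s * (of_bool (fst (snd (z, True, True))) * a0 (fst (z, True, True)) - 1)) * \<phi> (fst (z, True, True))) +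
           ennreal (1 / a0 z * (1 - b0 z)) * (ennreal (1 + s * (of_bool (fst (snd (z, True, False))) * a0 (fst (z, True, False)) - 1)) * \<phi> (fst (z, True, False))) +
           (ennreal ((1 - 1 / a0 z) * b0 z) * (ennreal (1 + s * (of_bool (fst (snd (z, False, False))) * a0 (fst (z, False, False)) - 1)) * \<phi> (fst (z, False, False))) +
            ennreal ((1 - 1 / a0 z) * (1 - b0 z)) * (ennreal (1 + s * (of_bool (fst (snd (z, False, False))) * a0 (fst (z, False, False)) - 1)) * \<phi> (fst (z, False, False)))) = \<phi> z"
      using ennreal_weights[OF _ _ _ _ p(1) p(2), of "1 / a0 z * b0 z" "1 / a0 z * (1 - b0 z)" "(1 - 1 / a0 z) * b0 z" "(1 - 1 / a0 z) * (1 - b0 z)" "\<phi> z"] i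
      by (simp only: fst_conv snd_conv of_bool_eq mult_1 mult_zero_left diff_0 mult_minus1_right add_uminus_conv_diff mult_nonneg_nonneg)
  qed
qed

lemma prob_space_P0: "prob_space P0"
proof (rule prob_spaceI)
  have "(\<integral>\<^sup>+w. 1 \<partial>P0) = (\<integral>\<^sup>+z. 1 \<partial>F0)"
    using nn_integral_weight_fst[of "\<lambda>_. 1" 0] Ka_ge by simp
  then show "emeasure P0 (space P0) = 1" by (simp add: F0.emeasure_space_1)
qed

sublocale P0: prob_space P0 by (rule prob_space_P0)

lemma fst_P0: "fst \<in> measurable P0 F0"
  unfolding measurable_cong_sets[OF sets_P0 sF0] by (rule fst_obs)

lemma distr_P0_fst: "distr P0 F0 fst = F0"
proof (rule measure_eqI)
  fix A assume "A \<in> sets (distr P0 F0 fst)"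
  then have A[measurable]: "A \<in> sets borel" by (simp add: sF0)
  have "emeasure (distr P0 F0 fst) A = (\<integral>\<^sup>+w. indicator A (fst w) \<partial>P0)"
    using A nn_integral_distr[OF fst_P0, of "indicator A"] by (simp add: sF0)
  also have "\<dots> = (\<integral>\<^sup>+z. indicator A z \<partial>F0)"
    using nn_integral_weight_fst[of "indicator A" 0] Ka_ge by simp
  finally show "emeasure (distr P0 F0 fst) A = emeasure F0 A" using A by (simp add: sF0)
qed simp

lemma integral_P0_fst:
  fixes \<phi> :: "'z \<Rightarrow> real"
  assumes "\<phi> \<in> borel_measurable borel" shows "(\<integral>w. \<phi> (fst w) \<partial>P0) = (\<integral>z. \<phi> z \<partial>F0)"
  using integral_distr[OF fst_P0, of \<phi>] assms unfolding distr_P0_fst by (simp add: measurable_cong_sets[OF sF0 refl])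

lemma AE_support: "AE w in P0. snd (snd w) \<longrightarrow> fst (snd w)"
proof -
  have m[measurable]: "Measurable.pred (obs_space :: 'z obs measure) (\<lambda>w. snd (snd w) \<longrightarrow> fst (snd w))"
    unfolding obs_space_def by measurable
  have mm: "(\<lambda>(z, r, y). (z, r, r \<and> y)) \<in> measurable (full_law a0 b0 F0) (obs_space :: 'z obs measure)"
    unfolding full_law_def obs_space_def by measurable
  show ?thesis unfolding obs_law_def using m
    by (subst AE_distr_iff[OF mm]) (auto simp: pred_def)
qed

text \<open>\<open>V1\<close> is the part of the limiting variance that stems from the posterior of
  \<eta>, and \<open>V2\<close> the part that stems from the posterior of F.\<close>

definition V1 where "V1 = (\<integral>z. a0 z * b0 z * (1 - b0 z) \<partial>F0)"

definition V2 where "V2 = (\<integral>z. (b0 z - chi b0 F0)\<^sup>2 \<partial>F0)"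

lemma integral_P0_nonneg:
  assumes h[measurable]: "h \<in> borel_measurable obs_space" and h0: "\<And>w. 0 \<le> (h w :: real)"
    and eq: "\<And>z. 1 / a0 z * b0 z * h (z, True, True) + 1 / a0 z * (1 - b0 z) * h (z, True, False) + (1 - 1 / a0 z) * h (z, False, False) = k z"
    and k[measurable]: "k \<in> borel_measurable borel" and kB: "\<And>z. k z \<le> B"
  shows "(\<integral>w. h w \<partial>P0) = (\<integral>z. k z \<partial>F0)"
proof -
  have i: "0 \<le> 1 / a0 z" "0 \<le> 1 - 1 / a0 z" "0 \<le> b0 z" "0 \<le> 1 - b0 z" for z using ab[of z] \<epsilon>0 by linarith+
  have k0: "0 \<le> k z" for z unfolding eq[of z, symmetric] using i[of z] h0 by (intro add_nonneg_nonneg mult_nonneg_nonneg) auto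
  have "(\<integral>\<^sup>+w. ennreal (h w) \<partial>P0) = (\<integral>\<^sup>+z. ennreal (k z) \<partial>F0)"
  proof (subst nn_integral_obs_law[OF a0 b0 F0 sF0], measurable, intro nn_integral_cong)
    fix z
    have "k z = 1 / a0 z * b0 z * h (z, True, True) + 1 / a0 z * (1 - b0 z) * h (z, True, False) +
       ((1 - 1 / a0 z) * b0 z * h (z, False, False) + (1 - 1 / a0 z) * (1 - b0 z) * h (z, False, False))"
    proof -
      have "(1 - p) * h (z, False, False) = (1 - p) * b0 z * h (z, False, False) + (1 - p) * (1 - b0 z) * h (z, False, False)" for p
        by (simp add: algebra_simps)
      then show ?thesis unfolding eq[symmetric] by simp
    qed
    then show "ennreal (1 / a0 z * b0 z) * ennreal (h (z, True, True)) + ennreal (1 / a0 z * (1 - b0 z)) * ennreal (h (z, True, False)) +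
       (ennreal ((1 - 1 / a0 z) * b0 z) * ennreal (h (z, False, False)) + ennreal ((1 - 1 / a0 z) * (1 - b0 z)) * ennreal (h (z, False, False))) = ennreal (k z)"
      using i[of z] h0 by (simp only: ennreal_mult[symmetric] ennreal_plus[symmetric] mult_nonneg_nonneg add_nonneg_nonneg)
  qed
  then show ?thesis using h0 k0 by (subst (1 2) integral_eq_nn_integral) auto
qed

text \<open>The second-order term of the log-likelihood along \<open>a0\<close> averages this
  function over the sample, so the observed information tends to \<open>V1\<close>.\<close>

lemma V1_P0: "(\<integral>w. of_bool (fst (snd w)) * (a0 (fst w))\<^sup>2 * b0 (fst w) * (1 - b0 (fst w)) \<partial>P0) = V1"
  unfolding V1_def
proof (rule integral_P0_nonneg)
  show "(\<lambda>w. of_bool (fst (snd w)) * (a0 (fst w))\<^sup>2 * b0 (fst w) * (1 - b0 (fst w))) \<in> borel_measurable (obs_space :: 'z obs measure)"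
    unfolding obs_space_def by measurable
  show "a0 z * b0 z * (1 - b0 z) \<le> Ka * 1 * 1" for z
    using a0_bounds[of z] b0_bounds[of z] Ka_ge a0_pos[of z] by (intro mult_mono) auto
  show "1 / a0 z * b0 z * (of_bool (fst (snd (z, True, True))) * (a0 (fst (z, True, True)))\<^sup>2 * b0 (fst (z, True, True)) * (1 - b0 (fst (z, True, True)))) +
         1 / a0 z * (1 - b0 z) * (of_bool (fst (snd (z, True, False))) * (a0 (fst (z, True, False)))\<^sup>2 * b0 (fst (z, True, False)) * (1 - b0 (fst (z, True, False)))) +
         (1 - 1 / a0 z) * (of_bool (fst (snd (z, False, False))) * (a0 (fst (z, False, False)))\<^sup>2 * b0 (fst (z, False, False)) * (1 - b0 (fst (z, False, False)))) =
         a0 z * b0 z * (1 - b0 z)" for z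
    using a0_pos[of z] by (simp add: field_simps power2_eq_square)
qed (use b0_bounds in \<open>auto intro!: mult_nonneg_nonneg\<close>)

lemma chi_bounds: "0 \<le> chi b0 F0" "chi b0 F0 \<le> 1"
proof -
  have "integrable F0 b0" using b0_bounds by (intro F0.integrable_const_bound[where B=1]) auto
  then show "0 \<le> chi b0 F0" "chi b0 F0 \<le> 1"
    unfolding chi_def using b0_bounds by (auto intro!: integral_nonneg F0.integral_le_const)
qed

text \<open>Given Z, the residual R (Y - b0(Z)) has mean zero, so the cross term in the square
  vanishes.\<close>

lemma eff_var_eq: "eff_var a0 b0 F0 = V1 + V2"
proof -
  let ?\<chi> = "chi b0 F0"
  have b2: "(b0 z - ?\<chi>)\<^sup>2 \<le> 1" for z using b0_bounds[of z] chi_bounds by (intro abs_square_le_1[THEN iffD2]) auto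
  have k1: "a0 z * b0 z * (1 - b0 z) \<le> Ka * 1 * 1" for z
    using a0_bounds[of z] b0_bounds[of z] Ka_ge a0_pos[of z] by (intro mult_mono) auto
  have k0: "0 \<le> a0 z * b0 z * (1 - b0 z)" for z using a0_pos[of z] b0_bounds[of z] by auto
  have "eff_var a0 b0 F0 = (\<integral>z. a0 z * b0 z * (1 - b0 z) + (b0 z - ?\<chi>)\<^sup>2 \<partial>F0)"
    unfolding eff_var_def
  proof (rule integral_P0_nonneg)
    show "(\<lambda>w. (influence a0 b0 F0 w)\<^sup>2) \<in> borel_measurable (obs_space :: 'z obs measure)"
      unfolding influence_def obs_space_def by measurable
    show "a0 z * b0 z * (1 - b0 z) + (b0 z - ?\<chi>)\<^sup>2 \<le> Ka + 1" for z using k1[of z] b2[of z] by simp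
    fix z
    \<comment> \<open>Naming the reciprocal \<open>p\<close> makes the identity polynomial, up to
      \<open>a0 z * p = 1\<close>.\<close>
    have "a0 z * (1 / a0 z) = 1" using a0_pos[of z] by simp
    then obtain p where p: "1 / a0 z = p" "a0 z * p = 1" by auto
    have "p * b0 z * (a0 z * (1 - b0 z) + b0 z - ?\<chi>)\<^sup>2 + p * (1 - b0 z) * (a0 z * (0 - b0 z) + b0 z - ?\<chi>)\<^sup>2 + (1 - p) * (b0 z - ?\<chi>)\<^sup>2
      = (a0 z * p) * a0 z * b0 z * (1 - b0 z) + (b0 z - ?\<chi>)\<^sup>2"
      by (simp add: power2_eq_square algebra_simps)
    then show "1 / a0 z * b0 z * (influence a0 b0 F0 (z, True, True))\<^sup>2 + 1 / a0 z * (1 - b0 z) * (influence a0 b0 F0 (z, True, False))\<^sup>2 +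
       (1 - 1 / a0 z) * (influence a0 b0 F0 (z, False, False))\<^sup>2 = a0 z * b0 z * (1 - b0 z) + (b0 z - ?\<chi>)\<^sup>2"
      unfolding p by (simp add: influence_def p(2))
  qed auto
  also have "\<dots> = V1 + V2" unfolding V1_def V2_def
  proof (rule Bochner_Integration.integral_add)
    show "integrable F0 (\<lambda>z. a0 z * b0 z * (1 - b0 z))" using k0 k1 by (intro F0.integrable_const_bound[where B=Ka]) auto
    show "integrable F0 (\<lambda>z. (b0 z - ?\<chi>)\<^sup>2)" using b2 by (intro F0.integrable_const_bound[where B=1]) auto
  qed
  finally show ?thesis .
qed

text \<open>Guarantees that the limit is a genuine normal law even if \<open>V2\<close> is
  0.\<close>

lemma V1_pos: "V1 > 0"
proof -
  have le: "\<epsilon>0 * \<epsilon>0 \<le> a0 z * b0 z * (1 - b0 z)" for z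
  proof -
    have "1 * \<epsilon>0 * \<epsilon>0 \<le> a0 z * b0 z * (1 - b0 z)" using a0_bounds[of z] ab[of z] \<epsilon>0 b0_bounds[of z] by (intro mult_mono) auto
    then show ?thesis by simp
  qed
  have k0: "0 \<le> a0 z * b0 z * (1 - b0 z)" for z using a0_pos[of z] b0_bounds[of z] by auto
  have "a0 z * b0 z * (1 - b0 z) \<le> Ka * 1 * 1" for z
    using a0_bounds[of z] b0_bounds[of z] Ka_ge a0_pos[of z] by (intro mult_mono) auto
  then have "integrable F0 (\<lambda>z. a0 z * b0 z * (1 - b0 z))"
    using k0 by (intro F0.integrable_const_bound[where B=Ka]) auto
  then have "\<epsilon>0 * \<epsilon>0 \<le> V1" unfolding V1_def using le by (intro F0.integral_ge_const) auto
  then show ?thesis using \<epsilon>0 by (smt (verit) mult_pos_pos)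
qed

lemma V2_eq: "V2 = (\<integral>z. (b0 z)\<^sup>2 \<partial>F0) - (chi b0 F0)\<^sup>2" and V2_nonneg: "V2 \<ge> 0"
proof -
  define c where "c = chi b0 F0"
  have c: "(\<integral>z. b0 z \<partial>F0) = c" by (simp add: c_def chi_def)
  have "integrable F0 b0" using b0_bounds by (intro F0.integrable_const_bound[where B=1]) auto
  moreover have "integrable F0 (\<lambda>z. (b0 z)\<^sup>2)"
    using b0_bounds by (intro F0.integrable_const_bound[where B=1]) (auto simp: abs_square_le_1)
  moreover have "(\<lambda>z. (b0 z - c)\<^sup>2) = (\<lambda>z. (b0 z)\<^sup>2 - 2 * c * b0 z + c\<^sup>2)"
    by (auto simp: power2_eq_square algebra_simps)
  ultimately show "V2 = (\<integral>z. (b0 z)\<^sup>2 \<partial>F0) - (chi b0 F0)\<^sup>2"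
    unfolding V2_def c_def[symmetric] by (simp add: F0.prob_space c) (simp add: power2_eq_square)
qed (simp add: V2_def)

end

section \<open>Local expansion of the likelihood\<close>

text \<open>The log-partition function of the Bernoulli family in its logit parameter; its
  derivative is \<open>Psi\<close>.\<close>

definition softplus :: "real \<Rightarrow> real" where
  "softplus x = ln (1 + exp x)"

lemma Psi_softplus: "Psi x = exp (x - softplus x)" "1 - Psi x = exp (- softplus x)"
proof -
  have p: "1 + exp x > 0" by (simp add: add_pos_pos)
  then show "Psi x = exp (x - softplus x)"
    by (simp add: Psi_def softplus_def exp_diff exp_minus field_simps)
  show "1 - Psi x = exp (- softplus x)"
    using p by (simp add: Psi_def softplus_def exp_minus field_simps)
qed

lemma Psi_bounds: "0 < Psi x" "Psi x < 1"
  by (simp_all add: Psi_def add_pos_pos)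

lemma softplus_deriv: "(softplus has_real_derivative Psi x) (at x)"
proof -
  have "1 + exp x > 0" by (simp add: add_pos_pos)
  then show ?thesis unfolding softplus_def Psi_def
    by (auto intro!: derivative_eq_intros simp: exp_minus field_simps)
qed

lemma Psi_deriv: "(Psi has_real_derivative Psi x * (1 - Psi x)) (at x)"
proof -
  have "1 + exp (- x) > 0" by (simp add: add_pos_pos)
  then show ?thesis unfolding Psi_def
    by (auto intro!: derivative_eq_intros simp: field_simps power2_eq_square)
qed

text \<open>The third derivative is Psi (1 - Psi) (1 - 2 Psi), bounded by 1 on the whole line. The
  remainder is therefore uniform in \<open>x\<close>, however large the functions charged by the
  prior may be.\<close>

lemma softplus_taylor:
  "\<bar>softplus x - softplus (x - d) - (d * Psi x - d\<^sup>2 / 2 * (Psi x * (1 - Psi x)))\<bar> \<le> \<bar>d\<bar> ^ 3"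
proof (cases "d = 0")
  case False
  define D where "D m = (if m = 0 then softplus else if m = 1 then Psi else if m = 2 then (\<lambda>x. Psi x * (1 - Psi x))
      else (\<lambda>x. Psi x * (1 - Psi x) * (1 - 2 * Psi x)))" for m :: nat
  have der: "DERIV (D m) t :> D (Suc m) t" if "m < 3" for m t
  proof -
    consider "m = 0" | "m = 1" | "m = 2" using \<open>m < 3\<close> by linarith
    then show ?thesis
    proof cases
      case 3
      show ?thesis unfolding D_def using 3
        by (auto intro!: derivative_eq_intros Psi_deriv simp: algebra_simps)
    qed (auto simp: D_def intro: softplus_deriv Psi_deriv)
  qed
  have "\<exists>t. (if x - d < x then x - d < t \<and> t < x else x < t \<and> t < x - d) \<and>
     softplus (x - d) = (\<Sum>m<3. D m x / fact m * (x - d - x) ^ m) + D 3 t / fact 3 * (x - d - x) ^ 3"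
    by (rule Taylor[of 3 D softplus "min x (x - d)" "max x (x - d)"]) (use der False in \<open>auto simp: D_def\<close>)
  then obtain t where t: "softplus (x - d) = (\<Sum>m<3. D m x / fact m * (x - d - x) ^ m) + D 3 t / fact 3 * (x - d - x) ^ 3"
    by blast
  have s: "(\<Sum>m<3. D m x / fact m * (x - d - x) ^ m) = softplus x - d * Psi x + d\<^sup>2 / 2 * (Psi x * (1 - Psi x))"
    by (simp add: eval_nat_numeral D_def)
  have "\<bar>D 3 t\<bar> \<le> 1"
  proof -
    have "\<bar>Psi t * (1 - Psi t) * (1 - 2 * Psi t)\<bar> \<le> 1 * 1 * 1"
      unfolding abs_mult using Psi_bounds[of t] by (intro mult_mono) auto
    then show ?thesis by (simp add: D_def)
  qed
  have "\<bar>softplus x - softplus (x - d) - (d * Psi x - d\<^sup>2 / 2 * (Psi x * (1 - Psi x)))\<bar> = \<bar>D 3 t\<bar> / fact 3 * \<bar>d\<bar> ^ 3"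
    unfolding t s by (simp add: abs_mult power_abs)
  also have "\<dots> \<le> 1 * \<bar>d\<bar> ^ 3"
    using \<open>\<bar>D 3 t\<bar> \<le> 1\<close> by (intro mult_right_mono) (auto simp: fact_numeral)
  finally show ?thesis by simp
qed simp

text \<open>Values in (0, 1] make prior integrals of the likelihood finite and the normalising
  constant positive, for an arbitrary prior.\<close>

lemma likelihood_pos: "0 < likelihood n x \<eta>" and likelihood_le_1: "likelihood n x \<eta> \<le> 1"
proof -
  have 1: "1 / a_of \<eta> z = Psi (fst \<eta> z)" for z by (simp add: a_of_def)
  have *: "0 < cond_density (a_of \<eta>) (b_of \<eta>) w \<and> cond_density (a_of \<eta>) (b_of \<eta>) w \<le> 1" for w
    using Psi_bounds unfolding cond_density_def 1 b_of_def
    by (auto simp: split_beta' less_imp_le intro!: mult_pos_pos zero_less_power mult_le_one power_le_one)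
  show "0 < likelihood n x \<eta>" unfolding likelihood_def using * by (intro prod_pos) auto
  show "likelihood n x \<eta> \<le> 1" unfolding likelihood_def using * by (intro prod_le_1) (auto simp: less_imp_le)
qed

text \<open>The shift leaves the factor of R untouched and tilts the Bernoulli factor exponentially.
  The premise excludes \<open>ry\<close> without \<open>r\<close>, where the truncated exponent
  would no longer be the intended one.\<close>

lemma cond_density_shift:
  assumes "ry \<longrightarrow> r"
  shows "cond_density A (\<lambda>z. Psi (e z)) (z, r, ry) = cond_density A (\<lambda>z. Psi (e z - d z)) (z, r, ry) *
    exp (of_bool ry * d z - of_bool r * (softplus (e z) - softplus (e z - d z)))"
proof -
  consider "r" "ry" | "r" "\<not> ry" | "\<not> r" "\<not> ry" using assms by auto
  then show ?thesis
  proof cases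
    case 1
    then show ?thesis by (simp add: cond_density_def Psi_softplus(1) exp_add[symmetric] mult.assoc)
  next
    case 2
    then show ?thesis by (simp add: cond_density_def Psi_softplus(2) exp_add[symmetric] mult.assoc)
  next
    case 3
    then show ?thesis by (simp add: cond_density_def)
  qed
qed

text \<open>With \<open>I\<close> the uncentred influence function, the first-order contributions
  are \<open>b - I\<close> from the functional and \<open>a0 * (y - r * b)\<close> from the score.
  They add up to \<open>- ((r * a0 - 1) * (b - b0))\<close>: the outcomes drop out, and only the
  multiplier process remains.\<close>

lemma (in causal_model) tilted_likelihood:
  fixes x :: "nat \<Rightarrow> 'z obs" and \<eta> :: "'z eta"
  defines "z i \<equiv> fst (x i)" and "r i \<equiv> of_bool (fst (snd (x i))) :: real" and "b \<equiv> b_of \<eta>"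
  assumes n: "n \<ge> 1" and supp: "\<And>i. i < n \<Longrightarrow> snd (snd (x i)) \<longrightarrow> fst (snd (x i))" and \<kappa>: "\<kappa> > 0"
    and c: "\<bar>sqrt n * (c - (chi b0 F0 + (\<Sum>i<n. influence a0 b0 F0 (x i)) / n))\<bar> \<le> \<kappa>"
    and W: "\<bar>\<Sum>i<n. (r i * a0 (z i) - 1) * (b (z i) - b0 (z i))\<bar> \<le> \<kappa> * sqrt n"
    and sq: "(\<Sum>i<n. (b (z i) - b0 (z i))\<^sup>2) / n \<le> \<kappa>\<^sup>2"
    and V: "\<bar>(\<Sum>i<n. r i * (a0 (z i))\<^sup>2 * b0 (z i) * (1 - b0 (z i))) / n - V1\<bar> \<le> \<kappa>"
  obtains q where "likelihood n x \<eta> = likelihood n x (eta_shift a0 n t \<eta>) * exp q"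
    "\<bar>t * (sqrt n * ((\<Sum>i<n. b (z i)) / n - c)) + q - t\<^sup>2 * V1 / 2\<bar> \<le> \<kappa> * (2 * \<bar>t\<bar> + t\<^sup>2 * (Ka\<^sup>2 + 1) / 2) + \<bar>t\<bar> ^ 3 * Ka ^ 3 / sqrt n"
proof
  define s where "s = t / sqrt n"
  define y where "y i = (of_bool (snd (snd (x i))) :: real)" for i
  define d where "d i = s * a0 (z i)" for i
  define e where "e i = snd \<eta> (z i)" for i
  define q where "q = (\<Sum>i<n. y i * d i - r i * (softplus (e i) - softplus (e i - d i)))"
  have sn: "sqrt n > 0" "sqrt n * sqrt n = n" using n by auto
  have bb: "b (z i) = Psi (e i)" for i by (simp add: b_def b_of_def e_def)
  show "likelihood n x \<eta> = likelihood n x (eta_shift a0 n t \<eta>) * exp q"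
  proof -
    have "cond_density (a_of \<eta>) (b_of \<eta>) (x i) = cond_density (a_of (eta_shift a0 n t \<eta>)) (b_of (eta_shift a0 n t \<eta>)) (x i) *
       exp (y i * d i - r i * (softplus (e i) - softplus (e i - d i)))" if "i < n" for i
    proof -
      obtain z' r' y' where xi: "x i = (z', r', y')" by (metis prod_cases3)
      have ff: "a_of (eta_shift a0 n t \<eta>) = a_of \<eta>" "b_of (eta_shift a0 n t \<eta>) = (\<lambda>z. Psi (snd \<eta> z - s * a0 z))"
        by (auto simp: fun_eq_iff a_of_def b_of_def eta_shift_def s_def)
      have "y' \<longrightarrow> r'" using supp[OF that] xi by simp
      from cond_density_shift[OF this, of "a_of \<eta>" "snd \<eta>" z' "\<lambda>z. s * a0 z"] show ?thesis
        unfolding ff b_of_def by (simp add: xi y_def r_def d_def e_def z_def)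
    qed
    then show ?thesis unfolding likelihood_def q_def by (simp add: exp_sum prod.distrib)
  qed
  define rem where "rem i = softplus (e i) - softplus (e i - d i) - (d i * Psi (e i) - (d i)\<^sup>2 / 2 * (Psi (e i) * (1 - Psi (e i))))" for i
  have remb: "\<bar>\<Sum>i<n. r i * rem i\<bar> \<le> \<bar>t\<bar> ^ 3 * Ka ^ 3 / sqrt n"
  proof -
    have "\<bar>\<Sum>i<n. r i * rem i\<bar> \<le> (\<Sum>i<n. \<bar>s\<bar> ^ 3 * Ka ^ 3)"
    proof (intro order.trans[OF sum_abs] sum_mono)
      fix i
      have "\<bar>r i * rem i\<bar> \<le> 1 * \<bar>d i\<bar> ^ 3"
        unfolding abs_mult rem_def by (intro mult_mono softplus_taylor) (auto simp: r_def)
      also have "\<bar>d i\<bar> ^ 3 \<le> (\<bar>s\<bar> * Ka) ^ 3"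
        unfolding d_def abs_mult using a0_bounds[of "z i"] by (intro power_mono mult_left_mono) auto
      finally show "\<bar>r i * rem i\<bar> \<le> \<bar>s\<bar> ^ 3 * Ka ^ 3" by (simp add: power_mult_distrib)
    qed
    also have "\<dots> = \<bar>t\<bar> ^ 3 * Ka ^ 3 / sqrt n"
      using sn n by (simp add: s_def power_divide power3_eq_cube)
    finally show ?thesis .
  qed
  define g where "g i = b (z i) - b0 (z i)" for i
  define I where "I i = a0 (z i) * (y i - r i * b0 (z i)) + b0 (z i)" for i
  have cI: "chi b0 F0 + (\<Sum>i<n. influence a0 b0 F0 (x i)) / n = (\<Sum>i<n. I i) / n"
  proof -
    have "influence a0 b0 F0 (x i) = I i - chi b0 F0" for i
      by (simp add: influence_def I_def y_def r_def z_def split_beta')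
    then show ?thesis using n by (simp add: sum_subtractf diff_divide_distrib)
  qed
  define ee where "ee = sqrt n * (c - (\<Sum>i<n. I i) / n)"
  have eeb: "\<bar>ee\<bar> \<le> \<kappa>" using c unfolding cI ee_def .
  define WW where "WW = (\<Sum>i<n. (r i * a0 (z i) - 1) * g i)"
  define VV where "VV = (\<Sum>i<n. r i * (a0 (z i))\<^sup>2 * (b (z i) * (1 - b (z i)))) / n"
  have tU: "t * (sqrt n * ((\<Sum>i<n. b (z i)) / n - c)) = s * (\<Sum>i<n. b (z i) - I i) - t * ee"
  proof -
    have "sqrt n / n = 1 / sqrt n" using sn n by (simp add: field_simps)
    then have sX: "s * X = t * (sqrt n * (X / n))" for X unfolding s_def by (metis times_divide_eq_right times_divide_eq_left mult.assoc mult_1)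
    show ?thesis by (simp only: ee_def sum_subtractf right_diff_distrib sX)
  qed
  have qe: "q = s * (\<Sum>i<n. a0 (z i) * (y i - r i * b (z i))) + t\<^sup>2 / 2 * VV - (\<Sum>i<n. r i * rem i)"
  proof -
    have "t\<^sup>2 / 2 * VV = (\<Sum>i<n. r i * ((d i)\<^sup>2 / 2 * (Psi (e i) * (1 - Psi (e i)))))"
      using n by (simp add: VV_def d_def s_def bb power_mult_distrib power_divide sum_distrib_left sum_divide_distrib mult_ac)
    moreover have "s * (\<Sum>i<n. a0 (z i) * (y i - r i * b (z i))) = (\<Sum>i<n. y i * d i - r i * (d i * Psi (e i)))"
      by (simp add: sum_distrib_left d_def bb algebra_simps)
    moreover have "q = (\<Sum>i<n. (y i * d i - r i * (d i * Psi (e i))) + r i * ((d i)\<^sup>2 / 2 * (Psi (e i) * (1 - Psi (e i)))) - r i * rem i)"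
      unfolding q_def rem_def by (intro sum.cong refl) (simp add: algebra_simps)
    ultimately show ?thesis by (simp only: sum.distrib sum_subtractf)
  qed
  have main: "s * (\<Sum>i<n. b (z i) - I i) + s * (\<Sum>i<n. a0 (z i) * (y i - r i * b (z i))) = - (s * WW)"
    unfolding WW_def g_def I_def by (simp add: sum_distrib_left sum.distrib[symmetric] sum_negf[symmetric] algebra_simps sum_subtractf[symmetric])
  have b1: "\<bar>s * WW\<bar> \<le> \<bar>t\<bar> * \<kappa>"
  proof -
    have "\<bar>s * WW\<bar> \<le> \<bar>s\<bar> * (\<kappa> * sqrt n)" unfolding abs_mult using W by (intro mult_left_mono) (auto simp: WW_def g_def)
    then show ?thesis using sn by (simp add: s_def)
  qed
  have b2: "\<bar>t * ee\<bar> \<le> \<bar>t\<bar> * \<kappa>" unfolding abs_mult using eeb by (intro mult_left_mono) auto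
  have b3: "\<bar>VV - V1\<bar> \<le> \<kappa> * (Ka\<^sup>2 + 1)"
  proof -
    have "\<bar>VV - (\<Sum>i<n. r i * (a0 (z i))\<^sup>2 * b0 (z i) * (1 - b0 (z i))) / n\<bar> = \<bar>\<Sum>i<n. r i * (a0 (z i))\<^sup>2 * (g i * (1 - b (z i) - b0 (z i)))\<bar> / n"
      unfolding VV_def g_def diff_divide_distrib[symmetric] sum_subtractf[symmetric] abs_divide
      by (simp add: algebra_simps)
    also have "\<bar>\<Sum>i<n. r i * (a0 (z i))\<^sup>2 * (g i * (1 - b (z i) - b0 (z i)))\<bar> / n \<le> (\<Sum>i<n. Ka\<^sup>2 * ((\<kappa> + (g i)\<^sup>2 / \<kappa>) / 2)) / n"
    proof (intro divide_right_mono order.trans[OF sum_abs] sum_mono)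
      fix i
      \<comment> \<open>Young's inequality turns the available mean square, at most \<kappa>^2, into
        a mean absolute error of at most \<kappa>.\<close>
      have "2 * \<bar>g i\<bar> * \<kappa> \<le> \<bar>g i\<bar>\<^sup>2 + \<kappa>\<^sup>2" by (rule sum_squares_bound)
      then have g1: "\<bar>g i\<bar> \<le> (\<kappa> + (g i)\<^sup>2 / \<kappa>) / 2" using \<kappa> by (simp add: field_simps power2_eq_square)
      have "\<bar>1 - b (z i) - b0 (z i)\<bar> \<le> 1" using Psi_bounds[of "e i"] b0_bounds[of "z i"] by (auto simp: bb)
      then have "\<bar>g i * (1 - b (z i) - b0 (z i))\<bar> \<le> \<bar>g i\<bar> * 1" unfolding abs_mult by (intro mult_left_mono) auto
      with g1 have g2: "\<bar>g i * (1 - b (z i) - b0 (z i))\<bar> \<le> (\<kappa> + (g i)\<^sup>2 / \<kappa>) / 2" by simp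
      have "\<bar>r i * (a0 (z i))\<^sup>2\<bar> \<le> 1 * Ka\<^sup>2" unfolding abs_mult
        using a0_bounds[of "z i"] by (intro mult_mono) (auto simp: r_def intro!: power_mono)
      with g2 show "\<bar>r i * (a0 (z i))\<^sup>2 * (g i * (1 - b (z i) - b0 (z i)))\<bar> \<le> Ka\<^sup>2 * ((\<kappa> + (g i)\<^sup>2 / \<kappa>) / 2)"
        unfolding abs_mult[of "r i * (a0 (z i))\<^sup>2"] by (intro mult_mono) auto
    qed auto
    also have "(\<Sum>i<n. Ka\<^sup>2 * ((\<kappa> + (g i)\<^sup>2 / \<kappa>) / 2)) / n = Ka\<^sup>2 * ((\<kappa> + ((\<Sum>i<n. (g i)\<^sup>2) / n) / \<kappa>) / 2)"
    proof -
      have "(\<Sum>i<n. Ka\<^sup>2 * ((\<kappa> + (g i)\<^sup>2 / \<kappa>) / 2)) = Ka\<^sup>2 * ((n * \<kappa> + (\<Sum>i<n. (g i)\<^sup>2) / \<kappa>) / 2)"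
        by (simp add: sum_distrib_left[symmetric] sum.distrib sum_divide_distrib[symmetric])
      moreover have "Ka\<^sup>2 * ((n * \<kappa> + G / \<kappa>) / 2) / n = Ka\<^sup>2 * ((\<kappa> + G / n / \<kappa>) / 2)" for G
        using n by (simp add: add_divide_distrib distrib_left)
      ultimately show ?thesis by simp
    qed
    also have "\<dots> \<le> Ka\<^sup>2 * ((\<kappa> + \<kappa>\<^sup>2 / \<kappa>) / 2)"
      using sq \<kappa> by (intro mult_left_mono divide_right_mono add_left_mono) (auto simp: g_def)
    also have "\<dots> = Ka\<^sup>2 * \<kappa>" using \<kappa> by (simp add: power2_eq_square)
    finally show ?thesis using V by (simp add: algebra_simps)
  qed
  have b4: "\<bar>t\<^sup>2 / 2 * VV - t\<^sup>2 * V1 / 2\<bar> \<le> t\<^sup>2 / 2 * (\<kappa> * (Ka\<^sup>2 + 1))"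
  proof -
    have "t\<^sup>2 / 2 * VV - t\<^sup>2 * V1 / 2 = t\<^sup>2 / 2 * (VV - V1)" by (simp add: algebra_simps)
    then show ?thesis using b3 by (simp only: abs_mult) (intro mult_mono, auto)
  qed
  have "\<bar>t * (sqrt n * ((\<Sum>i<n. b (z i)) / n - c)) + q - t\<^sup>2 * V1 / 2\<bar>
    = \<bar>- (s * WW) - t * ee + (t\<^sup>2 / 2 * VV - t\<^sup>2 * V1 / 2) - (\<Sum>i<n. r i * rem i)\<bar>"
    unfolding tU qe main[symmetric] by (simp add: algebra_simps)
  \<comment> \<open>In this order: the multiplier process, the expansion error of \<open>c\<close>,
    the observed information and the Taylor remainder.\<close>
  also have "\<dots> \<le> \<bar>t\<bar> * \<kappa> + \<bar>t\<bar> * \<kappa> + t\<^sup>2 / 2 * (\<kappa> * (Ka\<^sup>2 + 1)) + \<bar>t\<bar> ^ 3 * Ka ^ 3 / sqrt n"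
    using b1 b2 b4 remb by linarith
  also have "\<dots> = \<kappa> * (2 * \<bar>t\<bar> + t\<^sup>2 * (Ka\<^sup>2 + 1) / 2) + \<bar>t\<bar> ^ 3 * Ka ^ 3 / sqrt n" by (simp add: algebra_simps)
  finally show "\<bar>t * (sqrt n * ((\<Sum>i<n. b (z i)) / n - c)) + q - t\<^sup>2 * V1 / 2\<bar> \<le> \<kappa> * (2 * \<bar>t\<bar> + t\<^sup>2 * (Ka\<^sup>2 + 1) / 2) + \<bar>t\<bar> ^ 3 * Ka ^ 3 / sqrt n" .
qed

section \<open>Sampling\<close>

locale causal_sample = causal_model a0 b0 F0 \<epsilon>0
  for a0 b0 :: "'z::topological_space \<Rightarrow> real" and F0 :: "'z measure" and \<epsilon>0 :: real +
  fixes M :: "'m measure" and X :: "nat \<Rightarrow> 'm \<Rightarrow> 'z obs"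
  assumes M: "prob_space M" and indep: "prob_space.indep_vars M (\<lambda>_. obs_space) X UNIV"
    and distr_X: "\<And>i. distr M obs_space (X i) = obs_law a0 b0 F0"
begin

sublocale M: prob_space M by (rule M)

lemma X_measurable[measurable]: "X i \<in> measurable M obs_space"
  using indep unfolding M.indep_vars_def by auto

text \<open>Cut off outside \<open>{..<n}\<close> because points of the product space are
  extensional functions.\<close>

definition sample :: "nat \<Rightarrow> 'm \<Rightarrow> nat \<Rightarrow> 'z obs" where
  "sample n \<omega> = (\<lambda>i\<in>{..<n}. X i \<omega>)"

lemma sets_PiM_P0: "sets (\<Pi>\<^sub>M i\<in>{..<n}. P0) = sets (\<Pi>\<^sub>M i\<in>{..<n}. obs_space)"
  by (intro sets_PiM_cong) auto

lemma sample_measurable: "sample n \<in> measurable M (\<Pi>\<^sub>M i\<in>{..<n}. P0)"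
  unfolding measurable_cong_sets[OF refl sets_PiM_P0] sample_def by measurable

lemma distr_sample:
  assumes "n \<ge> 1"
  shows "distr M (\<Pi>\<^sub>M i\<in>{..<n}. P0) (sample n) = (\<Pi>\<^sub>M i\<in>{..<n}. P0)"
proof -
  have "{..<n} \<noteq> {}" using assms by (simp add: lessThan_empty_iff)
  moreover have "M.indep_vars (\<lambda>_. obs_space) X {..<n}"
    using indep by (rule M.indep_vars_subset) auto
  ultimately have "distr M (\<Pi>\<^sub>M i\<in>{..<n}. obs_space) (\<lambda>x. \<lambda>i\<in>{..<n}. X i x) = (\<Pi>\<^sub>M i\<in>{..<n}. distr M obs_space (X i))"
    by (subst (asm) M.indep_vars_iff_distr_eq_PiM) auto
  moreover have "distr M (\<Pi>\<^sub>M i\<in>{..<n}. P0) (sample n) = distr M (\<Pi>\<^sub>M i\<in>{..<n}. obs_space) (\<lambda>x. \<lambda>i\<in>{..<n}. X i x)"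
    using sets_PiM_P0 by (intro distr_cong) (auto simp: sample_def[abs_def])
  ultimately show ?thesis by (simp add: distr_X)
qed

lemma nn_integral_sample:
  assumes "n \<ge> 1" "\<phi> \<in> borel_measurable (\<Pi>\<^sub>M i\<in>{..<n}. P0)"
  shows "(\<integral>\<^sup>+\<omega>. \<phi> (sample n \<omega>) \<partial>M) = (\<integral>\<^sup>+x. \<phi> x \<partial>(\<Pi>\<^sub>M i\<in>{..<n}. P0))"
  using nn_integral_distr[OF sample_measurable, of \<phi> n] assms distr_sample[OF assms(1)] by simp

lemma sample_fst:
  fixes n :: nat
  assumes "\<phi> \<in> borel_measurable (\<Pi>\<^sub>M i\<in>{..<n}. F0)"
  shows "(\<lambda>x. \<phi> (\<lambda>i\<in>{..<n}. fst (x i))) \<in> borel_measurable (\<Pi>\<^sub>M i\<in>{..<n}. P0)"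
    "(\<integral>\<^sup>+x. \<phi> (\<lambda>i\<in>{..<n}. fst (x i)) \<partial>(\<Pi>\<^sub>M i\<in>{..<n}. P0)) = (\<integral>\<^sup>+z. \<phi> z \<partial>(\<Pi>\<^sub>M i\<in>{..<n}. F0))"
proof -
  note [measurable] = fst_P0
  show "(\<lambda>x. \<phi> (\<lambda>i\<in>{..<n}. fst (x i))) \<in> borel_measurable (\<Pi>\<^sub>M i\<in>{..<n}. P0)"
    by (rule measurable_compose[OF _ assms]) measurable
  have "(\<integral>\<^sup>+x. (\<Prod>i\<in>{..<n}. 1) * \<phi> (\<lambda>i\<in>{..<n}. fst (x i)) \<partial>(\<Pi>\<^sub>M i\<in>{..<n}. P0)) = (\<integral>\<^sup>+z. \<phi> z \<partial>(\<Pi>\<^sub>M i\<in>{..<n}. F0))"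
  proof (rule weighted_product_integral[OF prob_space_P0 F0 fst_P0, where W="\<lambda>_ _. 1"])
    fix A assume A: "A \<in> sets F0"
    then have "(\<integral>\<^sup>+w. ennreal (1 + 0 * (of_bool (fst (snd w)) * a0 (fst w) - 1)) * indicator A (fst w) \<partial>P0) = (\<integral>\<^sup>+z. indicator A z \<partial>F0)"
      using Ka_ge by (intro nn_integral_weight_fst) (auto simp: sF0)
    then show "(\<integral>\<^sup>+x. 1 * indicator A (fst x) \<partial>P0) = emeasure F0 A" using A by simp
  qed (use assms in auto)
  then show "(\<integral>\<^sup>+x. \<phi> (\<lambda>i\<in>{..<n}. fst (x i)) \<partial>(\<Pi>\<^sub>M i\<in>{..<n}. P0)) = (\<integral>\<^sup>+z. \<phi> z \<partial>(\<Pi>\<^sub>M i\<in>{..<n}. F0))" by simp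
qed

text \<open>Chebyshev's inequality, with the variance read off from bounded differences of size
  \<open>2 * B / n\<close>.\<close>

lemma whp_lln:
  fixes h :: "'z obs \<Rightarrow> real"
  assumes h[measurable]: "h \<in> borel_measurable obs_space" and B: "\<And>w. \<bar>h w\<bar> \<le> B" and \<kappa>: "\<kappa> > 0"
  shows "whp M (\<lambda>n \<omega>. \<bar>(\<Sum>i<n. h (X i \<omega>)) / n - (\<integral>w. h w \<partial>P0)\<bar> \<le> \<kappa>)"
proof -
  define m where "m = (\<integral>w. h w \<partial>P0)"
  define f where "f n x = (\<Sum>i<n. h (x i)) / n" for n and x :: "nat \<Rightarrow> 'z obs"
  define Y where "Y n \<omega> = ennreal ((f n (\<lambda>i. X i \<omega>) - m)\<^sup>2)" for n \<omega>
  have fm: "f n \<in> borel_measurable (\<Pi>\<^sub>M i\<in>{..<n}. P0)" for n unfolding f_def by measurable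
  have hP: "h \<in> borel_measurable P0" by measurable
  have B0: "0 \<le> B" using B[of undefined] by linarith
  have hi: "integrable P0 h" using B by (intro P0.integrable_const_bound[where B=B]) auto
  have EY: "(\<integral>\<^sup>+\<omega>. Y n \<omega> \<partial>M) \<le> ennreal (4 * B\<^sup>2 / n)" if n: "n \<ge> 1" for n
  proof -
    let ?P = "\<Pi>\<^sub>M i\<in>{..<n}. P0"
    interpret PN: prob_space ?P by (intro prob_space_PiM prob_space_P0)
    interpret PP: product_prob_space "\<lambda>_. P0" "{..<n}" by (intro product_prob_spaceI prob_space_P0)
    note [measurable] = fm[of n]
    have fB: "\<bar>f n x\<bar> \<le> B" for x
    proof -
      have "\<bar>\<Sum>i<n. h (x i)\<bar> \<le> (\<Sum>i<n. B)" by (intro order.trans[OF sum_abs] sum_mono B)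
      then show ?thesis using n by (simp add: f_def field_simps)
    qed
    have diff: "\<bar>f n (x(i := y)) - f n x\<bar> \<le> 2 * B / n" if i: "i < n" for x i y
    proof -
      have "(\<Sum>k<n. h ((x(i := y)) k)) - (\<Sum>k<n. h (x k)) = (\<Sum>k<n. if k = i then h y - h (x i) else 0)"
        unfolding sum_subtractf[symmetric] by (intro sum.cong) auto
      also have "\<dots> = h y - h (x i)" using i by simp
      finally have "f n (x(i := y)) - f n x = (h y - h (x i)) / n"
        unfolding f_def by (simp only: diff_divide_distrib[symmetric])
      then show ?thesis using B[of y] B[of "x i"] n by (auto simp: abs_divide intro!: divide_right_mono)
    qed
    have var: "(\<integral>x. (f n x)\<^sup>2 \<partial>?P) - (\<integral>x. f n x \<partial>?P)\<^sup>2 \<le> n * (2 * B / n)\<^sup>2"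
      by (rule bounded_differences_variance[OF prob_space_P0 fm]) (use fB diff in auto)
    have mean: "(\<integral>x. f n x \<partial>?P) = m"
    proof -
      have ei: "(\<integral>x. h (x i) \<partial>?P) = m" if "i < n" for i
      proof -
        have "(\<integral>x. h (x i) \<partial>?P) = (\<integral>w. h w \<partial>distr ?P P0 (\<lambda>x. x i))"
          using that by (subst integral_distr) auto
        also have "distr ?P P0 (\<lambda>x. x i) = P0" using that by (intro PP.PiM_component) auto
        finally show ?thesis by (simp add: m_def)
      qed
      have "integrable ?P (\<lambda>x. h (x i))" if "i < n" for i
        using B that by (intro PN.integrable_const_bound[where B=B]) (auto intro!: measurable_compose[OF _ hP])
      then show ?thesis unfolding f_def using ei n by simp
    qed
    have f1: "integrable ?P (f n)" using fB by (intro PN.integrable_const_bound[where B=B]) auto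
    have "(f n x)\<^sup>2 \<le> B\<^sup>2" for x using fB[of x] B0 by (simp add: abs_le_square_iff[symmetric])
    then have f2: "integrable ?P (\<lambda>x. (f n x)\<^sup>2)" by (intro PN.integrable_const_bound[where B="B\<^sup>2"]) auto
    have ex: "(\<lambda>x. (f n x - m)\<^sup>2) = (\<lambda>x. (f n x)\<^sup>2 - 2 * m * f n x + m\<^sup>2)"
      by (auto simp: power2_eq_square algebra_simps)
    have "(\<integral>\<^sup>+\<omega>. Y n \<omega> \<partial>M) = (\<integral>\<^sup>+\<omega>. ennreal ((f n (sample n \<omega>) - m)\<^sup>2) \<partial>M)"
      unfolding Y_def f_def sample_def by (intro nn_integral_cong) simp
    also have "\<dots> = (\<integral>\<^sup>+x. ennreal ((f n x - m)\<^sup>2) \<partial>?P)"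
      by (rule nn_integral_sample[OF n]) measurable
    also have "\<dots> = ennreal (\<integral>x. (f n x - m)\<^sup>2 \<partial>?P)"
      using f1 f2 unfolding ex[symmetric] by (intro nn_integral_eq_integral) (auto simp: ex)
    also have "(\<integral>x. (f n x - m)\<^sup>2 \<partial>?P) = (\<integral>x. (f n x)\<^sup>2 \<partial>?P) - m\<^sup>2"
      unfolding ex using f1 f2 by (simp add: mean PN.prob_space) (simp add: power2_eq_square)
    also have "\<dots> \<le> 4 * B\<^sup>2 / n"
      using var n unfolding mean by (simp add: power_divide power_mult_distrib) (simp add: power2_eq_square field_simps)
    finally show ?thesis by (simp add: ennreal_leI)
  qed
  have "whp M (\<lambda>n \<omega>. Y n \<omega> \<le> ennreal (\<kappa>\<^sup>2 * 1))"
  proof (rule whp_Markov)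
    show "Y n \<in> borel_measurable M" for n unfolding Y_def f_def by measurable
    fix e :: real assume e: "e > 0"
    have "(\<lambda>n. 4 * B\<^sup>2 / real n) \<longlonglongrightarrow> 0" by (rule lim_const_over_n)
    from order_tendstoD(2)[OF this e] show "\<forall>\<^sub>F n in sequentially. (\<integral>\<^sup>+\<omega>. Y n \<omega> \<partial>M) \<le> ennreal (e * 1) \<and> (0::real) < 1"
      using eventually_ge_at_top[of 1]
    proof eventually_elim
      case (elim n)
      then have "ennreal (4 * B\<^sup>2 / real n) \<le> ennreal (e * 1)" by (intro ennreal_leI) simp
      then show ?case using EY[of n] elim by (auto intro: order.trans)
    qed
  qed (use \<kappa> in simp)
  then show ?thesis
  proof (rule whp_mono, intro always_eventually allI ballI impI)
    fix n \<omega> assume "Y n \<omega> \<le> ennreal (\<kappa>\<^sup>2 * 1)"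
    then have "(f n (\<lambda>i. X i \<omega>) - m)\<^sup>2 \<le> \<kappa>\<^sup>2" unfolding Y_def by (simp add: ennreal_le_iff)
    then have "\<bar>f n (\<lambda>i. X i \<omega>) - m\<bar> \<le> \<bar>\<kappa>\<bar>" by (simp add: abs_le_square_iff)
    then show "\<bar>(\<Sum>i<n. h (X i \<omega>)) / n - (\<integral>w. h w \<partial>P0)\<bar> \<le> \<kappa>" using \<kappa> by (simp add: f_def m_def)
  qed
qed

text \<open>The type of observations contains outcomes with RY = 1 and R = 0. They have probability
  zero and are excluded here for all indices at once, so that the likelihood identity holds on the
  good event.\<close>

lemma whp_support: "whp M (\<lambda>n \<omega>. \<forall>i. snd (snd (X i \<omega>)) \<longrightarrow> fst (snd (X i \<omega>)))"
proof (rule whp_AE)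
  have "AE \<omega> in M. snd (snd (X i \<omega>)) \<longrightarrow> fst (snd (X i \<omega>))" for i
  proof -
    have m[measurable]: "Measurable.pred (obs_space :: 'z obs measure) (\<lambda>w. snd (snd w) \<longrightarrow> fst (snd w))"
      unfolding obs_space_def by measurable
    show ?thesis using m AE_support unfolding distr_X[of i, symmetric]
      by (subst (asm) AE_distr_iff) (auto simp: pred_def)
  qed
  then show "AE \<omega> in M. \<forall>i. snd (snd (X i \<omega>)) \<longrightarrow> fst (snd (X i \<omega>))" by (simp add: AE_all_countable)
qed

end

section \<open>Uniform control over the sieve\<close>

locale causal_sieve = causal_sample a0 b0 F0 \<epsilon>0 M X
  for a0 b0 :: "'z::topological_space \<Rightarrow> real" and F0 :: "'z measure" and \<epsilon>0 :: real
    and M :: "'m measure" and X :: "nat \<Rightarrow> 'm \<Rightarrow> 'z obs" +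
  fixes Q :: "'z eta measure" and H :: "nat \<Rightarrow> 'z eta set"
  assumes Q: "eta_prior Q" and H[measurable]: "\<And>n. H n \<in> sets Q"
    and L2: "(\<lambda>n. SUP \<eta>\<in>H n. L2_norm F0 (\<lambda>z. b_of \<eta> z - b0 z)) \<longlonglongrightarrow> 0"
    and emp: "tendsto_in_outer_prob M
           (\<lambda>n \<omega>. SUP \<eta>\<in>H n. \<bar>emp_process (obs_law a0 b0 F0) n (\<lambda>i. X i \<omega>)
                                   (\<lambda>(z, _). b_of \<eta> z - b0 z)\<bar>) 0"
begin

sublocale Q: prob_space Q using Q by (simp add: eta_prior_def)

lemma b_of_measurable2: "(\<lambda>(\<eta>, z). b_of \<eta> z) \<in> borel_measurable (Q \<Otimes>\<^sub>M borel)"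
proof -
  have [measurable]: "(\<lambda>(\<eta>, z). snd \<eta> z) \<in> borel_measurable (Q \<Otimes>\<^sub>M borel)" using Q by (simp add: eta_prior_def)
  have "(\<lambda>p. Psi ((\<lambda>(\<eta>, z). snd \<eta> z) p)) \<in> borel_measurable (Q \<Otimes>\<^sub>M borel)"
    unfolding Psi_def by measurable
  then show ?thesis by (simp add: b_of_def split_beta')
qed

lemma b_of_bounds: "0 \<le> b_of \<eta> z" "b_of \<eta> z \<le> 1"
  using Psi_bounds[of "snd \<eta> z"] by (auto simp: b_of_def less_imp_le)

lemma b_of_measurable[measurable]: "\<eta> \<in> space Q \<Longrightarrow> b_of \<eta> \<in> borel_measurable borel"
  using measurable_compose[OF measurable_Pair1' b_of_measurable2] by simp

definition gg :: "'z eta \<Rightarrow> 'z \<Rightarrow> real" where "gg \<eta> z = b_of \<eta> z - b0 z"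

lemma gg_bound: "\<bar>gg \<eta> z\<bar> \<le> 1"
  using b_of_bounds[of \<eta> z] b0_bounds[of z] by (auto simp: gg_def)

lemma gg_measurable: "\<eta> \<in> H n \<Longrightarrow> gg \<eta> \<in> borel_measurable borel"
  using sets.sets_into_space[OF H[of n]] unfolding gg_def
  by (intro borel_measurable_diff b_of_measurable b0) auto

text \<open>This measure does not depend on the sample, as the product-space arguments require. The
  posterior has a density with respect to the prior, so almost sure statements under
  \<open>R n\<close> are valid for the posterior on the sieve.\<close>

definition R where "R n = restrict_space Q (H n)"

lemma space_R: "space (R n) = H n"
  using sets.sets_into_space[OF H[of n]] by (auto simp: R_def space_restrict_space)

lemma gg_class: "bounded_class (R n) F0 gg"
proof (rule bounded_class.intro)
  show "finite_measure (R n)" unfolding R_def by (intro finite_measure_restrict_space) (auto intro: Q.finite_measure_axioms)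
  show "prob_space F0" by (rule F0)
  show "(\<lambda>(\<eta>, z). gg \<eta> z) \<in> borel_measurable (R n \<Otimes>\<^sub>M F0)"
  proof -
    have 1: "(\<lambda>p. p) \<in> measurable (R n \<Otimes>\<^sub>M F0) (Q \<Otimes>\<^sub>M borel)"
    proof -
      have "fst \<in> measurable (R n \<Otimes>\<^sub>M F0) Q" unfolding R_def
        by (rule measurable_compose[OF measurable_fst]) (rule measurable_restrict_space1, simp)
      moreover have "snd \<in> measurable (R n \<Otimes>\<^sub>M F0) borel" by measurable
      ultimately have "(\<lambda>p. (fst p, snd p)) \<in> measurable (R n \<Otimes>\<^sub>M F0) (Q \<Otimes>\<^sub>M borel)" by (rule measurable_Pair)
      then show ?thesis by simp
    qed
    have "(\<lambda>(\<eta>, z). gg \<eta> z) \<in> borel_measurable (Q \<Otimes>\<^sub>M borel)"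
      unfolding gg_def split_beta' using b_of_measurable2 by (intro borel_measurable_diff) (auto simp: split_beta')
    from measurable_compose[OF 1 this] show ?thesis by simp
  qed
qed (rule gg_bound)

text \<open>The maximum with 0 settles the case of an empty sieve, whose real supremum has no
  prescribed value.\<close>

definition \<delta>n where "\<delta>n n = max 0 (SUP \<eta>\<in>H n. L2_norm F0 (\<lambda>z. b_of \<eta> z - b0 z))"

lemma \<delta>n_lim: "\<delta>n \<longlonglongrightarrow> 0"
  unfolding \<delta>n_def using tendsto_max[OF tendsto_const L2, of 0] by simp

text \<open>Jensen's inequality, read off from the nonnegative variance of
  \<open>gg \<eta>\<close>.\<close>

lemma Pgg_le:
  assumes "\<eta> \<in> H n"
  shows "\<bar>\<integral>z. gg \<eta> z \<partial>F0\<bar> \<le> \<delta>n n"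
proof -
  note [measurable] = gg_measurable[of _ n]
  have sq: "(gg \<eta> z)\<^sup>2 \<le> 1" for \<eta> z using gg_bound[of \<eta> z] by (simp add: abs_square_le_1)
  have i2: "integrable F0 (\<lambda>z. (gg \<eta> z)\<^sup>2)" if "\<eta> \<in> H n" for \<eta>
    using that sq by (intro F0.integrable_const_bound[where B=1]) auto
  have i1: "integrable F0 (gg \<eta>)" using assms gg_bound by (intro F0.integrable_const_bound[where B=1]) auto
  have le1: "L2_norm F0 (gg \<eta>) \<le> 1" if "\<eta> \<in> H n" for \<eta>
  proof -
    have "(\<integral>z. (gg \<eta> z)\<^sup>2 \<partial>F0) \<le> 1" using i2[OF that] sq by (intro F0.integral_le_const) auto
    then show ?thesis by (simp add: L2_norm_def)
  qed
  define m where "m = (\<integral>z. gg \<eta> z \<partial>F0)"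
  have "0 \<le> (\<integral>z. (gg \<eta> z - m)\<^sup>2 \<partial>F0)" by simp
  also have "(\<lambda>z. (gg \<eta> z - m)\<^sup>2) = (\<lambda>z. (gg \<eta> z)\<^sup>2 - 2 * m * gg \<eta> z + m\<^sup>2)"
    by (auto simp: power2_eq_square algebra_simps)
  also have "(\<integral>z. (gg \<eta> z)\<^sup>2 - 2 * m * gg \<eta> z + m\<^sup>2 \<partial>F0) = (\<integral>z. (gg \<eta> z)\<^sup>2 \<partial>F0) - m\<^sup>2"
    using i1 i2[OF assms] by (simp add: F0.prob_space m_def[symmetric]) (simp add: power2_eq_square)
  finally have "m\<^sup>2 \<le> (\<integral>z. (gg \<eta> z)\<^sup>2 \<partial>F0)" by simp
  then have "\<bar>m\<bar> \<le> L2_norm F0 (gg \<eta>)" unfolding L2_norm_def by (intro real_le_rsqrt) simp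
  also have "\<dots> \<le> (SUP \<eta>\<in>H n. L2_norm F0 (gg \<eta>))"
    using le1 by (intro cSUP_upper[OF assms] bdd_aboveI2)
  also have "\<dots> \<le> \<delta>n n" by (simp add: \<delta>n_def gg_def[abs_def])
  finally show ?thesis by (simp add: m_def)
qed

text \<open>The essential supremum lies below the true one, which is the direction in which the
  hypothesis on the empirical process is used; boundedness of the class makes the real supremum an
  upper bound.\<close>

lemma centred_le_emp:
  assumes n: "n \<ge> 1" and T: "(SUP \<eta>\<in>H n. \<bar>emp_process P0 n x (\<lambda>(z, _). b_of \<eta> z - b0 z)\<bar>) \<le> e"
  shows "ess_norm (R n) (bounded_class.centred F0 gg {..<n} (\<lambda>i\<in>{..<n}. fst (x i))) \<le> ennreal (e * sqrt n)"
proof -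
  interpret bounded_class "R n" F0 gg by (rule gg_class)
  have "(\<lambda>i\<in>{..<n}. fst (x i)) \<in> space (\<Pi>\<^sub>M i\<in>{..<n}. F0)"
    using sets_eq_imp_space_eq[OF sF0] by (auto simp: space_PiM)
  then show ?thesis
  proof (intro ess_norm_le centred_measurable[OF order.refl] AE_I2)
    fix \<eta> assume "\<eta> \<in> space (R n)"
    then have \<eta>: "\<eta> \<in> H n" by (simp add: space_R)
    have eq: "emp_process P0 n x (\<lambda>(z, _). b_of \<eta>' z - b0 z) = sqrt n * ((\<Sum>i<n. gg \<eta>' (fst (x i))) / n - (\<integral>z. gg \<eta>' z \<partial>F0))" if "\<eta>' \<in> H n" for \<eta>'
    proof -
      have "(\<integral>w. gg \<eta>' (fst w) \<partial>P0) = (\<integral>z. gg \<eta>' z \<partial>F0)" by (rule integral_P0_fst[OF gg_measurable[OF that]])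
      then show ?thesis unfolding emp_process_def gg_def by (simp add: split_beta')
    qed
    have bd: "\<bar>emp_process P0 n x (\<lambda>(z, _). b_of \<eta>' z - b0 z)\<bar> \<le> sqrt n * 2" if "\<eta>' \<in> H n" for \<eta>'
    proof -
      have "\<bar>\<Sum>i<n. gg \<eta>' (fst (x i))\<bar> \<le> (\<Sum>i<n. 1)" by (intro order.trans[OF sum_abs] sum_mono gg_bound)
      then have "\<bar>(\<Sum>i<n. gg \<eta>' (fst (x i))) / n\<bar> \<le> 1" using n by simp
      then have "\<bar>(\<Sum>i<n. gg \<eta>' (fst (x i))) / n - (\<integral>z. gg \<eta>' z \<partial>F0)\<bar> \<le> 2" using Pg_bound[of \<eta>'] by linarith
      then show ?thesis unfolding eq[OF that] abs_mult by (intro mult_mono) auto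
    qed
    have "\<bar>emp_process P0 n x (\<lambda>(z, _). b_of \<eta> z - b0 z)\<bar> \<le> (SUP \<eta>\<in>H n. \<bar>emp_process P0 n x (\<lambda>(z, _). b_of \<eta> z - b0 z)\<bar>)"
      using bd by (intro cSUP_upper[OF \<eta>] bdd_aboveI2)
    with T have le: "\<bar>emp_process P0 n x (\<lambda>(z, _). b_of \<eta> z - b0 z)\<bar> \<le> e" by linarith
    have "centred {..<n} (\<lambda>i\<in>{..<n}. fst (x i)) \<eta> = (\<Sum>i<n. gg \<eta> (fst (x i))) - n * (\<integral>z. gg \<eta> z \<partial>F0)"
      by (simp add: centred_def gh_def sum_subtractf)
    also have "\<dots> = sqrt n * emp_process P0 n x (\<lambda>(z, _). b_of \<eta> z - b0 z)"
      unfolding eq[OF \<eta>] using n by (simp add: right_diff_distrib mult.assoc[symmetric])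
    finally have "\<bar>centred {..<n} (\<lambda>i\<in>{..<n}. fst (x i)) \<eta>\<bar> \<le> e * sqrt n"
      using le n by (simp add: abs_mult mult.commute)
    then show "ennreal \<bar>centred {..<n} (\<lambda>i\<in>{..<n}. fst (x i)) \<eta>\<bar> \<le> ennreal (e * sqrt n)" by (rule ennreal_leI)
  qed
qed

text \<open>The hypothesis speaks of outer probability on the given space, the symmetrisation
  inequalities of a product space. The bridge is the measurable event \<open>U'\<close>: it lies
  inside the possibly non-measurable event of the hypothesis, so its probability is at most the
  outer measure of the latter.\<close>

lemma rn_small:
  assumes e: "0 < e"
  shows "\<forall>\<^sub>F n in sequentially. bounded_class.rn (R n) F0 gg n \<le> ennreal (e * sqrt n)"
proof -
  \<comment> \<open>\<open>rn_le\<close> asks for a level of at most 1/2 and returns 7 times that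
    level.\<close>
  define e' where "e' = min (1/2) (e / 7)"
  have e': "0 < e'" "e' \<le> 1 / 2" "7 * e' \<le> e" using e by (auto simp: e'_def)
  have "whp M (\<lambda>n \<omega>. (SUP \<eta>\<in>H n. \<bar>emp_process P0 n (\<lambda>i. X i \<omega>) (\<lambda>(z, _). b_of \<eta> z - b0 z)\<bar>) \<le> e')"
    using emp[unfolded tendsto_in_outer_prob_whp, rule_format, OF e'(1)]
    by (rule whp_mono, intro always_eventually allI ballI impI) (simp add: abs_le_iff)
  from whpD[OF this, of "e'\<^sup>2"] e'(1)
  have "\<forall>\<^sub>F n in sequentially. outer_measure_of M {\<omega> \<in> space M. \<not> (SUP \<eta>\<in>H n. \<bar>emp_process P0 n (\<lambda>i. X i \<omega>) (\<lambda>(z, _). b_of \<eta> z - b0 z)\<bar>) \<le> e'} \<le> ennreal (e'\<^sup>2)"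
    by simp
  then show ?thesis using eventually_ge_at_top[of 1]
  proof eventually_elim
    case (elim n)
    interpret bounded_class "R n" F0 gg by (rule gg_class)
    let ?S = "\<Pi>\<^sub>M i\<in>{..<n}. F0" and ?P = "\<Pi>\<^sub>M i\<in>{..<n}. P0"
    interpret PS: prob_space ?S by (intro prob_space_PiM F0)
    note [measurable] = ess_centred_measurable[of "{..<n}" "{..<n}", OF order.refl]
    define U where "U = {z \<in> space ?S. ennreal (e' * sqrt n) < ess_norm (R n) (centred {..<n} z)}"
    have U: "U \<in> sets ?S" unfolding U_def by measurable
    have ind: "indicator U \<in> borel_measurable ?S" using U by measurable
    define U' where "U' = {\<omega> \<in> space M. (\<lambda>i\<in>{..<n}. fst (sample n \<omega> i)) \<in> U}"
    have mz: "(\<lambda>\<omega>. \<lambda>i\<in>{..<n}. fst (sample n \<omega> i)) \<in> measurable M ?S"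
    proof -
      note [measurable] = fst_P0
      have "(\<lambda>x. \<lambda>i\<in>{..<n}. fst (x i)) \<in> measurable ?P ?S" by measurable
      from measurable_compose[OF sample_measurable this] show ?thesis .
    qed
    have U': "U' \<in> sets M" unfolding U'_def using measurable_sets[OF mz U] by (simp add: vimage_def Int_def conj_commute)
    have "emeasure ?S U = (\<integral>\<^sup>+z. indicator U z \<partial>?S)" using U by simp
    also have "\<dots> = (\<integral>\<^sup>+x. indicator U (\<lambda>i\<in>{..<n}. fst (x i)) \<partial>?P)" by (rule sample_fst(2)[OF ind, symmetric])
    also have "\<dots> = (\<integral>\<^sup>+\<omega>. indicator U (\<lambda>i\<in>{..<n}. fst (sample n \<omega> i)) \<partial>M)"
      by (rule nn_integral_sample[OF elim(2) sample_fst(1)[OF ind], symmetric])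
    also have "\<dots> = (\<integral>\<^sup>+\<omega>. indicator U' \<omega> \<partial>M)" by (intro nn_integral_cong) (auto simp: U'_def indicator_def)
    also have "\<dots> = outer_measure_of M U'" using U' by simp
    also have "\<dots> \<le> outer_measure_of M {\<omega> \<in> space M. \<not> (SUP \<eta>\<in>H n. \<bar>emp_process P0 n (\<lambda>i. X i \<omega>) (\<lambda>(z, _). b_of \<eta> z - b0 z)\<bar>) \<le> e'}"
    proof (rule outer_measure_of_mono, safe)
      fix \<omega> assume "\<omega> \<in> U'"
      then show "\<omega> \<in> space M" by (simp add: U'_def)
    next
      fix \<omega> assume \<omega>: "\<omega> \<in> U'" and le: "(SUP \<eta>\<in>H n. \<bar>emp_process P0 n (\<lambda>i. X i \<omega>) (\<lambda>(z, _). b_of \<eta> z - b0 z)\<bar>) \<le> e'"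
      have eq: "(\<lambda>i\<in>{..<n}. fst (sample n \<omega> i)) = (\<lambda>i\<in>{..<n}. fst (X i \<omega>))" by (auto simp: sample_def fun_eq_iff)
      show False using centred_le_emp[OF elim(2) le] \<omega> by (simp add: U'_def U_def eq not_less[symmetric])
    qed
    also have "\<dots> \<le> ennreal (e'\<^sup>2)" by (rule elim(1))
    finally have "measure ?S U \<le> e'\<^sup>2" by (simp add: PS.emeasure_eq_measure ennreal_le_iff)
    then have "rn n \<le> ennreal (7 * e' * sqrt n)" unfolding U_def by (intro rn_le[OF elim(2) e'(1,2)])
    also have "\<dots> \<le> ennreal (e * sqrt n)" using e'(3) by (intro ennreal_leI mult_right_mono) auto
    finally show ?case .
  qed
qed

lemma total_small:
  assumes e: "0 < e"
  shows "\<forall>\<^sub>F n in sequentially. 2 * bounded_class.rn (R n) F0 gg n + ennreal (sqrt n * \<delta>n n) \<le> ennreal (e * sqrt n)"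
proof -
  have e4: "e / 4 > 0" "e / 2 > 0" using e by auto
  show ?thesis using rn_small[OF e4(1)] order_tendstoD(2)[OF \<delta>n_lim e4(2)]
  proof eventually_elim
  case (elim n)
  have d: "0 \<le> \<delta>n n" by (simp add: \<delta>n_def)
  have "2 * bounded_class.rn (R n) F0 gg n + ennreal (sqrt n * \<delta>n n) \<le> 2 * ennreal (e / 4 * sqrt n) + ennreal (sqrt n * (e / 2))"
    using elim d by (intro add_mono mult_left_mono ennreal_leI) (auto simp: mult_left_mono)
  also have "2 * ennreal (e / 4 * sqrt n) = ennreal (2 * (e / 4 * sqrt n))" using e by (subst ennreal_mult) auto
  also have "\<dots> + ennreal (sqrt n * (e / 2)) = ennreal (2 * (e / 4 * sqrt n) + sqrt n * (e / 2))"
    using e by (intro ennreal_plus[symmetric]) auto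
  also have "2 * (e / 4 * sqrt n) + sqrt n * (e / 2) = e * sqrt n" by simp
  finally show ?case .
  qed
qed

text \<open>The multiplier R a0(Z) - 1 is bounded by \<open>Ka\<close> and centred given Z, so both
  suprema are governed by \<open>rn n\<close> and \<open>sqrt n * \<delta>n n\<close>, each of
  smaller order than sqrt n. The factor 8 / sqrt n in \<open>ess_squares_le\<close> explains why the
  second supremum is small at scale 1.\<close>

lemma whp_uniform:
  assumes \<kappa>: "\<kappa> > 0"
  shows "whp M (\<lambda>n \<omega>. AE \<eta> in Q. \<eta> \<in> H n \<longrightarrow>
     \<bar>\<Sum>i<n. (of_bool (fst (snd (X i \<omega>))) * a0 (fst (X i \<omega>)) - 1) * gg \<eta> (fst (X i \<omega>))\<bar> \<le> \<kappa> * sqrt n \<and>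
     (\<Sum>i<n. (gg \<eta> (fst (X i \<omega>)))\<^sup>2) / n \<le> \<kappa>\<^sup>2)"
proof -
  define \<xi> where "\<xi> w = of_bool (fst (snd w)) * a0 (fst w) - 1" for w :: "'z obs"
  have \<xi>m[measurable]: "\<xi> \<in> borel_measurable P0"
    unfolding measurable_cong_sets[OF sets_P0 refl] \<xi>_def obs_space_def by measurable
  have \<xi>K: "\<bar>\<xi> w\<bar> \<le> Ka" for w using a0_bounds[of "fst w"] Ka_ge by (auto simp: \<xi>_def)
  have K: "Ka > 0" using Ka_ge by linarith
  define Y1 where "Y1 n x = ess_norm (R n) (\<lambda>\<eta>. \<Sum>i<n. \<xi> (x i) * gg \<eta> (fst (x i)))" for n and x :: "nat \<Rightarrow> 'z obs"
  define Y2 where "Y2 n z = ess_norm (R n) (\<lambda>\<eta>. (\<Sum>i<n. (gg \<eta> (z i))\<^sup>2) / n)" for n and z :: "nat \<Rightarrow> 'z"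
  have dn: "AE \<eta> in R n. \<bar>\<integral>z. gg \<eta> z \<partial>F0\<bar> \<le> \<delta>n n" for n
    by (intro AE_I2 Pgg_le) (simp add: space_R)
  have d0: "0 \<le> \<delta>n n" for n by (simp add: \<delta>n_def)
  have m1: "Y1 n \<in> borel_measurable (\<Pi>\<^sub>M i\<in>{..<n}. P0)" for n
  proof -
    interpret bounded_class "R n" F0 gg by (rule gg_class)
    note [measurable] = fst_P0
    show ?thesis unfolding Y1_def
    proof (intro ess_norm_measurable[OF sfR])
      have "(\<lambda>p. \<xi> (fst p i) * gg (snd p) (fst (fst p i))) \<in> borel_measurable ((\<Pi>\<^sub>M i\<in>{..<n}. P0) \<Otimes>\<^sub>M R n)" if "i \<in> {..<n}" for i
        using that by (intro borel_measurable_times g_comp) measurable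
      then show "(\<lambda>(x, \<eta>). \<Sum>i<n. \<xi> (x i) * gg \<eta> (fst (x i))) \<in> borel_measurable ((\<Pi>\<^sub>M i\<in>{..<n}. P0) \<Otimes>\<^sub>M R n)"
        unfolding split_beta' by (intro borel_measurable_sum)
    qed
  qed
  have m2: "Y2 n \<in> borel_measurable (\<Pi>\<^sub>M i\<in>{..<n}. F0)" for n
  proof -
    interpret bounded_class "R n" F0 gg by (rule gg_class)
    show ?thesis unfolding Y2_def
    proof (intro ess_norm_measurable[OF sfR])
      have "(\<lambda>p. (gg (snd p) (fst p i))\<^sup>2) \<in> borel_measurable ((\<Pi>\<^sub>M i\<in>{..<n}. F0) \<Otimes>\<^sub>M R n)" if "i \<in> {..<n}" for i
        using that by (intro borel_measurable_power g_comp) measurable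
      then show "(\<lambda>(x, \<eta>). (\<Sum>i<n. (gg \<eta> (x i))\<^sup>2) / n) \<in> borel_measurable ((\<Pi>\<^sub>M i\<in>{..<n}. F0) \<Otimes>\<^sub>M R n)"
        unfolding split_beta' by (intro borel_measurable_divide borel_measurable_sum borel_measurable_const)
    qed
  qed
  \<comment> \<open>The weight of \<open>nn_integral_weight_fst\<close> at slope
    \<open>s / Ka\<close>, the largest one that keeps it nonnegative.\<close>
  have eqw: "(\<integral>\<^sup>+x. ennreal (1 + s * (\<xi> x / Ka)) * indicator A (fst x) \<partial>P0) = emeasure F0 A"
    if "s = 1 \<or> s = -1" "A \<in> sets F0" for s A
  proof -
    have "(\<integral>\<^sup>+x. ennreal (1 + (s / Ka) * (of_bool (fst (snd x)) * a0 (fst x) - 1)) * indicator A (fst x) \<partial>P0) = (\<integral>\<^sup>+z. indicator A z \<partial>F0)"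
      using that K by (intro nn_integral_weight_fst) (auto simp: sF0)
    then show ?thesis using that by (simp add: \<xi>_def)
  qed
  have w1: "whp M (\<lambda>n \<omega>. Y1 n (sample n \<omega>) \<le> ennreal (\<kappa> * sqrt n))"
  proof (rule whp_Markov[OF _ \<kappa>])
    show "(\<lambda>\<omega>. Y1 n (sample n \<omega>)) \<in> borel_measurable M" for n by (rule measurable_compose[OF sample_measurable m1])
    fix e :: real assume e: "e > 0"
    have "e / Ka > 0" using e K by simp
    from total_small[OF this] show "\<forall>\<^sub>F n in sequentially. (\<integral>\<^sup>+\<omega>. Y1 n (sample n \<omega>) \<partial>M) \<le> ennreal (e * sqrt n) \<and> sqrt n > 0"
      using eventually_ge_at_top[of 1]
    proof eventually_elim
      case (elim n)
      interpret bounded_class "R n" F0 gg by (rule gg_class)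
      have "(\<integral>\<^sup>+\<omega>. Y1 n (sample n \<omega>) \<partial>M) = (\<integral>\<^sup>+x. Y1 n x \<partial>(\<Pi>\<^sub>M i\<in>{..<n}. P0))"
        by (rule nn_integral_sample[OF elim(2) m1])
      also have "\<dots> \<le> ennreal Ka * (2 * rn n + ennreal (sqrt n * \<delta>n n))"
        unfolding Y1_def by (rule ess_multiplier_le[OF prob_space_P0 fst_P0 \<xi>m \<xi>K K eqw dn d0])
      also have "\<dots> \<le> ennreal Ka * ennreal (e / Ka * sqrt n)" using elim(1) by (rule mult_left_mono) simp
      also have "\<dots> = ennreal (e * sqrt n)" using K e by (subst ennreal_mult[symmetric]) auto
      finally show ?case using elim by simp
    qed
  qed
  have w2: "whp M (\<lambda>n \<omega>. Y2 n (\<lambda>i\<in>{..<n}. fst (sample n \<omega> i)) \<le> ennreal (\<kappa>\<^sup>2 * 1))"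
  proof (rule whp_Markov[OF _ zero_less_power[OF \<kappa>]])
    show "(\<lambda>\<omega>. Y2 n (\<lambda>i\<in>{..<n}. fst (sample n \<omega> i))) \<in> borel_measurable M" for n
      by (rule measurable_compose[OF sample_measurable sample_fst(1)[OF m2]])
    fix e :: real assume e: "e > 0"
    have "e / 8 > 0" using e by simp
    from total_small[OF this] show "\<forall>\<^sub>F n in sequentially. (\<integral>\<^sup>+\<omega>. Y2 n (\<lambda>i\<in>{..<n}. fst (sample n \<omega> i)) \<partial>M) \<le> ennreal (e * 1) \<and> (1::real) > 0"
      using eventually_ge_at_top[of 1]
    proof eventually_elim
      case (elim n)
      interpret bounded_class "R n" F0 gg by (rule gg_class)
      have "(\<integral>\<^sup>+\<omega>. Y2 n (\<lambda>i\<in>{..<n}. fst (sample n \<omega> i)) \<partial>M) = (\<integral>\<^sup>+x. Y2 n (\<lambda>i\<in>{..<n}. fst (x i)) \<partial>(\<Pi>\<^sub>M i\<in>{..<n}. P0))"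
        by (rule nn_integral_sample[OF elim(2) sample_fst(1)[OF m2]])
      also have "\<dots> = (\<integral>\<^sup>+z. Y2 n z \<partial>(\<Pi>\<^sub>M i\<in>{..<n}. F0))" by (rule sample_fst(2)[OF m2])
      also have "\<dots> \<le> ennreal (8 / sqrt n) * (2 * rn n + ennreal (sqrt n * \<delta>n n))"
        unfolding Y2_def by (rule ess_squares_le[OF dn d0 elim(2)])
      also have "\<dots> \<le> ennreal (8 / sqrt n) * ennreal (e / 8 * sqrt n)" using elim(1) by (rule mult_left_mono) simp
      also have "\<dots> = ennreal (e * 1)" using elim e by (subst ennreal_mult[symmetric]) auto
      finally show ?case by simp
    qed
  qed
  show ?thesis
  proof (rule whp_mono[OF whp_conj[OF w1 w2]], rule always_eventually, intro allI ballI impI)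
    fix n \<omega> assume "\<omega> \<in> space M" and le: "Y1 n (sample n \<omega>) \<le> ennreal (\<kappa> * sqrt n) \<and> Y2 n (\<lambda>i\<in>{..<n}. fst (sample n \<omega> i)) \<le> ennreal (\<kappa>\<^sup>2 * 1)"
    have "AE \<eta> in R n. \<bar>\<Sum>i<n. \<xi> (sample n \<omega> i) * gg \<eta> (fst (sample n \<omega> i))\<bar> \<le> \<kappa> * sqrt n \<and>
       (\<Sum>i<n. (gg \<eta> ((\<lambda>i\<in>{..<n}. fst (sample n \<omega> i)) i))\<^sup>2) / n \<le> \<kappa>\<^sup>2"
      using ess_norm_AE[of "\<lambda>\<eta>. \<Sum>i<n. \<xi> (sample n \<omega> i) * gg \<eta> (fst (sample n \<omega> i))" "R n"]
        ess_norm_AE[of "\<lambda>\<eta>. (\<Sum>i<n. (gg \<eta> ((\<lambda>i\<in>{..<n}. fst (sample n \<omega> i)) i))\<^sup>2) / n" "R n"]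
    proof eventually_elim
      case (elim \<eta>)
      have "ennreal \<bar>\<Sum>i<n. \<xi> (sample n \<omega> i) * gg \<eta> (fst (sample n \<omega> i))\<bar> \<le> ennreal (\<kappa> * sqrt n)"
        using elim(1) le unfolding Y1_def by (auto intro: order.trans)
      moreover have "ennreal \<bar>(\<Sum>i<n. (gg \<eta> ((\<lambda>i\<in>{..<n}. fst (sample n \<omega> i)) i))\<^sup>2) / n\<bar> \<le> ennreal (\<kappa>\<^sup>2 * 1)"
        using elim(2) le unfolding Y2_def by (rule order.trans[OF _ conjunct2])
      ultimately show ?case using \<kappa> by (simp only: ennreal_le_iff mult_nonneg_nonneg less_imp_le real_sqrt_ge_zero of_nat_0_le_iff mult_1_right zero_le_power2) (use abs_le_D1 in blast)
    qed
    moreover have "(\<Sum>i<n. \<xi> (sample n \<omega> i) * gg \<eta> (fst (sample n \<omega> i))) = (\<Sum>i<n. \<xi> (X i \<omega>) * gg \<eta> (fst (X i \<omega>)))" for \<eta>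
      by (intro sum.cong) (auto simp: sample_def)
    moreover have "(\<Sum>i<n. (gg \<eta> ((\<lambda>i\<in>{..<n}. fst (sample n \<omega> i)) i))\<^sup>2) = (\<Sum>i<n. (gg \<eta> (fst (X i \<omega>)))\<^sup>2)" for \<eta>
      by (intro sum.cong) (auto simp: sample_def)
    ultimately have "AE \<eta> in R n. \<bar>\<Sum>i<n. \<xi> (X i \<omega>) * gg \<eta> (fst (X i \<omega>))\<bar> \<le> \<kappa> * sqrt n \<and> (\<Sum>i<n. (gg \<eta> (fst (X i \<omega>)))\<^sup>2) / n \<le> \<kappa>\<^sup>2"
      by simp
    then show "AE \<eta> in Q. \<eta> \<in> H n \<longrightarrow>
     \<bar>\<Sum>i<n. (of_bool (fst (snd (X i \<omega>))) * a0 (fst (X i \<omega>)) - 1) * gg \<eta> (fst (X i \<omega>))\<bar> \<le> \<kappa> * sqrt n \<and>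
     (\<Sum>i<n. (gg \<eta> (fst (X i \<omega>)))\<^sup>2) / n \<le> \<kappa>\<^sup>2"
      unfolding R_def \<xi>_def by (subst (asm) AE_restrict_space_iff) auto
  qed
qed

end

section \<open>The posterior of the functional\<close>

text \<open>The coordinates are independent, so Tonelli factorises the transform. The law is the
  intermediate one of the final comparison, in which the Dirichlet part is already Gaussian.\<close>

lemma mgf_mixture:
  assumes C: "prob_space C" and U[measurable]: "U \<in> borel_measurable C"
    and m: "has_bochner_integral C (\<lambda>\<eta>. exp (t * U \<eta>)) m"
  shows "has_bochner_integral (distr (C \<Otimes>\<^sub>M gauss \<sigma>) borel (\<lambda>p. U (fst p) + snd p)) (\<lambda>x. exp (t * x)) (m * exp (t\<^sup>2 * \<sigma>\<^sup>2 / 2))"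
proof -
  interpret C: prob_space C by fact
  interpret G: real_distribution "gauss \<sigma>" by (rule gauss_real_distribution)
  have nn: "(\<integral>\<^sup>+y. ennreal (exp (t * y)) \<partial>gauss \<sigma>) = ennreal (exp (t\<^sup>2 * \<sigma>\<^sup>2 / 2))"
    using gauss_mgf[of \<sigma> t] nn_integral_eq_integral[of "gauss \<sigma>" "\<lambda>y. exp (t * y)"] by (simp add: has_bochner_integral_iff)
  have nC: "(\<integral>\<^sup>+\<eta>. ennreal (exp (t * U \<eta>)) \<partial>C) = ennreal m"
    using m nn_integral_eq_integral[of C "\<lambda>\<eta>. exp (t * U \<eta>)"] by (simp add: has_bochner_integral_iff)
  have m0: "m \<ge> 0" using m by (auto simp: has_bochner_integral_iff)
  have "(\<integral>\<^sup>+p. ennreal (exp (t * (U (fst p) + snd p))) \<partial>(C \<Otimes>\<^sub>M gauss \<sigma>))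
     = (\<integral>\<^sup>+\<eta>. \<integral>\<^sup>+y. ennreal (exp (t * (U \<eta> + y))) \<partial>gauss \<sigma> \<partial>C)"
    by (subst G.nn_integral_fst[symmetric]) (auto simp: measurable_cong_sets[OF sets_pair_measure_cong[OF refl G.events_eq_borel] refl])
  also have "\<dots> = (\<integral>\<^sup>+\<eta>. ennreal (exp (t * U \<eta>)) * ennreal (exp (t\<^sup>2 * \<sigma>\<^sup>2 / 2)) \<partial>C)"
    unfolding nn[symmetric]
    by (intro nn_integral_cong) (simp add: distrib_left exp_add ennreal_mult nn_integral_cmult)
  also have "\<dots> = ennreal (m * exp (t\<^sup>2 * \<sigma>\<^sup>2 / 2))"
    using m0 by (simp add: nn_integral_multc nC ennreal_mult)
  finally show ?thesis using m0
    by (intro has_bochner_integral_distr has_bochner_integral_nn_integral)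
      (auto simp: measurable_cong_sets[OF sets_pair_measure_cong[OF refl G.events_eq_borel] refl])
qed

section \<open>Conditioned posteriors and exponential tilting\<close>

text \<open>The posterior for one fixed sample: \<open>L\<close> is the likelihood and
  \<open>A\<close> the sieve.\<close>

locale weighted_prior = prob_space Q for Q :: "'e measure" +
  fixes L :: "'e \<Rightarrow> real" and A :: "'e set"
  assumes L[measurable]: "L \<in> borel_measurable Q" and L0: "\<And>\<eta>. 0 < L \<eta>" and L1: "\<And>\<eta>. L \<eta> \<le> 1"
    and A[measurable]: "A \<in> sets Q"
begin

definition Z where "Z = (\<integral>\<eta>. L \<eta> \<partial>Q)"

definition ZA where "ZA = (\<integral>\<eta>. indicator A \<eta> * L \<eta> \<partial>Q)"

definition post where "post = density Q (\<lambda>\<eta>. ennreal (L \<eta> / Z))"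

text \<open>The posterior conditioned on \<open>A\<close>. Its exponential moments, unlike those of
  \<open>post\<close>, involve the likelihood ratio only where an expansion of it is
  available.\<close>

definition cpost where "cpost = density Q (\<lambda>\<eta>. ennreal (indicator A \<eta> * L \<eta> / ZA))"

lemma bounded_integrable:
  fixes f :: "'e \<Rightarrow> real"
  assumes "f \<in> borel_measurable Q" "\<And>\<eta>. \<eta> \<in> space Q \<Longrightarrow> \<bar>f \<eta>\<bar> \<le> B"
  shows "integrable Q f"
  using assms by (intro integrable_const_bound[where B=B]) auto

lemma L_integrable: "integrable Q L" "integrable Q (\<lambda>\<eta>. indicator A \<eta> * L \<eta>)"
  using L0 L1 by (auto intro!: bounded_integrable[where B=1] simp: less_imp_le abs_mult indicator_def)

lemma Z_pos: "Z > 0"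
proof -
  have "0 \<le> Z" unfolding Z_def using L0 by (intro Bochner_Integration.integral_nonneg) (simp add: less_imp_le)
  moreover have "Z \<noteq> 0"
  proof
    assume "Z = 0"
    then have "AE \<eta> in Q. L \<eta> = 0"
      unfolding Z_def using L_integrable(1) L0 by (subst (asm) integral_nonneg_eq_0_iff_AE) (auto simp: less_imp_le)
    then have "AE \<eta> in Q. False" using L0 by (auto elim!: eventually_mono simp: less_le)
    then show False by simp
  qed
  ultimately show ?thesis by simp
qed

lemma ZA_nonneg: "ZA \<ge> 0"
  unfolding ZA_def using L0 by (intro Bochner_Integration.integral_nonneg) (simp add: less_imp_le)

lemma prob_post: "prob_space post"
proof (rule prob_spaceI)
  have "(\<integral>\<^sup>+\<eta>. ennreal (L \<eta> / Z) \<partial>Q) = ennreal (\<integral>\<eta>. L \<eta> / Z \<partial>Q)"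
    using L_integrable L0 Z_pos by (intro nn_integral_eq_integral) (auto simp: less_imp_le)
  also have "\<dots> = 1" using Z_pos by (simp add: Z_def[symmetric])
  finally show "emeasure post (space post) = 1" by (simp add: post_def emeasure_density cong: nn_integral_cong)
qed

lemma prob_cpost: "ZA > 0 \<Longrightarrow> prob_space cpost"
proof (rule prob_spaceI)
  assume p: "ZA > 0"
  have "(\<integral>\<^sup>+\<eta>. ennreal (indicator A \<eta> * L \<eta> / ZA) \<partial>Q) = ennreal (\<integral>\<eta>. indicator A \<eta> * L \<eta> / ZA \<partial>Q)"
    using L_integrable L0 p by (intro nn_integral_eq_integral) (auto simp: less_imp_le)
  also have "\<dots> = 1" using p by (simp add: ZA_def[symmetric])
  finally show "emeasure cpost (space cpost) = 1" by (simp add: cpost_def emeasure_density cong: nn_integral_cong)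
qed

lemma measure_post_A: "measure post A = ZA / Z"
proof -
  have "emeasure post A = (\<integral>\<^sup>+\<eta>. ennreal (indicator A \<eta> * L \<eta> / Z) \<partial>Q)"
    unfolding post_def by (subst emeasure_density) (auto intro!: nn_integral_cong simp: indicator_def)
  also have "\<dots> = ennreal (\<integral>\<eta>. indicator A \<eta> * L \<eta> / Z \<partial>Q)"
    using L_integrable L0 Z_pos by (intro nn_integral_eq_integral) (auto simp: less_imp_le)
  also have "\<dots> = ennreal (ZA / Z)" by (simp add: ZA_def)
  finally show ?thesis using ZA_nonneg Z_pos by (intro measure_eq_emeasure_eq_ennreal) auto
qed

lemma integral_post:
  fixes \<phi> :: "'e \<Rightarrow> real"
  shows "\<phi> \<in> borel_measurable Q \<Longrightarrow> (\<integral>\<eta>. \<phi> \<eta> \<partial>post) = (\<integral>\<eta>. L \<eta> / Z * \<phi> \<eta> \<partial>Q)"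
  unfolding post_def using L0 Z_pos by (subst integral_density) (auto simp: less_imp_le)

lemma integral_cpost:
  fixes \<phi> :: "'e \<Rightarrow> real"
  shows "\<phi> \<in> borel_measurable Q \<Longrightarrow> ZA > 0 \<Longrightarrow> (\<integral>\<eta>. \<phi> \<eta> \<partial>cpost) = (\<integral>\<eta>. indicator A \<eta> * L \<eta> / ZA * \<phi> \<eta> \<partial>Q)"
  unfolding cpost_def using L0 by (subst integral_density) (auto simp: less_imp_le)

text \<open>One \<kappa> is the posterior mass outside \<open>A\<close>, the other the effect of
  renormalising by \<open>ZA\<close> in place of \<open>Z\<close>; \<open>e\<close> is the error on
  \<open>A\<close> itself.\<close>

lemma conditioning_le:
  assumes \<phi>[measurable]: "\<phi> \<in> borel_measurable Q" and \<psi>[measurable]: "\<psi> \<in> borel_measurable Q"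
    and b1: "\<And>\<eta>. \<eta> \<in> space Q \<Longrightarrow> \<bar>\<phi> \<eta>\<bar> \<le> 1" and b2: "\<And>\<eta>. \<eta> \<in> space Q \<Longrightarrow> \<bar>\<psi> \<eta>\<bar> \<le> (1::real)"
    and close: "AE \<eta> in Q. \<eta> \<in> A \<longrightarrow> \<bar>\<phi> \<eta> - \<psi> \<eta>\<bar> \<le> e" and e: "e \<ge> 0"
    and \<kappa>: "1 - \<kappa> \<le> measure post A" "\<kappa> < 1"
  shows "\<bar>(\<integral>\<eta>. \<phi> \<eta> \<partial>post) - (\<integral>\<eta>. \<psi> \<eta> \<partial>cpost)\<bar> \<le> 2 * \<kappa> + e"
proof -
  have Zp: "ZA > 0"
  proof -
    have "ZA / Z > 0" using \<kappa> unfolding measure_post_A by linarith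
    then show ?thesis using Z_pos by (simp add: zero_less_divide_iff)
  qed
  have ZZ: "ZA \<le> Z" unfolding ZA_def Z_def using L_integrable L0
    by (intro integral_mono) (auto simp: indicator_def less_imp_le)
  have i1: "integrable Q (\<lambda>\<eta>. L \<eta> / Z * \<phi> \<eta>)"
    using L0 L1 Z_pos b1 by (intro bounded_integrable[where B="1 / Z * 1"]) (auto simp: abs_mult less_imp_le intro!: mult_le_one divide_right_mono)
  have i2: "integrable Q (\<lambda>\<eta>. indicator A \<eta> * L \<eta> / ZA * \<psi> \<eta>)"
    using L0 L1 Zp b2 by (intro bounded_integrable[where B="1 / ZA * 1"]) (auto simp: abs_mult less_imp_le indicator_def intro!: mult_le_one divide_right_mono)
  \<comment> \<open>In this order: the mass outside \<open>A\<close>, the renormalisation on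
    \<open>A\<close>, and the error \<open>e\<close> against the conditioned density.\<close>
  let ?r = "\<lambda>\<eta>. L \<eta> / Z - indicator A \<eta> * L \<eta> / Z + (indicator A \<eta> * L \<eta> / ZA - indicator A \<eta> * L \<eta> / Z) + e * (indicator A \<eta> * L \<eta> / ZA)"
  have "\<bar>(\<integral>\<eta>. \<phi> \<eta> \<partial>post) - (\<integral>\<eta>. \<psi> \<eta> \<partial>cpost)\<bar> = \<bar>\<integral>\<eta>. L \<eta> / Z * \<phi> \<eta> - indicator A \<eta> * L \<eta> / ZA * \<psi> \<eta> \<partial>Q\<bar>"
    using i1 i2 Zp by (simp add: integral_post integral_cpost)
  also have "\<dots> \<le> (\<integral>\<eta>. \<bar>L \<eta> / Z * \<phi> \<eta> - indicator A \<eta> * L \<eta> / ZA * \<psi> \<eta>\<bar> \<partial>Q)" by (rule integral_abs_bound)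
  also have "\<dots> \<le> (\<integral>\<eta>. ?r \<eta> \<partial>Q)"
  proof (rule integral_mono_AE)
    show "integrable Q (\<lambda>\<eta>. \<bar>L \<eta> / Z * \<phi> \<eta> - indicator A \<eta> * L \<eta> / ZA * \<psi> \<eta>\<bar>)" using i1 i2 by auto
    show "integrable Q ?r" using L_integrable
      by (intro Bochner_Integration.integrable_add Bochner_Integration.integrable_diff integrable_mult_right integrable_divide_zero) auto
    show "AE \<eta> in Q. \<bar>L \<eta> / Z * \<phi> \<eta> - indicator A \<eta> * L \<eta> / ZA * \<psi> \<eta>\<bar> \<le> ?r \<eta>"
      using close AE_space
    proof eventually_elim
      case (elim \<eta>)
      show ?case
      proof (cases "\<eta> \<in> A")
        case True
        have le: "L \<eta> / Z \<le> L \<eta> / ZA" using L0[of \<eta>] ZZ Zp by (intro divide_left_mono) auto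
        have "L \<eta> / Z * \<phi> \<eta> - L \<eta> / ZA * \<psi> \<eta> = (L \<eta> / Z - L \<eta> / ZA) * \<phi> \<eta> + L \<eta> / ZA * (\<phi> \<eta> - \<psi> \<eta>)"
          by (simp only: left_diff_distrib right_diff_distrib)
        also have "\<bar>\<dots>\<bar> \<le> \<bar>L \<eta> / Z - L \<eta> / ZA\<bar> * \<bar>\<phi> \<eta>\<bar> + \<bar>L \<eta> / ZA\<bar> * \<bar>\<phi> \<eta> - \<psi> \<eta>\<bar>"
          unfolding abs_mult[symmetric] by (rule abs_triangle_ineq)
        also have "\<dots> \<le> \<bar>L \<eta> / Z - L \<eta> / ZA\<bar> * 1 + \<bar>L \<eta> / ZA\<bar> * e"
          using elim b1 True by (intro add_mono mult_left_mono) auto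
        also have "\<dots> = (L \<eta> / ZA - L \<eta> / Z) + e * (L \<eta> / ZA)" using le L0[of \<eta>] Zp by simp
        finally show ?thesis using True by simp
      next
        case False
        have "\<bar>L \<eta> / Z * \<phi> \<eta>\<bar> \<le> L \<eta> / Z * 1"
          unfolding abs_mult using L0[of \<eta>] Z_pos b1[OF elim(2)] by (intro mult_mono) auto
        then show ?thesis using False by simp
      qed
    qed
  qed
  also have "\<dots> = (Z / Z - ZA / Z) + (ZA / ZA - ZA / Z) + e * (ZA / ZA)"
  proof -
    have i: "integrable Q (\<lambda>\<eta>. L \<eta> / Z)" "integrable Q (\<lambda>\<eta>. indicator A \<eta> * L \<eta> / Z)" "integrable Q (\<lambda>\<eta>. indicator A \<eta> * L \<eta> / ZA)"
      using L_integrable by (intro integrable_divide_zero; simp)+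
    have v: "(\<integral>\<eta>. L \<eta> / Z \<partial>Q) = Z / Z" "(\<integral>\<eta>. indicator A \<eta> * L \<eta> / Z \<partial>Q) = ZA / Z" "(\<integral>\<eta>. indicator A \<eta> * L \<eta> / ZA \<partial>Q) = ZA / ZA"
      by (simp_all only: integral_divide_zero Z_def[symmetric] ZA_def[symmetric])
    show ?thesis
      by (simp only: Bochner_Integration.integral_add Bochner_Integration.integral_diff integral_mult_right_zero i v
          Bochner_Integration.integrable_add Bochner_Integration.integrable_diff integrable_mult_right)
  qed
  also have "\<dots> = 2 * (1 - measure post A) + e" using Z_pos Zp by (simp add: measure_post_A)
  also have "\<dots> \<le> 2 * \<kappa> + e" using \<kappa> by simp
  finally show ?thesis .
qed

text \<open>Under the posterior, \<eta> and F are independent, so F is integrated out for each fixed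
  \<eta>. There the Dirichlet part is replaced by a Gaussian, and what remains is to condition a
  bounded function of \<eta> on \<open>A\<close>.\<close>

lemma mixture_close:
  assumes D: "prob_space D" and W: "(\<lambda>p. W (fst p) (snd p)) \<in> borel_measurable (Q \<Otimes>\<^sub>M D)"
    and U: "U \<in> borel_measurable Q" and f: "f \<in> BL1"
    and close: "AE \<eta> in Q. \<eta> \<in> A \<longrightarrow> \<bar>(\<integral>F. f (W \<eta> F) \<partial>D) - (\<integral>y. f (U \<eta> + y) \<partial>gauss \<sigma>)\<bar> \<le> e" and e: "e \<ge> 0"
    and \<kappa>: "1 - \<kappa> \<le> measure post A" "\<kappa> < 1"
  shows "\<bar>(\<integral>x. f x \<partial>distr (post \<Otimes>\<^sub>M D) borel (\<lambda>p. W (fst p) (snd p))) - (\<integral>x. f x \<partial>distr (cpost \<Otimes>\<^sub>M gauss \<sigma>) borel (\<lambda>p. U (fst p) + snd p))\<bar> \<le> 2 * \<kappa> + e"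
proof -
  interpret D: prob_space D by fact
  interpret post: prob_space post by (rule prob_post)
  have "ZA / Z > 0" using \<kappa> unfolding measure_post_A by linarith
  then have Zp: "ZA > 0" using Z_pos by (simp add: zero_less_divide_iff)
  interpret cpost: prob_space cpost using Zp by (rule prob_cpost)
  interpret G: real_distribution "gauss \<sigma>" by (rule gauss_real_distribution)
  interpret PD: pair_prob_space post D ..
  interpret CG: pair_prob_space cpost "gauss \<sigma>" ..
  have sp: "sets post = sets Q" "sets cpost = sets Q" by (simp_all add: post_def cpost_def)
  note [measurable] = BL1_measurable[OF f] U
  note [measurable_cong] = sp
  have W'[measurable]: "(\<lambda>p. W (fst p) (snd p)) \<in> borel_measurable (post \<Otimes>\<^sub>M D)"
    using W by (simp add: measurable_cong_sets[OF sets_pair_measure_cong[OF sp(1) refl] refl])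
  have fW: "(\<lambda>p. f (W (fst p) (snd p))) \<in> borel_measurable (Q \<Otimes>\<^sub>M D)"
    by (rule measurable_compose[OF W BL1_measurable[OF f]])
  have fU: "(\<lambda>p. f (U (fst p) + snd p)) \<in> borel_measurable (Q \<Otimes>\<^sub>M gauss \<sigma>)" by measurable
  have bD: "\<bar>\<integral>F. f (W \<eta> F) \<partial>D\<bar> \<le> 1" for \<eta>
  proof -
    have "\<bar>\<integral>F. f (W \<eta> F) \<partial>D\<bar> \<le> (\<integral>F. \<bar>f (W \<eta> F)\<bar> \<partial>D)" by (rule integral_abs_bound)
    also have "\<dots> \<le> 1"
    proof (cases "integrable D (\<lambda>F. \<bar>f (W \<eta> F)\<bar>)")
      case True then show ?thesis using BL1_bound[OF f] by (intro D.integral_le_const) auto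
    qed (simp add: not_integrable_integral_eq)
    finally show ?thesis .
  qed
  have bG: "\<bar>\<integral>y. f (U \<eta> + y) \<partial>gauss \<sigma>\<bar> \<le> 1" for \<eta>
  proof -
    have i: "integrable (gauss \<sigma>) (\<lambda>y. \<bar>f (U \<eta> + y)\<bar>)"
      using BL1_bound[OF f] by (intro G.integrable_const_bound[where B=1]) auto
    have "\<bar>\<integral>y. f (U \<eta> + y) \<partial>gauss \<sigma>\<bar> \<le> (\<integral>y. \<bar>f (U \<eta> + y)\<bar> \<partial>gauss \<sigma>)" by (rule integral_abs_bound)
    also have "\<dots> \<le> 1" using i BL1_bound[OF f] by (intro G.integral_le_const) auto
    finally show ?thesis .
  qed
  have "(\<integral>x. f x \<partial>distr (post \<Otimes>\<^sub>M D) borel (\<lambda>p. W (fst p) (snd p))) = (\<integral>p. f (W (fst p) (snd p)) \<partial>(post \<Otimes>\<^sub>M D))"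
    by (subst integral_distr) auto
  also have "\<dots> = (\<integral>\<eta>. (\<integral>F. f (W \<eta> F) \<partial>D) \<partial>post)"
  proof (subst PD.integral_fst'[symmetric])
    show "integrable (post \<Otimes>\<^sub>M D) (\<lambda>p. f (W (fst p) (snd p)))"
      using BL1_bound[OF f] by (intro PD.P.integrable_const_bound[where B=1]) auto
  qed simp
  finally have e1: "(\<integral>x. f x \<partial>distr (post \<Otimes>\<^sub>M D) borel (\<lambda>p. W (fst p) (snd p))) = (\<integral>\<eta>. (\<integral>F. f (W \<eta> F) \<partial>D) \<partial>post)" .
  have "(\<integral>x. f x \<partial>distr (cpost \<Otimes>\<^sub>M gauss \<sigma>) borel (\<lambda>p. U (fst p) + snd p)) = (\<integral>p. f (U (fst p) + snd p) \<partial>(cpost \<Otimes>\<^sub>M gauss \<sigma>))"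
    by (subst integral_distr) auto
  also have "\<dots> = (\<integral>\<eta>. (\<integral>y. f (U \<eta> + y) \<partial>gauss \<sigma>) \<partial>cpost)"
  proof (subst CG.integral_fst'[symmetric])
    show "integrable (cpost \<Otimes>\<^sub>M gauss \<sigma>) (\<lambda>p. f (U (fst p) + snd p))"
      using BL1_bound[OF f] by (intro CG.P.integrable_const_bound[where B=1]) auto
  qed simp
  finally have e2: "(\<integral>x. f x \<partial>distr (cpost \<Otimes>\<^sub>M gauss \<sigma>) borel (\<lambda>p. U (fst p) + snd p)) = (\<integral>\<eta>. (\<integral>y. f (U \<eta> + y) \<partial>gauss \<sigma>) \<partial>cpost)" .
  show ?thesis unfolding e1 e2
  proof (rule conditioning_le[OF _ _ bD bG close e \<kappa>])
    show "(\<lambda>\<eta>. \<integral>F. f (W \<eta> F) \<partial>D) \<in> borel_measurable Q"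
      using D.borel_measurable_lebesgue_integral[of "\<lambda>\<eta> F. f (W \<eta> F)" Q] fW by (simp add: split_beta')
    show "(\<lambda>\<eta>. \<integral>y. f (U \<eta> + y) \<partial>gauss \<sigma>) \<in> borel_measurable Q"
      using G.borel_measurable_lebesgue_integral[of "\<lambda>\<eta> y. f (U \<eta> + y)" Q] fU by (simp add: split_beta')
  qed
qed

text \<open>A change of measure: \<open>L * exp (t * U) = Lt * exp (t * U + q)\<close>, and on
  \<open>A\<close> the exponent stays within \<open>k\<close> of the constant \<open>v\<close>. The
  transform is thus \<open>exp v\<close>, up to a factor between \<open>exp (- k)\<close> and
  \<open>exp k\<close>, times the likelihood ratio, which is within \<kappa> of 1.\<close>

lemma mgf_tilt:
  assumes U[measurable]: "U \<in> borel_measurable Q" and UB: "\<And>\<eta>. \<eta> \<in> space Q \<Longrightarrow> \<bar>U \<eta>\<bar> \<le> B"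
    and Zp: "ZA > 0" and Lt[measurable]: "Lt \<in> borel_measurable Q" and Lt01: "\<And>\<eta>. 0 < Lt \<eta>" "\<And>\<eta>. Lt \<eta> \<le> (1::real)"
    and tilt: "AE \<eta> in Q. \<eta> \<in> A \<longrightarrow> (\<exists>q. L \<eta> = Lt \<eta> * exp q \<and> \<bar>t * U \<eta> + q - v\<bar> \<le> k)"
    and ratio: "\<bar>(\<integral>\<eta>. indicator A \<eta> * Lt \<eta> \<partial>Q) / ZA - 1\<bar> \<le> \<kappa>"
  obtains m where "has_bochner_integral cpost (\<lambda>\<eta>. exp (t * U \<eta>)) m" "exp (v - k) * (1 - \<kappa>) \<le> m" "m \<le> exp (v + k) * (1 + \<kappa>)"
proof
  interpret cpost: prob_space cpost using Zp by (rule prob_cpost)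
  let ?e = "\<lambda>\<eta>. exp (t * U \<eta>)"
  have eB: "?e \<eta> \<le> exp (\<bar>t\<bar> * B)" if "\<eta> \<in> space Q" for \<eta>
  proof -
    have "t * U \<eta> \<le> \<bar>t\<bar> * \<bar>U \<eta>\<bar>" by (metis abs_ge_self abs_mult)
    also have "\<dots> \<le> \<bar>t\<bar> * B" using UB[OF that] by (intro mult_left_mono) auto
    finally show ?thesis by simp
  qed
  have sp: "sets cpost = sets Q" "space cpost = space Q" by (simp_all add: cpost_def)
  have "integrable cpost ?e"
    using eB sp by (intro cpost.integrable_const_bound[where B="exp (\<bar>t\<bar> * B)"]) (auto simp: measurable_cong_sets[OF sp(1) refl])
  then show "has_bochner_integral cpost ?e (\<integral>\<eta>. ?e \<eta> \<partial>cpost)" by (rule has_bochner_integral_integrable)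
  have "L \<eta> * ?e \<eta> \<le> 1 * exp (\<bar>t\<bar> * B)" if "\<eta> \<in> space Q" for \<eta>
    using L0[of \<eta>] L1 eB[OF that] by (intro mult_mono) auto
  then have ie: "integrable Q (\<lambda>\<eta>. indicator A \<eta> * (L \<eta> * ?e \<eta>))"
    using L0 by (intro bounded_integrable[where B="exp (\<bar>t\<bar> * B)"]) (auto simp: abs_mult less_imp_le indicator_def)
  have il: "integrable Q (\<lambda>\<eta>. indicator A \<eta> * Lt \<eta>)"
    using Lt01 by (intro bounded_integrable[where B=1]) (auto simp: less_imp_le abs_mult indicator_def)
  have pt: "AE \<eta> in Q. exp (v - k) * (indicator A \<eta> * Lt \<eta>) \<le> indicator A \<eta> * (L \<eta> * ?e \<eta>) \<and> indicator A \<eta> * (L \<eta> * ?e \<eta>) \<le> exp (v + k) * (indicator A \<eta> * Lt \<eta>)"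
    using tilt
  proof eventually_elim
    case (elim \<eta>)
    show ?case
    proof (cases "\<eta> \<in> A")
      case True
      then obtain q where q: "L \<eta> = Lt \<eta> * exp q" "\<bar>t * U \<eta> + q - v\<bar> \<le> k" using elim by blast
      have eq: "L \<eta> * ?e \<eta> = Lt \<eta> * exp (t * U \<eta> + q)" unfolding q(1) by (simp add: exp_add)
      have "exp (v - k) \<le> exp (t * U \<eta> + q)" "exp (t * U \<eta> + q) \<le> exp (v + k)" using q(2) by auto
      then show ?thesis using True Lt01(1)[of \<eta>] unfolding eq by (simp add: mult.commute)
    qed simp
  qed
  define Zt where "Zt = (\<integral>\<eta>. indicator A \<eta> * Lt \<eta> \<partial>Q)"
  have m: "(\<integral>\<eta>. ?e \<eta> \<partial>cpost) = (\<integral>\<eta>. indicator A \<eta> * (L \<eta> * ?e \<eta>) \<partial>Q) / ZA"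
    using Zp by (subst integral_cpost) (auto simp: mult.assoc)
  have r: "1 - \<kappa> \<le> Zt / ZA" "Zt / ZA \<le> 1 + \<kappa>" using ratio unfolding Zt_def by linarith+
  have "exp (v - k) * Zt = (\<integral>\<eta>. exp (v - k) * (indicator A \<eta> * Lt \<eta>) \<partial>Q)" by (simp add: Zt_def)
  also have "\<dots> \<le> (\<integral>\<eta>. indicator A \<eta> * (L \<eta> * ?e \<eta>) \<partial>Q)"
    using pt ie il by (intro integral_mono_AE) (auto elim: eventually_mono)
  finally have "exp (v - k) * Zt / ZA \<le> (\<integral>\<eta>. ?e \<eta> \<partial>cpost)" unfolding m using Zp by (intro divide_right_mono) auto
  moreover have "exp (v - k) * (1 - \<kappa>) \<le> exp (v - k) * (Zt / ZA)" using r by (intro mult_left_mono) auto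
  ultimately show "exp (v - k) * (1 - \<kappa>) \<le> (\<integral>\<eta>. ?e \<eta> \<partial>cpost)" by simp
  have "(\<integral>\<eta>. indicator A \<eta> * (L \<eta> * ?e \<eta>) \<partial>Q) \<le> (\<integral>\<eta>. exp (v + k) * (indicator A \<eta> * Lt \<eta>) \<partial>Q)"
    using pt ie il by (intro integral_mono_AE) (auto elim: eventually_mono)
  also have "\<dots> = exp (v + k) * Zt" by (simp add: Zt_def)
  finally have "(\<integral>\<eta>. ?e \<eta> \<partial>cpost) \<le> exp (v + k) * Zt / ZA" unfolding m using Zp by (intro divide_right_mono) auto
  moreover have "exp (v + k) * (Zt / ZA) \<le> exp (v + k) * (1 + \<kappa>)" using r by (intro mult_left_mono) auto
  ultimately show "(\<integral>\<eta>. ?e \<eta> \<partial>cpost) \<le> exp (v + k) * (1 + \<kappa>)" by simp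
qed

end

lemma d_BL_nonneg:
  assumes "prob_space \<mu>" "prob_space \<nu>"
  shows "0 \<le> d_BL \<mu> \<nu>"
proof -
  obtain f where "f \<in> BL1" using BL1_nonempty by auto
  from d_BL_ge[OF assms this] show ?thesis by (meson abs_ge_zero order_trans)
qed

section \<open>Assembly on one good event\<close>

context causal_sieve
begin

lemma eval_measurable:
  "(\<lambda>\<eta>. fst \<eta> z) \<in> borel_measurable Q" "(\<lambda>\<eta>. snd \<eta> z) \<in> borel_measurable Q"
proof -
  have p: "(\<lambda>\<eta>. (\<eta>, z)) \<in> measurable Q (Q \<Otimes>\<^sub>M borel)" by measurable
  have m: "(\<lambda>(\<eta>, z). fst \<eta> z) \<in> borel_measurable (Q \<Otimes>\<^sub>M borel)" "(\<lambda>(\<eta>, z). snd \<eta> z) \<in> borel_measurable (Q \<Otimes>\<^sub>M borel)"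
    using Q unfolding eta_prior_def by blast+
  show "(\<lambda>\<eta>. fst \<eta> z) \<in> borel_measurable Q"
    using measurable_compose[OF p m(1)] by simp
  show "(\<lambda>\<eta>. snd \<eta> z) \<in> borel_measurable Q"
    using measurable_compose[OF p m(2)] by simp
qed

lemma likelihood_shift_measurable: "(\<lambda>\<eta>. likelihood n x (eta_shift a0 n t \<eta>)) \<in> borel_measurable Q"
proof -
  note [measurable] = eval_measurable
  have "(\<lambda>\<eta>. cond_density (a_of (eta_shift a0 n t \<eta>)) (b_of (eta_shift a0 n t \<eta>)) w) \<in> borel_measurable Q" for w
    unfolding cond_density_def a_of_def b_of_def eta_shift_def Psi_def split_beta' by simp measurable
  then show ?thesis unfolding likelihood_def by (intro borel_measurable_prod)
qed

lemma likelihood_measurable: "(\<lambda>\<eta>. likelihood n x \<eta>) \<in> borel_measurable Q"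
proof -
  have "eta_shift a0 n 0 = (\<lambda>\<eta>. \<eta>)" by (auto simp: eta_shift_def)
  then show ?thesis using likelihood_shift_measurable[of n x 0] by simp
qed

lemma likelihood_weighted_prior: "weighted_prior Q (likelihood n x) (H n)"
  by unfold_locales (auto simp: likelihood_measurable likelihood_pos likelihood_le_1)

text \<open>As \<open>b_of\<close> is nonnegative, the functional is a nonnegative integral against
  the kernel \<open>snd\<close>, and such integrals are jointly measurable in \<eta> and F.\<close>

lemma chi_measurable2:
  assumes D: "sets D = sets (prob_algebra borel)"
  shows "(\<lambda>p. chi (b_of (fst p)) (snd p)) \<in> borel_measurable (Q \<Otimes>\<^sub>M D)"
proof -
  let ?N = "Q \<Otimes>\<^sub>M D"
  have spD: "space D = space (prob_algebra borel)" using D by (rule sets_eq_imp_space_eq)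
  have snd: "snd \<in> measurable ?N (subprob_algebra borel)"
    by (rule measurable_compose[OF measurable_snd]) (use measurable_prob_algebraD[OF measurable_ident_sets[OF D]] in \<open>simp add: id_def\<close>)
  have fb: "(\<lambda>(p, z). ennreal (b_of (fst p) z)) \<in> borel_measurable (?N \<Otimes>\<^sub>M borel)"
  proof -
    have "(\<lambda>q. (fst (fst q), snd q)) \<in> measurable (?N \<Otimes>\<^sub>M (borel :: 'z measure)) (Q \<Otimes>\<^sub>M borel)" by measurable
    from measurable_compose[OF this b_of_measurable2] show ?thesis by (simp add: split_beta')
  qed
  have "(\<lambda>p. enn2real (\<integral>\<^sup>+z. ennreal (b_of (fst p) z) \<partial>snd p)) \<in> borel_measurable ?N"
    using nn_integral_measurable_subprob_algebra2[OF fb snd] by measurable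
  then show ?thesis
  proof (rule measurable_cong[THEN iffD1, rotated])
    fix p assume p: "p \<in> space ?N"
    then have s: "sets (snd p) = sets borel" "fst p \<in> space Q" using spD by (auto simp: space_pair_measure space_prob_algebra)
    then show "enn2real (\<integral>\<^sup>+z. ennreal (b_of (fst p) z) \<partial>snd p) = chi (b_of (fst p)) (snd p)"
      unfolding chi_def using b_of_measurable[OF s(2)]
      by (subst integral_eq_nn_integral) (simp_all add: b_of_bounds measurable_cong_sets[OF s(1) refl])
  qed
qed

text \<open>Sample, sample size and tolerance are fixed, and every probabilistic input appears as an
  inequality. The posterior is within \<open>2 * \<kappa> + e / 4\<close>, at most
  \<open>e / 2\<close>, of an intermediate law, and that law is within \<open>e / 4\<close> of the
  limit.\<close>

lemma d_BL_on_good_event: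
  fixes x :: "nat \<Rightarrow> 'z obs" and c :: real
  defines "z i \<equiv> fst (x i)" and "r i \<equiv> of_bool (fst (snd (x i))) :: real"
  assumes n: "n \<ge> 1" and DP: "dirichlet_process \<alpha> D"
    and \<kappa>: "0 < \<kappa>" "\<kappa> < 1" and e: "\<kappa> \<le> e / 8" and \<kappa>d: "7 * \<kappa> \<le> \<kappa>d"
    and clt: "\<And>b f u. b \<in> borel_measurable borel \<Longrightarrow> (\<forall>z. 0 \<le> b z \<and> b z \<le> 1) \<Longrightarrow>
      \<bar>(\<Sum>i<n. (b (z i) - (\<Sum>i<n. b (z i)) / n)\<^sup>2) / n - V2\<bar> \<le> \<kappa>d \<Longrightarrow> f \<in> BL1 \<Longrightarrow>
      \<bar>(\<integral>F. f (u + sqrt n * (chi b F - (\<Sum>i<n. b (z i)) / n)) \<partial>D) - (\<integral>y. f (u + y) \<partial>gauss (sqrt V2))\<bar> \<le> e / 4"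
    and cl: "\<And>\<mu>. real_distribution \<mu> \<Longrightarrow>
       (\<And>t. t \<in> T \<Longrightarrow> integrable \<mu> (\<lambda>x. exp (t * x)) \<and> \<bar>(\<integral>x. exp (t * x) \<partial>\<mu>) - (\<integral>x. exp (t * x) \<partial>gauss (sqrt (V1 + V2)))\<bar> < \<delta>) \<Longrightarrow>
       d_BL \<mu> (gauss (sqrt (V1 + V2))) < e / 4"
    and tk: "\<And>t. t \<in> T \<Longrightarrow> \<bar>t\<bar> ^ 3 * Ka ^ 3 / sqrt n \<le> \<kappa> \<and>
       exp (t\<^sup>2 * (V1 + V2) / 2 + \<kappa> * (1 + 2 * \<bar>t\<bar> + t\<^sup>2 * (Ka\<^sup>2 + 1) / 2)) * (1 + \<kappa>) < exp (t\<^sup>2 * (V1 + V2) / 2) + \<delta> \<and>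
       exp (t\<^sup>2 * (V1 + V2) / 2) - \<delta> < exp (t\<^sup>2 * (V1 + V2) / 2 - \<kappa> * (1 + 2 * \<bar>t\<bar> + t\<^sup>2 * (Ka\<^sup>2 + 1) / 2)) * (1 - \<kappa>)"
    and supp: "\<And>i. i < n \<Longrightarrow> snd (snd (x i)) \<longrightarrow> fst (snd (x i))"
    and c: "\<bar>sqrt n * (c - (chi b0 F0 + (\<Sum>i<n. influence a0 b0 F0 (x i)) / n))\<bar> \<le> \<kappa>"
    and unif: "AE \<eta> in Q. \<eta> \<in> H n \<longrightarrow> \<bar>\<Sum>i<n. (r i * a0 (z i) - 1) * gg \<eta> (z i)\<bar> \<le> \<kappa> * sqrt n \<and> (\<Sum>i<n. (gg \<eta> (z i))\<^sup>2) / n \<le> \<kappa>\<^sup>2"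
    and V: "\<bar>(\<Sum>i<n. r i * (a0 (z i))\<^sup>2 * b0 (z i) * (1 - b0 (z i))) / n - V1\<bar> \<le> \<kappa>"
    and l1: "\<bar>(\<Sum>i<n. b0 (z i)) / n - chi b0 F0\<bar> \<le> \<kappa>"
    and l2: "\<bar>(\<Sum>i<n. (b0 (z i))\<^sup>2) / n - (\<integral>z. (b0 z)\<^sup>2 \<partial>F0)\<bar> \<le> \<kappa>"
    and post: "1 - \<kappa> \<le> measure (eta_posterior Q n x) (H n)"
    and ratio: "\<And>t. t \<in> T \<Longrightarrow> \<bar>(LINT \<eta>:H n|Q. likelihood n x (eta_shift a0 n t \<eta>)) / (LINT \<eta>:H n|Q. likelihood n x \<eta>) - 1\<bar> \<le> \<kappa>"
  shows "\<bar>d_BL (chi_posterior Q D n x c) (normal_law 0 (eff_var a0 b0 F0))\<bar> \<le> e"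
proof -
  interpret wp: weighted_prior Q "likelihood n x" "H n" by (rule likelihood_weighted_prior)
  from DP have pD: "prob_space D" and sD: "sets D = sets (prob_algebra borel)"
    by (auto simp: dirichlet_process_def)
  interpret D: prob_space D by fact
  have pe: "eta_posterior Q n x = wp.post" by (simp add: eta_posterior_def wp.post_def wp.Z_def)
  have post': "1 - \<kappa> \<le> measure wp.post (H n)" using post by (simp add: pe)
  have "wp.ZA / wp.Z > 0" using post' \<kappa> unfolding wp.measure_post_A by linarith
  then have Zp: "wp.ZA > 0" using wp.Z_pos by (simp add: zero_less_divide_iff)
  define U where "U \<eta> = sqrt n * ((\<Sum>i<n. b_of \<eta> (z i)) / n - c)" for \<eta>
  define W where "W \<eta> F = sqrt n * (chi (b_of \<eta>) F - c)" for \<eta> :: "'z eta" and F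
  define v where "v = (V1 + V2)"
  have vpos: "v > 0" using V1_pos V2_nonneg by (simp add: v_def)
  have nl: "normal_law 0 (eff_var a0 b0 F0) = gauss (sqrt (V1 + V2))"
    using normal_law_eq_gauss[OF vpos] by (simp add: eff_var_eq v_def)
  have bm: "(\<lambda>\<eta>. b_of \<eta> y) \<in> borel_measurable Q" for y
    unfolding b_of_def Psi_def using eval_measurable by measurable
  have Um[measurable]: "U \<in> borel_measurable Q" unfolding U_def using bm by measurable
  \<comment> \<open>The bound grows with \<open>n\<close>; it only secures the existence of
    exponential moments.\<close>
  have UB: "\<bar>U \<eta>\<bar> \<le> sqrt n * (1 + \<bar>c\<bar>)" for \<eta>
  proof -
    have "\<bar>\<Sum>i<n. b_of \<eta> (z i)\<bar> \<le> (\<Sum>i<n. 1)"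
      by (intro order.trans[OF sum_abs] sum_mono) (simp add: b_of_bounds)
    then have "\<bar>(\<Sum>i<n. b_of \<eta> (z i)) / n\<bar> \<le> 1" using n by simp
    then have "\<bar>(\<Sum>i<n. b_of \<eta> (z i)) / n - c\<bar> \<le> 1 + \<bar>c\<bar>" by linarith
    then show ?thesis unfolding U_def abs_mult by (intro mult_mono) auto
  qed
  have Wm: "(\<lambda>p. W (fst p) (snd p)) \<in> borel_measurable (Q \<Otimes>\<^sub>M D)"
    unfolding W_def using chi_measurable2[OF sD] by measurable
  have cp: "chi_posterior Q D n x c = distr (wp.post \<Otimes>\<^sub>M D) borel (\<lambda>p. W (fst p) (snd p))"
    by (simp add: chi_posterior_def pe W_def split_beta')
  \<comment> \<open>The intermediate law: \<eta> is drawn from the conditioned posterior, and the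
    Dirichlet part is an independent Gaussian of variance \<open>V2\<close>.\<close>
  define \<mu> where "\<mu> = distr (wp.cpost \<Otimes>\<^sub>M gauss (sqrt V2)) borel (\<lambda>p. U (fst p) + snd p)"
  interpret cpost: prob_space wp.cpost using Zp by (rule wp.prob_cpost)
  interpret G: real_distribution "gauss (sqrt V2)" by (rule gauss_real_distribution)
  interpret CG: pair_prob_space wp.cpost "gauss (sqrt V2)" ..
  interpret post: prob_space wp.post by (rule wp.prob_post)
  interpret PD: pair_prob_space wp.post D ..
  have sc: "sets wp.cpost = sets Q" "sets wp.post = sets Q" by (simp_all add: wp.cpost_def wp.post_def)
  have Uc[measurable]: "U \<in> borel_measurable wp.cpost" using Um by (simp add: measurable_cong_sets[OF sc(1) refl])
  have rd: "real_distribution \<mu>" unfolding \<mu>_def by (rule CG.real_distribution_distr) measurable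
  have prob_cp: "prob_space (chi_posterior Q D n x c)"
    unfolding cp using Wm by (intro PD.P.prob_space_distr) (simp add: measurable_cong_sets[OF sets_pair_measure_cong[OF sc(2) refl] refl])
  have d2: "d_BL \<mu> (gauss (sqrt (V1 + V2))) < e / 4"
  proof (rule cl[OF rd])
    fix t assume t: "t \<in> T"
    \<comment> \<open>The summand 1 absorbs the Taylor remainder, which is at most \<kappa> by
      \<open>tk\<close>.\<close>
    define k where "k = \<kappa> * (1 + 2 * \<bar>t\<bar> + t\<^sup>2 * (Ka\<^sup>2 + 1) / 2)"
    have tilt: "AE \<eta> in Q. \<eta> \<in> H n \<longrightarrow> (\<exists>q. likelihood n x \<eta> = likelihood n x (eta_shift a0 n t \<eta>) * exp q \<and> \<bar>t * U \<eta> + q - t\<^sup>2 * V1 / 2\<bar> \<le> k)"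
      using unif
    proof (rule AE_mp, intro AE_I2 impI)
      fix \<eta> assume "\<eta> \<in> H n \<longrightarrow> \<bar>\<Sum>i<n. (r i * a0 (z i) - 1) * gg \<eta> (z i)\<bar> \<le> \<kappa> * sqrt n \<and> (\<Sum>i<n. (gg \<eta> (z i))\<^sup>2) / n \<le> \<kappa>\<^sup>2" and "\<eta> \<in> H n"
      then have h: "\<bar>\<Sum>i<n. (r i * a0 (z i) - 1) * (b_of \<eta> (z i) - b0 (z i))\<bar> \<le> \<kappa> * sqrt n" "(\<Sum>i<n. (b_of \<eta> (z i) - b0 (z i))\<^sup>2) / n \<le> \<kappa>\<^sup>2"
        by (auto simp: gg_def)
      obtain q where q: "likelihood n x \<eta> = likelihood n x (eta_shift a0 n t \<eta>) * exp q"
        "\<bar>t * (sqrt n * ((\<Sum>i<n. b_of \<eta> (z i)) / n - c)) + q - t\<^sup>2 * V1 / 2\<bar> \<le> \<kappa> * (2 * \<bar>t\<bar> + t\<^sup>2 * (Ka\<^sup>2 + 1) / 2) + \<bar>t\<bar> ^ 3 * Ka ^ 3 / sqrt n"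
        using tilted_likelihood[OF n supp \<kappa>(1) c h[unfolded z_def r_def] V[unfolded z_def r_def], of t] unfolding z_def by blast
      have "\<kappa> * (2 * \<bar>t\<bar> + t\<^sup>2 * (Ka\<^sup>2 + 1) / 2) + \<bar>t\<bar> ^ 3 * Ka ^ 3 / sqrt n \<le> k"
        using tk[OF t] unfolding k_def by (simp add: algebra_simps)
      then show "\<exists>q. likelihood n x \<eta> = likelihood n x (eta_shift a0 n t \<eta>) * exp q \<and> \<bar>t * U \<eta> + q - t\<^sup>2 * V1 / 2\<bar> \<le> k"
        using q unfolding U_def by (intro exI[of _ q]) linarith
    qed
    have rat: "\<bar>(\<integral>\<eta>. indicator (H n) \<eta> * likelihood n x (eta_shift a0 n t \<eta>) \<partial>Q) / wp.ZA - 1\<bar> \<le> \<kappa>"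
      using ratio[OF t] by (simp add: set_lebesgue_integral_def wp.ZA_def)
    obtain m where m: "has_bochner_integral wp.cpost (\<lambda>\<eta>. exp (t * U \<eta>)) m"
      "exp (t\<^sup>2 * V1 / 2 - k) * (1 - \<kappa>) \<le> m" "m \<le> exp (t\<^sup>2 * V1 / 2 + k) * (1 + \<kappa>)"
      using wp.mgf_tilt[OF Um UB Zp likelihood_shift_measurable likelihood_pos likelihood_le_1 tilt rat] by blast
    let ?s = "exp (t\<^sup>2 * (sqrt V2)\<^sup>2 / 2)"
    have mix: "has_bochner_integral \<mu> (\<lambda>x. exp (t * x)) (m * ?s)"
      unfolding \<mu>_def by (rule mgf_mixture[OF cpost.prob_space_axioms Uc m(1)])
    have s2: "(sqrt V2)\<^sup>2 = V2" "(sqrt (V1 + V2))\<^sup>2 = V1 + V2" using V2_nonneg vpos by (auto simp: v_def)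
    have "m * ?s \<le> exp (t\<^sup>2 * V1 / 2 + k) * (1 + \<kappa>) * ?s" using m(3) by (intro mult_right_mono) auto
    also have "\<dots> = exp (t\<^sup>2 * (V1 + V2) / 2 + k) * (1 + \<kappa>)"
      unfolding s2 by (simp add: exp_add distrib_left add_divide_distrib) (simp add: algebra_simps)
    finally have up: "m * ?s < exp (t\<^sup>2 * (V1 + V2) / 2) + \<delta>" using tk[OF t] unfolding k_def by linarith
    have "exp (t\<^sup>2 * (V1 + V2) / 2 - k) * (1 - \<kappa>) = exp (t\<^sup>2 * V1 / 2 - k) * (1 - \<kappa>) * ?s"
      unfolding s2 by (simp add: exp_add exp_diff distrib_left add_divide_distrib)
    also have "\<dots> \<le> m * ?s" using m(2) by (intro mult_right_mono) auto
    finally have lo: "exp (t\<^sup>2 * (V1 + V2) / 2) - \<delta> < m * ?s" using tk[OF t] unfolding k_def by linarith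
    have gm: "(\<integral>x. exp (t * x) \<partial>gauss (sqrt (V1 + V2))) = exp (t\<^sup>2 * (V1 + V2) / 2)"
      using has_bochner_integral_integral_eq[OF gauss_mgf[of "sqrt (V1 + V2)" t]] s2 by simp
    show "integrable \<mu> (\<lambda>x. exp (t * x)) \<and> \<bar>(\<integral>x. exp (t * x) \<partial>\<mu>) - (\<integral>x. exp (t * x) \<partial>gauss (sqrt (V1 + V2)))\<bar> < \<delta>"
      using mix up lo unfolding gm by (auto simp: has_bochner_integral_iff)
  qed
  have pG: "prob_space (gauss (sqrt (V1 + V2)))" and p\<mu>: "prob_space \<mu>"
    using gauss_real_distribution rd by (auto simp: real_distribution_def)
  have var: "\<bar>(\<Sum>i<n. (b_of \<eta> (z i) - (\<Sum>i<n. b_of \<eta> (z i)) / n)\<^sup>2) / n - V2\<bar> \<le> \<kappa>d"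
    if sq: "(\<Sum>i<n. (gg \<eta> (z i))\<^sup>2) / n \<le> \<kappa>\<^sup>2" for \<eta>
  proof -
    define b where "b i = b_of \<eta> (z i)" for i
    define m where "m = (\<Sum>i<n. b i) / n"
    define m0 where "m0 = (\<Sum>i<n. b0 (z i)) / n"
    have b01: "0 \<le> b i" "b i \<le> 1" for i by (simp_all add: b_def b_of_bounds)
    have avg01: "0 \<le> (\<Sum>i<n. h i) / n" "(\<Sum>i<n. h i) / n \<le> 1" if "\<And>i. 0 \<le> h i" "\<And>i. h i \<le> (1::real)" for h
    proof -
      show "0 \<le> (\<Sum>i<n. h i) / n" using that by (intro divide_nonneg_nonneg sum_nonneg) auto
      have "(\<Sum>i<n. h i) \<le> (\<Sum>i<n. 1)" using that by (intro sum_mono) auto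
      then show "(\<Sum>i<n. h i) / n \<le> 1" using n by simp
    qed
    have var_eq: "(\<Sum>i<n. (b i - m)\<^sup>2) / n = (\<Sum>i<n. (b i)\<^sup>2) / n - m\<^sup>2"
    proof -
      have "(\<Sum>i<n. (b i - m)\<^sup>2) = (\<Sum>i<n. (b i)\<^sup>2) - 2 * m * (\<Sum>i<n. b i) + n * m\<^sup>2"
        by (simp add: power2_diff sum.distrib sum_subtractf sum_distrib_left[symmetric] sum_distrib_right[symmetric] mult_ac)
      moreover have "(\<Sum>i<n. b i) = n * m" using n by (simp add: m_def)
      ultimately have "(\<Sum>i<n. (b i - m)\<^sup>2) = (\<Sum>i<n. (b i)\<^sup>2) - n * m\<^sup>2" by (simp add: power2_eq_square)
      then show ?thesis using n by (simp add: diff_divide_distrib)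
    qed
    have g1: "(\<Sum>i<n. \<bar>gg \<eta> (z i)\<bar>) / n \<le> \<kappa>"
    proof -
      have "(\<Sum>i<n. \<bar>gg \<eta> (z i)\<bar>) / n \<le> (\<Sum>i<n. (\<kappa> + (gg \<eta> (z i))\<^sup>2 / \<kappa>) / 2) / n"
      proof (intro divide_right_mono sum_mono)
        fix i
        have "2 * \<bar>gg \<eta> (z i)\<bar> * \<kappa> \<le> \<bar>gg \<eta> (z i)\<bar>\<^sup>2 + \<kappa>\<^sup>2" by (rule sum_squares_bound)
        then show "\<bar>gg \<eta> (z i)\<bar> \<le> (\<kappa> + (gg \<eta> (z i))\<^sup>2 / \<kappa>) / 2" using \<kappa>(1) by (simp add: field_simps power2_eq_square)
      qed simp
      also have "\<dots> = (\<kappa> + (\<Sum>i<n. (gg \<eta> (z i))\<^sup>2) / n / \<kappa>) / 2"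
        using n by (simp add: sum.distrib sum_divide_distrib[symmetric] add_divide_distrib)
      also have "\<dots> \<le> (\<kappa> + \<kappa>\<^sup>2 / \<kappa>) / 2" using sq \<kappa>(1) by (intro divide_right_mono add_left_mono) auto
      also have "\<dots> = \<kappa>" using \<kappa>(1) by (simp add: power2_eq_square)
      finally show ?thesis .
    qed
    have mm0: "\<bar>m - m0\<bar> \<le> \<kappa>"
    proof -
      have "\<bar>m - m0\<bar> = \<bar>\<Sum>i<n. gg \<eta> (z i)\<bar> / n"
        by (simp add: m_def m0_def gg_def b_def sum_subtractf diff_divide_distrib[symmetric])
      also have "\<dots> \<le> (\<Sum>i<n. \<bar>gg \<eta> (z i)\<bar>) / n" by (intro divide_right_mono sum_abs) auto
      finally show ?thesis using g1 by simp
    qed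
    have s: "\<bar>(\<Sum>i<n. (b i)\<^sup>2) / n - (\<Sum>i<n. (b0 (z i))\<^sup>2) / n\<bar> \<le> 2 * \<kappa>"
    proof -
      have "\<bar>(\<Sum>i<n. (b i)\<^sup>2) / n - (\<Sum>i<n. (b0 (z i))\<^sup>2) / n\<bar> = \<bar>\<Sum>i<n. (b i)\<^sup>2 - (b0 (z i))\<^sup>2\<bar> / n"
        by (simp add: sum_subtractf diff_divide_distrib[symmetric])
      also have "\<dots> \<le> (\<Sum>i<n. 2 * \<bar>gg \<eta> (z i)\<bar>) / n"
      proof (intro divide_right_mono order.trans[OF sum_abs] sum_mono)
        fix i
        have "\<bar>(b i)\<^sup>2 - (b0 (z i))\<^sup>2\<bar> = \<bar>b i + b0 (z i)\<bar> * \<bar>gg \<eta> (z i)\<bar>"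
          by (simp add: abs_mult[symmetric] gg_def b_def power2_eq_square algebra_simps)
        also have "\<dots> \<le> 2 * \<bar>gg \<eta> (z i)\<bar>" using b01[of i] b0_bounds[of "z i"] by (intro mult_right_mono) auto
        finally show "\<bar>(b i)\<^sup>2 - (b0 (z i))\<^sup>2\<bar> \<le> 2 * \<bar>gg \<eta> (z i)\<bar>" .
      qed simp
      also have "\<dots> = 2 * ((\<Sum>i<n. \<bar>gg \<eta> (z i)\<bar>) / n)" by (simp add: sum_distrib_left[symmetric])
      finally show ?thesis using g1 by simp
    qed
    have m2: "\<bar>m\<^sup>2 - (chi b0 F0)\<^sup>2\<bar> \<le> 4 * \<kappa>"
    proof -
      have "\<bar>m\<^sup>2 - (chi b0 F0)\<^sup>2\<bar> = \<bar>m + chi b0 F0\<bar> * \<bar>m - chi b0 F0\<bar>"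
        by (simp add: abs_mult[symmetric] power2_eq_square algebra_simps)
      also have "\<dots> \<le> 2 * (2 * \<kappa>)"
      proof (intro mult_mono)
        have "0 \<le> m" "m \<le> 1" unfolding m_def using avg01[of b] b01 by auto
        then show "\<bar>m + chi b0 F0\<bar> \<le> 2" using chi_bounds by auto
        show "\<bar>m - chi b0 F0\<bar> \<le> 2 * \<kappa>" using mm0 l1 unfolding m0_def by linarith
      qed auto
      finally show ?thesis by simp
    qed
    \<comment> \<open>7 = 2 + 1 + 4: the passage from \<open>b\<close> to \<open>b0\<close> in the
      mean of squares, the law of large numbers for the squares of \<open>b0\<close>, and the
      squared mean.\<close>
    have "\<bar>(\<Sum>i<n. (b i - m)\<^sup>2) / n - V2\<bar> \<le> 7 * \<kappa>"
      unfolding var_eq V2_eq using s l2 m2 by linarith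
    then show ?thesis using \<kappa>d unfolding m_def b_def by linarith
  qed
  have e0: "e \<ge> 0" using \<kappa> e by linarith
  have "d_BL (chi_posterior Q D n x c) (gauss (sqrt (V1 + V2))) \<le> e"
  proof (rule d_BL_le)
    fix f assume f: "f \<in> BL1"
    have close: "AE \<eta> in Q. \<eta> \<in> H n \<longrightarrow> \<bar>(\<integral>F. f (W \<eta> F) \<partial>D) - (\<integral>y. f (U \<eta> + y) \<partial>gauss (sqrt V2))\<bar> \<le> e / 4"
      using unif AE_space
    proof eventually_elim
      case (elim \<eta>)
      show ?case
      proof
        assume "\<eta> \<in> H n"
        then have sq: "(\<Sum>i<n. (gg \<eta> (z i))\<^sup>2) / n \<le> \<kappa>\<^sup>2" using elim(1) by blast
        have "W \<eta> F = U \<eta> + sqrt n * (chi (b_of \<eta>) F - (\<Sum>i<n. b_of \<eta> (z i)) / n)" for F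
          by (simp add: W_def U_def algebra_simps)
        then show "\<bar>(\<integral>F. f (W \<eta> F) \<partial>D) - (\<integral>y. f (U \<eta> + y) \<partial>gauss (sqrt V2))\<bar> \<le> e / 4"
          using clt[OF b_of_measurable[OF elim(2)] _ var[OF sq] f, of "U \<eta>"] by (simp add: b_of_bounds)
      qed
    qed
    have "\<bar>(\<integral>x. f x \<partial>chi_posterior Q D n x c) - (\<integral>x. f x \<partial>\<mu>)\<bar> \<le> 2 * \<kappa> + e / 4"
      unfolding cp \<mu>_def using e0 by (intro wp.mixture_close[OF pD Wm Um f close _ post' \<kappa>(2)]) simp
    moreover have "\<bar>(\<integral>x. f x \<partial>\<mu>) - (\<integral>x. f x \<partial>gauss (sqrt (V1 + V2)))\<bar> \<le> e / 4"
      using d_BL_ge[OF p\<mu> pG f] d2 by linarith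
    ultimately show "\<bar>(\<integral>x. f x \<partial>chi_posterior Q D n x c) - (\<integral>x. f x \<partial>gauss (sqrt (V1 + V2)))\<bar> \<le> e"
      using e e0 by linarith
  qed
  then show ?thesis unfolding nl using d_BL_nonneg[OF prob_cp pG] by simp
qed

text \<open>The constants are fixed in the order \<open>T\<close> and \<delta>,
  \<open>\<kappa>d\<close>, \<kappa>, and last the sample size; none of them depends on the sample,
  so a single event serves all the estimates.\<close>

lemma bernstein_von_mises:
  assumes \<nu>: "finite_measure \<nu>" "sets \<nu> = sets borel"
    and DP: "\<And>n x. n \<ge> 1 \<Longrightarrow> dirichlet_process (dp_posterior_base \<nu> n x) (D n x)"
    and post: "tendsto_in_outer_prob M (\<lambda>n \<omega>. measure (eta_posterior Q n (\<lambda>i. X i \<omega>)) (H n)) 1"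
    and ratio: "\<And>t::real. tendsto_in_outer_prob M
           (\<lambda>n \<omega>. (LINT \<eta>:H n|Q. likelihood n (\<lambda>i. X i \<omega>) (eta_shift a0 n t \<eta>)) /
                  (LINT \<eta>:H n|Q. likelihood n (\<lambda>i. X i \<omega>) \<eta>)) 1"
  shows "semiparametric_BvM M X a0 b0 F0 Q D"
  unfolding semiparametric_BvM_def tendsto_in_outer_prob_whp
proof (intro allI impI)
  fix c and e :: real assume c: "efficient_sequence M X a0 b0 F0 c" and e: "e > 0"
  have e4: "e / 4 > 0" using e by simp
  define v where "v = V1 + V2"
  obtain T \<delta> where T: "finite T" and \<delta>: "\<delta> > 0"
    and cl: "\<And>\<mu>. real_distribution \<mu> \<Longrightarrow>
       (\<And>t. t \<in> T \<Longrightarrow> integrable \<mu> (\<lambda>x. exp (t * x)) \<and> \<bar>(\<integral>x. exp (t * x) \<partial>\<mu>) - (\<integral>x. exp (t * x) \<partial>gauss (sqrt v))\<bar> < \<delta>) \<Longrightarrow>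
       d_BL \<mu> (gauss (sqrt v)) < e / 4"
    using mgf_close_imp_d_BL_less[OF gauss_real_distribution _ e4, of "sqrt v"] gauss_mgf
    by (metis has_bochner_integral_iff)
  obtain \<kappa>d where \<kappa>d: "\<kappa>d > 0"
    and clt: "\<forall>\<^sub>F n in sequentially. \<forall>x D b f u. dirichlet_process (dp_posterior_base \<nu> n x) D \<longrightarrow>
      b \<in> borel_measurable borel \<longrightarrow> (\<forall>z. 0 \<le> b z \<and> b z \<le> 1) \<longrightarrow>
      \<bar>(\<Sum>i<n. (b (fst (x i)) - (\<Sum>i<n. b (fst (x i))) / n)\<^sup>2) / n - (sqrt V2)\<^sup>2\<bar> \<le> \<kappa>d \<longrightarrow> f \<in> BL1 \<longrightarrow>
      \<bar>(\<integral>F. f (u + sqrt n * (chi b F - (\<Sum>i<n. b (fst (x i))) / n)) \<partial>D) - (\<integral>y. f (u + y) \<partial>gauss (sqrt V2))\<bar> \<le> e / 4"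
    using dirichlet_process_clt[OF \<nu> e4, of "sqrt V2"] by blast
  let ?B = "\<lambda>t. 1 + 2 * \<bar>t\<bar> + t\<^sup>2 * (Ka\<^sup>2 + 1) / 2"
  let ?w = "\<lambda>t. t\<^sup>2 * v / 2"
  \<comment> \<open>One tolerance for all requirements: apart from positivity, these are finitely
    many strict inequalities that hold at 0, and by continuity they persist for small positive
    \<kappa>.\<close>
  have "\<forall>\<^sub>F \<kappa> in at_right 0. \<kappa> < min 1 (min (e / 8) (\<kappa>d / 7)) \<and> 0 < \<kappa> \<and>
     (\<forall>t\<in>T. exp (?w t + \<kappa> * ?B t) * (1 + \<kappa>) < exp (?w t) + \<delta> \<and> exp (?w t) - \<delta> < exp (?w t - \<kappa> * ?B t) * (1 - \<kappa>))"
  proof (intro eventually_conj eventually_ball_finite[OF T] ballI)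
    show "\<forall>\<^sub>F \<kappa> in at_right 0. \<kappa> < min 1 (min (e / 8) (\<kappa>d / 7))"
      using e \<kappa>d by (intro eventually_at_rightI[of 0 "min 1 (min (e / 8) (\<kappa>d / 7))"]) auto
    show "\<forall>\<^sub>F \<kappa> in at_right 0. (0::real) < \<kappa>" by (rule eventually_at_right_less)
    fix t assume "t \<in> T"
    have "((\<lambda>\<kappa>. exp (?w t + \<kappa> * ?B t) * (1 + \<kappa>)) \<longlongrightarrow> exp (?w t + 0 * ?B t) * (1 + 0)) (at_right 0)"
      by (intro tendsto_intros)
    then show "\<forall>\<^sub>F \<kappa> in at_right 0. exp (?w t + \<kappa> * ?B t) * (1 + \<kappa>) < exp (?w t) + \<delta>"
      using \<delta> by (intro order_tendstoD(2)) auto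
    have "((\<lambda>\<kappa>. exp (?w t - \<kappa> * ?B t) * (1 - \<kappa>)) \<longlongrightarrow> exp (?w t - 0 * ?B t) * (1 - 0)) (at_right 0)"
      by (intro tendsto_intros)
    then show "\<forall>\<^sub>F \<kappa> in at_right 0. exp (?w t) - \<delta> < exp (?w t - \<kappa> * ?B t) * (1 - \<kappa>)"
      using \<delta> by (intro order_tendstoD(1)) auto
  qed
  then obtain \<kappa> where \<kappa>m: "\<kappa> < min 1 (min (e / 8) (\<kappa>d / 7))" "0 < \<kappa>"
    and \<kappa>T: "\<forall>t\<in>T. exp (?w t + \<kappa> * ?B t) * (1 + \<kappa>) < exp (?w t) + \<delta> \<and> exp (?w t) - \<delta> < exp (?w t - \<kappa> * ?B t) * (1 - \<kappa>)"
    using eventually_happens' trivial_limit_at_right_real by blast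
  have \<kappa>: "0 < \<kappa>" "\<kappa> < 1" "\<kappa> \<le> e / 8" "7 * \<kappa> \<le> \<kappa>d" using \<kappa>m by auto
  have evT: "\<forall>\<^sub>F n in sequentially. \<forall>t\<in>T. \<bar>t\<bar> ^ 3 * Ka ^ 3 / sqrt (real n) \<le> \<kappa>"
  proof (intro eventually_ball_finite[OF T] ballI)
    fix t assume "t \<in> T"
    have "(\<lambda>n. \<bar>t\<bar> ^ 3 * Ka ^ 3 / sqrt (real n)) \<longlonglongrightarrow> 0" by real_asymp
    from order_tendstoD(2)[OF this \<kappa>(1)] show "\<forall>\<^sub>F n in sequentially. \<bar>t\<bar> ^ 3 * Ka ^ 3 / sqrt (real n) \<le> \<kappa>"
      by (auto elim: eventually_mono)
  qed
  have hV: "(\<lambda>w. of_bool (fst (snd w)) * (a0 (fst w))\<^sup>2 * b0 (fst w) * (1 - b0 (fst w))) \<in> borel_measurable (obs_space :: 'z obs measure)"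
    and hb: "(\<lambda>w. b0 (fst w)) \<in> borel_measurable (obs_space :: 'z obs measure)"
    and hb2: "(\<lambda>w. (b0 (fst w))\<^sup>2) \<in> borel_measurable (obs_space :: 'z obs measure)"
    unfolding obs_space_def by measurable
  have w1: "whp M (\<lambda>n \<omega>. \<bar>(\<Sum>i<n. of_bool (fst (snd (X i \<omega>))) * (a0 (fst (X i \<omega>)))\<^sup>2 * b0 (fst (X i \<omega>)) * (1 - b0 (fst (X i \<omega>)))) / n - V1\<bar> \<le> \<kappa>)"
    unfolding V1_P0[symmetric]
  proof (rule whp_lln[OF hV _ \<kappa>(1)])
    show "\<bar>of_bool (fst (snd w)) * (a0 (fst w))\<^sup>2 * b0 (fst w) * (1 - b0 (fst w))\<bar> \<le> 1 * Ka\<^sup>2 * 1 * 1" for w :: "'z obs"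
      unfolding abs_mult using a0_bounds[of "fst w"] b0_bounds[of "fst w"] Ka_ge
      by (intro mult_mono) (auto intro!: power_mono)
  qed
  have w2: "whp M (\<lambda>n \<omega>. \<bar>(\<Sum>i<n. b0 (fst (X i \<omega>))) / n - chi b0 F0\<bar> \<le> \<kappa>)"
    using whp_lln[OF hb _ \<kappa>(1), of 1] b0_bounds by (simp add: chi_def integral_P0_fst)
  have w3: "whp M (\<lambda>n \<omega>. \<bar>(\<Sum>i<n. (b0 (fst (X i \<omega>)))\<^sup>2) / n - (\<integral>z. (b0 z)\<^sup>2 \<partial>F0)\<bar> \<le> \<kappa>)"
    using whp_lln[OF hb2 _ \<kappa>(1), of 1] b0_bounds integral_P0_fst[of "\<lambda>z. (b0 z)\<^sup>2"] by (simp add: abs_square_le_1)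
  have w4: "whp M (\<lambda>n \<omega>. \<bar>sqrt n * (c n \<omega> - (chi b0 F0 + (\<Sum>i<n. influence a0 b0 F0 (X i \<omega>)) / n)) - 0\<bar> \<le> \<kappa>)"
    using c \<kappa>(1) unfolding efficient_sequence_def tendsto_in_outer_prob_whp by blast
  have w5: "whp M (\<lambda>n \<omega>. \<bar>measure (eta_posterior Q n (\<lambda>i. X i \<omega>)) (H n) - 1\<bar> \<le> \<kappa>)"
    using post \<kappa>(1) unfolding tendsto_in_outer_prob_whp by blast
  have w6: "whp M (\<lambda>n \<omega>. \<forall>t\<in>T. \<bar>(LINT \<eta>:H n|Q. likelihood n (\<lambda>i. X i \<omega>) (eta_shift a0 n t \<eta>)) /
                  (LINT \<eta>:H n|Q. likelihood n (\<lambda>i. X i \<omega>) \<eta>) - 1\<bar> \<le> \<kappa>)"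
    by (rule whp_ball_finite[OF T]) (use ratio \<kappa>(1) in \<open>auto simp: tendsto_in_outer_prob_whp\<close>)
  \<comment> \<open>The likelihood ratios enter for the finitely many arguments in \<open>T\<close>
    only, which is what makes a finite intersection of events possible.\<close>
  have good: "whp M (\<lambda>n \<omega>.
       \<bar>(\<Sum>i<n. of_bool (fst (snd (X i \<omega>))) * (a0 (fst (X i \<omega>)))\<^sup>2 * b0 (fst (X i \<omega>)) * (1 - b0 (fst (X i \<omega>)))) / n - V1\<bar> \<le> \<kappa> \<and>
       \<bar>(\<Sum>i<n. b0 (fst (X i \<omega>))) / n - chi b0 F0\<bar> \<le> \<kappa> \<and>
       \<bar>(\<Sum>i<n. (b0 (fst (X i \<omega>)))\<^sup>2) / n - (\<integral>z. (b0 z)\<^sup>2 \<partial>F0)\<bar> \<le> \<kappa> \<and>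
       \<bar>sqrt n * (c n \<omega> - (chi b0 F0 + (\<Sum>i<n. influence a0 b0 F0 (X i \<omega>)) / n)) - 0\<bar> \<le> \<kappa> \<and>
       \<bar>measure (eta_posterior Q n (\<lambda>i. X i \<omega>)) (H n) - 1\<bar> \<le> \<kappa> \<and>
       (\<forall>t\<in>T. \<bar>(LINT \<eta>:H n|Q. likelihood n (\<lambda>i. X i \<omega>) (eta_shift a0 n t \<eta>)) /
                  (LINT \<eta>:H n|Q. likelihood n (\<lambda>i. X i \<omega>) \<eta>) - 1\<bar> \<le> \<kappa>) \<and>
       (\<forall>i. snd (snd (X i \<omega>)) \<longrightarrow> fst (snd (X i \<omega>))) \<and>
       (AE \<eta> in Q. \<eta> \<in> H n \<longrightarrow>
         \<bar>\<Sum>i<n. (of_bool (fst (snd (X i \<omega>))) * a0 (fst (X i \<omega>)) - 1) * gg \<eta> (fst (X i \<omega>))\<bar> \<le> \<kappa> * sqrt n \<and>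
         (\<Sum>i<n. (gg \<eta> (fst (X i \<omega>)))\<^sup>2) / n \<le> \<kappa>\<^sup>2))" (is "whp M ?G")
    by (intro whp_conj w1 w2 w3 w4 w5 w6 whp_support whp_uniform[OF \<kappa>(1)])
  show "whp M (\<lambda>n \<omega>. \<bar>d_BL (chi_posterior Q (D n (\<lambda>i. X i \<omega>)) n (\<lambda>i. X i \<omega>) (c n \<omega>)) (normal_law 0 (eff_var a0 b0 F0)) - 0\<bar> \<le> e)"
  proof (rule whp_mono[OF good])
    show "\<forall>\<^sub>F n in sequentially. \<forall>\<omega>\<in>space M. ?G n \<omega> \<longrightarrow>
       \<bar>d_BL (chi_posterior Q (D n (\<lambda>i. X i \<omega>)) n (\<lambda>i. X i \<omega>) (c n \<omega>)) (normal_law 0 (eff_var a0 b0 F0)) - 0\<bar> \<le> e"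
      using clt evT eventually_ge_at_top[of 1]
    proof (eventually_elim, intro ballI impI)
      fix n \<omega>
      assume clt_n: "\<forall>x D b f u. dirichlet_process (dp_posterior_base \<nu> n x) D \<longrightarrow>
      b \<in> borel_measurable borel \<longrightarrow> (\<forall>z. 0 \<le> b z \<and> b z \<le> 1) \<longrightarrow>
      \<bar>(\<Sum>i<n. (b (fst (x i)) - (\<Sum>i<n. b (fst (x i))) / n)\<^sup>2) / n - (sqrt V2)\<^sup>2\<bar> \<le> \<kappa>d \<longrightarrow> f \<in> BL1 \<longrightarrow>
      \<bar>(\<integral>F. f (u + sqrt n * (chi b F - (\<Sum>i<n. b (fst (x i))) / n)) \<partial>D) - (\<integral>y. f (u + y) \<partial>gauss (sqrt V2))\<bar> \<le> e / 4"
        and tn: "\<forall>t\<in>T. \<bar>t\<bar> ^ 3 * Ka ^ 3 / sqrt (real n) \<le> \<kappa>" and n: "1 \<le> n" and G: "?G n \<omega>"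
      have "\<bar>d_BL (chi_posterior Q (D n (\<lambda>i. X i \<omega>)) n (\<lambda>i. X i \<omega>) (c n \<omega>)) (normal_law 0 (eff_var a0 b0 F0))\<bar> \<le> e"
      proof (rule d_BL_on_good_event[OF n DP[OF n] \<kappa> _ cl[unfolded v_def]])
        show "\<bar>(\<integral>F. f (u + sqrt n * (chi b F - (\<Sum>i<n. b (fst (X i \<omega>))) / n)) \<partial>D n (\<lambda>i. X i \<omega>)) - (\<integral>y. f (u + y) \<partial>gauss (sqrt V2))\<bar> \<le> e / 4"
          if "b \<in> borel_measurable borel" "\<forall>z. 0 \<le> b z \<and> b z \<le> 1"
            "\<bar>(\<Sum>i<n. (b (fst (X i \<omega>)) - (\<Sum>i<n. b (fst (X i \<omega>))) / n)\<^sup>2) / n - V2\<bar> \<le> \<kappa>d" "f \<in> BL1" for b f u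
          using clt_n[rule_format, OF DP[OF n] that(1) _ _ that(4)] that(2,3) V2_nonneg by simp
        show "\<bar>t\<bar> ^ 3 * Ka ^ 3 / sqrt n \<le> \<kappa> \<and>
          exp (t\<^sup>2 * (V1 + V2) / 2 + \<kappa> * (1 + 2 * \<bar>t\<bar> + t\<^sup>2 * (Ka\<^sup>2 + 1) / 2)) * (1 + \<kappa>) < exp (t\<^sup>2 * (V1 + V2) / 2) + \<delta> \<and>
          exp (t\<^sup>2 * (V1 + V2) / 2) - \<delta> < exp (t\<^sup>2 * (V1 + V2) / 2 - \<kappa> * (1 + 2 * \<bar>t\<bar> + t\<^sup>2 * (Ka\<^sup>2 + 1) / 2)) * (1 - \<kappa>)"
          if "t \<in> T" for t using tn \<kappa>T that unfolding v_def by blast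
        have "\<bar>measure (eta_posterior Q n (\<lambda>i. X i \<omega>)) (H n) - 1\<bar> \<le> \<kappa>" using G by blast
        then show "1 - \<kappa> \<le> measure (eta_posterior Q n (\<lambda>i. X i \<omega>)) (H n)" by linarith
      qed (use G in simp_all)
      then show "\<bar>d_BL (chi_posterior Q (D n (\<lambda>i. X i \<omega>)) n (\<lambda>i. X i \<omega>) (c n \<omega>)) (normal_law 0 (eff_var a0 b0 F0)) - 0\<bar> \<le> e"
        by simp
    qed
  qed
qed

end

theorem theorem1:
  fixes M :: "'m measure"
    and X :: "nat \<Rightarrow> 'm \<Rightarrow> 'z::polish_space obs"
    and a0 b0 f0 :: "'z \<Rightarrow> real"
    and F0 \<mu> \<nu> :: "'z measure"
    and Q :: "'z eta measure"
    and D :: "nat \<Rightarrow> (nat \<Rightarrow> 'z obs) \<Rightarrow> 'z measure measure"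
    and H :: "nat \<Rightarrow> 'z eta set"
  assumes "a0 \<in> borel_measurable borel" and "b0 \<in> borel_measurable borel"
    and "prob_space F0" and "sets F0 = sets borel"
    and "\<exists>\<epsilon>>0. \<forall>z. \<epsilon> \<le> 1 / a0 z \<and> 1 / a0 z \<le> 1 - \<epsilon> \<and> \<epsilon> \<le> b0 z \<and> b0 z \<le> 1 - \<epsilon>"
    and "sigma_finite_measure \<mu>" and "sets \<mu> = sets borel"
    and "f0 \<in> borel_measurable borel"
    and "F0 = density \<mu> (\<lambda>z. ennreal (f0 z))"
    and "\<exists>\<epsilon>>0. \<exists>C. \<forall>z. \<epsilon> \<le> f0 z \<and> f0 z \<le> C"
    and "prob_space M"
    and "prob_space.indep_vars M (\<lambda>_. obs_space) X UNIV"
    and "\<And>i. distr M obs_space (X i) = obs_law a0 b0 F0"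
    and "eta_prior Q"
    and "finite_measure \<nu>" and "sets \<nu> = sets borel"
    and "\<And>n x. n \<ge> 1 \<Longrightarrow> dirichlet_process (dp_posterior_base \<nu> n x) (D n x)"
    and "\<And>n. H n \<in> sets Q"
    and "tendsto_in_outer_prob M (\<lambda>n \<omega>. measure (eta_posterior Q n (\<lambda>i. X i \<omega>)) (H n)) 1"
    and "(\<lambda>n. SUP \<eta>\<in>H n. L2_norm F0 (\<lambda>z. b_of \<eta> z - b0 z)) \<longlonglongrightarrow> 0"
    and "tendsto_in_outer_prob M
           (\<lambda>n \<omega>. SUP \<eta>\<in>H n. \<bar>emp_process (obs_law a0 b0 F0) n (\<lambda>i. X i \<omega>)
                                   (\<lambda>(z, _). b_of \<eta> z - b0 z)\<bar>) 0"
    and "\<And>t::real. tendsto_in_outer_prob M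
           (\<lambda>n \<omega>. (LINT \<eta>:H n|Q. likelihood n (\<lambda>i. X i \<omega>) (eta_shift a0 n t \<eta>)) /
                  (LINT \<eta>:H n|Q. likelihood n (\<lambda>i. X i \<omega>) \<eta>)) 1"
  shows "semiparametric_BvM M X a0 b0 F0 Q D"
proof -
  obtain \<epsilon> where \<epsilon>: "\<epsilon> > 0" "\<And>z. \<epsilon> \<le> 1 / a0 z \<and> 1 / a0 z \<le> 1 - \<epsilon> \<and> \<epsilon> \<le> b0 z \<and> b0 z \<le> 1 - \<epsilon>"
    using assms(5) by blast
  interpret causal_sieve a0 b0 F0 \<epsilon> M X Q H
  proof (intro causal_sieve.intro causal_sample.intro causal_model.intro causal_sample_axioms.intro causal_sieve_axioms.intro)
    show "eta_prior Q" "prob_space F0" "prob_space M" by fact+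
  qed (use assms \<epsilon> in auto)
  show ?thesis by (rule bernstein_von_mises[OF assms(15,16,17,19,22)])
qed

end
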